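(* Let $k,c>0$ and let $f,g\in\mathcal{D}'(\mathbb{R})$. Then the distribution $v$ given by $$\langle v(t),\varphi\rangle:=\left\langle f,\psi_t(t)\ast\varphi\right\rangle+\left\langle g+\tfrac{k}{2}f,\psi(t)\ast\varphi\right\rangle,\qquad \varphi\in\mathcal{C}_0^\infty(\mathbb{R}),\ t\in\mathbb{R},$$ is the unique solution in $\mathcal{C}^1(\mathbb{R},\mathcal{D}'(\mathbb{R}))$, in the sense of distributions, of the problem $$v_{tt}=c^2v_{xx}+\tfrac{k^2}{4}v,\qquad v(0)=f,\qquad v_t(0)=g+\tfrac{k}{2}f.$$
   Context: Let $\alpha=\frac{k}{4c}$ and $$\psi(x,t)=\operatorname{sgn}(t)\,\frac{1}{2c}\,I_0\!\left(2\alpha\sqrt{c^2t^2-x^2}\right)\mathcal{X}_{[-c|t|,c|t|]}(x),$$ $$\psi_t(\cdot,t)=\frac12\left[\delta(\cdot-ct)+\delta(\cdot+ct)\right]+\alpha c|t|\,\frac{I_0'\!\left(2\alpha\sqrt{c^2t^2-\cdot^2}\right)}{\sqrt{c^2t^2-\cdot^2}}\,\mathcal{X}_{[-c|t|,c|t|]}(\cdot),$$ where $I_0$ is the modified Bessel function of the first kind of order $0$, $\mathcal{X}_\Omega$ is the characteristic function of $\Omega$, $\delta(\cdot-a)$ is the Dirac delta at $x=a$, $\psi(\cdot,0)=0$, and $I_0'(2\alpha z)/z$ is understood by its limit $\alpha$ at $z=0$. We write $\psi(t)=\psi(\cdot,t)$, $\psi_t(t)=\psi_t(\cdot,t)$;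 both are compactly supported distributions in $x$, and $\ast$ is convolution in $x$, so $\psi(t)\ast\varphi,\psi_t(t)\ast\varphi\in\mathcal{C}_0^\infty(\mathbb{R})$. $\mathcal{C}^1(\mathbb{R},\mathcal{D}'(\mathbb{R}))$ is the space of maps $t\mapsto v(t)\in\mathcal{D}'(\mathbb{R})$ for which there is a map $t\mapsto v_t(t)\in\mathcal{D}'(\mathbb{R})$ such that, for every $\varphi\in\mathcal{C}_0^\infty(\mathbb{R})$ and $t\in\mathbb{R}$, $\left\langle \frac{v(t+h)-v(t)}{h},\varphi\right\rangle\to\langle v_t(t),\varphi\rangle$ and $\langle v_t(t+h),\varphi\rangle\to\langle v_t(t),\varphi\rangle$ as $h\to0$. A $v\in\mathcal{C}^1(\mathbb{R},\mathcal{D}'(\mathbb{R}))$ solves the equation in the sense of distributions if it holds in $\mathcal{D}'(\mathbb{R}\times\mathbb{R})$, i.e. $\int_{\mathbb{R}}\left\langle v(t),\left(\phi_{tt}-c^2\phi_{xx}-\frac{k^2}{4}\phi\right)(\cdot,t)\right\rangle dt=0$ for all $\phi\in\mathcal{C}_0^\infty(\mathbb{R}^2)$. The initial conditions are equalities in $\mathcal{D}'(\mathbb{R})$ at $t=0$. *)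

theory Defs
  imports "HOL-Analysis.Analysis"
begin

section \<open>Test functions and distributions\<close>

text \<open>
  Scalars range over a type \<open>'a\<close> of sort \<open>{real_normed_field, euclidean_space}\<close>, so that
  real and complex distributions are both covered.
\<close>

primrec k_times_differentiable ::
    "nat \<Rightarrow> ('b::real_normed_vector \<Rightarrow> 'a::real_normed_vector) \<Rightarrow> bool" where
  "k_times_differentiable 0 \<phi> \<longleftrightarrow> continuous_on UNIV \<phi>"
| "k_times_differentiable (Suc n) \<phi> \<longleftrightarrow>
     (\<forall>x. \<phi> differentiable (at x)) \<and>
     (\<forall>e. k_times_differentiable n (\<lambda>x. frechet_derivative \<phi> (at x) e))"

definition smooth :: "('b::real_normed_vector \<Rightarrow> 'a::real_normed_vector) \<Rightarrow> bool" where
  "smooth \<phi> \<longleftrightarrow> (\<forall>n. k_times_differentiable n \<phi>)"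

definition supp :: "('b::topological_space \<Rightarrow> 'a::zero) \<Rightarrow> 'b set" where
  "supp \<phi> = closure {x. \<phi> x \<noteq> 0}"

definition test_functions :: "('b::real_normed_vector \<Rightarrow> 'a::real_normed_vector) set" where
  "test_functions = {\<phi>. smooth \<phi> \<and> compact (supp \<phi>)}"

definition vderiv :: "(real \<Rightarrow> 'a::real_normed_vector) \<Rightarrow> real \<Rightarrow> 'a" where
  "vderiv \<phi> x = vector_derivative \<phi> (at x)"

text \<open>
  HOL functionals are total, so a distribution is given the value 0 outside the test functions.
  Equality of distributions is then equality of HOL functions.  Continuity is expressed by the
  usual seminorm estimate on each compact set.
\<close>

definition distributions ::
    "((real \<Rightarrow> 'a::{real_normed_field,euclidean_space}) \<Rightarrow> 'a) set" where
  "distributions = {u.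
     (\<forall>\<phi>. \<phi> \<notin> test_functions \<longrightarrow> u \<phi> = 0) \<and>
     (\<forall>\<phi>\<in>test_functions. \<forall>\<theta>\<in>test_functions. \<forall>a b.
        u (\<lambda>x. a * \<phi> x + b * \<theta> x) = a * u \<phi> + b * u \<theta>) \<and>
     (\<forall>K. compact K \<longrightarrow> (\<exists>C N. \<forall>\<phi>\<in>test_functions. supp \<phi> \<subseteq> K \<longrightarrow>
        norm (u \<phi>) \<le> C * (\<Sum>j\<le>N. (SUP x. norm ((vderiv ^^ j) \<phi> x)))))}"

definition on_test_functions ::
    "((real \<Rightarrow> 'a::real_normed_vector) \<Rightarrow> 'a) \<Rightarrow> (real \<Rightarrow> 'a) \<Rightarrow> 'a" where
  "on_test_functions u = (\<lambda>\<phi>. if \<phi> \<in> test_functions then u \<phi> else 0)"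

definition dist_of_fun ::
    "(real \<Rightarrow> real) \<Rightarrow> (real \<Rightarrow> 'a::{real_normed_field,euclidean_space}) \<Rightarrow> 'a" where
  "dist_of_fun F = on_test_functions (\<lambda>\<phi>. LINT x|lborel. F x *\<^sub>R \<phi> x)"

definition dirac_delta :: "real \<Rightarrow> (real \<Rightarrow> 'a::real_normed_vector) \<Rightarrow> 'a" where
  "dirac_delta a = on_test_functions (\<lambda>\<phi>. \<phi> a)"

definition dist_convolution ::
    "((real \<Rightarrow> 'a) \<Rightarrow> 'a) \<Rightarrow> (real \<Rightarrow> 'a) \<Rightarrow> real \<Rightarrow> 'a" (infixl "\<star>" 75) where
  "u \<star> \<phi> = (\<lambda>x. u (\<lambda>y. \<phi> (x - y)))"

text \<open>\<open>dist_C1_deriv v v'\<close>: the curve \<open>v\<close> is continuously differentiable as a map from the reals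
  into the distributions (tested pointwise), with derivative \<open>v'\<close>.\<close>

definition dist_C1_deriv ::
    "(real \<Rightarrow> (real \<Rightarrow> 'a::{real_normed_field,euclidean_space}) \<Rightarrow> 'a) \<Rightarrow>
     (real \<Rightarrow> (real \<Rightarrow> 'a) \<Rightarrow> 'a) \<Rightarrow> bool" where
  "dist_C1_deriv v v' \<longleftrightarrow>
     (\<forall>t. v t \<in> distributions) \<and> (\<forall>t. v' t \<in> distributions) \<and>
     (\<forall>\<phi>\<in>test_functions. \<forall>t.
        ((\<lambda>h. (v (t + h) \<phi> - v t \<phi>) /\<^sub>R h) \<longlongrightarrow> v' t \<phi>) (at 0) \<and>
        ((\<lambda>h. v' (t + h) \<phi>) \<longlongrightarrow> v' t \<phi>) (at 0))"


section \<open>The Cauchy problem\<close>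

text \<open>Points of the plane are written \<open>(x, t)\<close>.\<close>

definition partial_x :: "(real \<times> real \<Rightarrow> 'a::real_normed_vector) \<Rightarrow> real \<times> real \<Rightarrow> 'a" where
  "partial_x \<phi> = (\<lambda>(x, t). vector_derivative (\<lambda>s. \<phi> (s, t)) (at x))"

definition partial_t :: "(real \<times> real \<Rightarrow> 'a::real_normed_vector) \<Rightarrow> real \<times> real \<Rightarrow> 'a" where
  "partial_t \<phi> = (\<lambda>(x, t). vector_derivative (\<lambda>s. \<phi> (x, s)) (at t))"

text \<open>The weak form of \<open>v\<^sub>t\<^sub>t = c\<^sup>2 v\<^sub>x\<^sub>x + (k\<^sup>2/4) v\<close>.  The time integral is required to
  exist and to vanish, since \<open>lebesgue_integral\<close> is 0 on non-integrable functions.\<close>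

definition weak_solution ::
    "real \<Rightarrow> real \<Rightarrow> (real \<Rightarrow> (real \<Rightarrow> 'a::{real_normed_field,euclidean_space}) \<Rightarrow> 'a) \<Rightarrow> bool" where
  "weak_solution k c v \<longleftrightarrow>
     (\<forall>\<phi>\<in>test_functions.
        has_bochner_integral lborel
          (\<lambda>t. v t (\<lambda>x. partial_t (partial_t \<phi>) (x, t)
                        - c\<^sup>2 *\<^sub>R partial_x (partial_x \<phi>) (x, t)
                        - (k\<^sup>2 / 4) *\<^sub>R \<phi> (x, t)))
          0)"

definition solves_cauchy_problem ::
    "real \<Rightarrow> real \<Rightarrow> ((real \<Rightarrow> 'a::{real_normed_field,euclidean_space}) \<Rightarrow> 'a) \<Rightarrow>
     ((real \<Rightarrow> 'a) \<Rightarrow> 'a) \<Rightarrow> (real \<Rightarrow> (real \<Rightarrow> 'a) \<Rightarrow> 'a) \<Rightarrow> bool" where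
  "solves_cauchy_problem k c v0 v1 v \<longleftrightarrow>
     (\<exists>v'. dist_C1_deriv v v' \<and> weak_solution k c v \<and> v 0 = v0 \<and> v' 0 = v1)"


section \<open>The fundamental solution\<close>

text \<open>Power series of the modified Bessel function of the first kind, order 0.\<close>

definition bessel_I0 :: "real \<Rightarrow> real" where
  "bessel_I0 x = (\<Sum>n. (x / 2) ^ (2 * n) / (fact n)\<^sup>2)"

definition psi_fun :: "real \<Rightarrow> real \<Rightarrow> real \<Rightarrow> real \<Rightarrow> real" where
  "psi_fun k c t x =
     (let \<alpha> = k / (4 * c) in
      sgn t * (1 / (2 * c)) * bessel_I0 (2 * \<alpha> * sqrt (c\<^sup>2 * t\<^sup>2 - x\<^sup>2))
        * indicator {- c * \<bar>t\<bar> .. c * \<bar>t\<bar>} x)"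

text \<open>The density of the absolutely continuous part of \<open>\<psi>\<^sub>t\<close>; at \<open>z = 0\<close> the quotient
  takes its limit \<open>\<alpha>\<close>.\<close>

definition psi_t_fun :: "real \<Rightarrow> real \<Rightarrow> real \<Rightarrow> real \<Rightarrow> real" where
  "psi_t_fun k c t x =
     (let \<alpha> = k / (4 * c); z = sqrt (c\<^sup>2 * t\<^sup>2 - x\<^sup>2) in
      \<alpha> * c * \<bar>t\<bar> * (if z = 0 then \<alpha> else deriv bessel_I0 (2 * \<alpha> * z) / z)
        * indicator {- c * \<bar>t\<bar> .. c * \<bar>t\<bar>} x)"

definition psi ::
    "real \<Rightarrow> real \<Rightarrow> real \<Rightarrow> (real \<Rightarrow> 'a::{real_normed_field,euclidean_space}) \<Rightarrow> 'a" where
  "psi k c t = dist_of_fun (psi_fun k c t)"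

definition psi_t ::
    "real \<Rightarrow> real \<Rightarrow> real \<Rightarrow> (real \<Rightarrow> 'a::{real_normed_field,euclidean_space}) \<Rightarrow> 'a" where
  "psi_t k c t = (\<lambda>\<phi>. (1 / 2) *\<^sub>R (dirac_delta (c * t) \<phi> + dirac_delta (- (c * t)) \<phi>)
                        + dist_of_fun (psi_t_fun k c t) \<phi>)"

end

theory Submission
  imports Defs
begin

text \<open>
  With \<open>\<alpha> = k / (4 c)\<close>, the kernel is \<open>\<psi>(x,t) = sgn t F (c\<^sup>2 t\<^sup>2 - x\<^sup>2) / (2 c)\<close> inside the light cone, where
  \<open>F (z\<^sup>2) = I\<^sub>0 (2 \<alpha> z)\<close> is entire and \<open>F' + s F'' = \<alpha>\<^sup>2 F\<close>.  Substituting \<open>y = c t s\<close> turns the convolutions into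
  integrals over the fixed interval \<open>[-1,1]\<close>, and differentiation under the integral gives
  \<open>(\<psi> * \<theta>)\<^sub>t = \<psi>\<^sub>t * \<theta>\<close> and \<open>(\<psi>\<^sub>t * \<theta>)\<^sub>t = \<psi> * L \<theta>\<close> with \<open>L \<theta> = c\<^sup>2 \<theta>'' + (k\<^sup>2 / 4) \<theta>\<close>.  By transposition
  \<open>v'' = v \<circ> L\<close>.

  By the uniform boundedness principle the product rule holds for the pairing of a \<open>C\<^sup>1\<close> curve of distributions
  with a \<open>C\<^sup>1\<close> curve of test functions.  For a test function \<open>\<phi>\<close> on the plane it yields
  \<open>(v(\<phi>\<^sub>t) - v'(\<phi>))' = v(\<phi>\<^sub>t\<^sub>t - L \<phi>)\<close>, hence the weak equation.

  Conversely, testing a weak solution \<open>w\<close> against products \<open>\<rho>(t) \<theta>(x)\<close> and applying the lemma of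
  du Bois-Reymond gives \<open>w'' = w \<circ> L\<close>; then \<open>w'(t) (\<psi>(T-t) * \<theta>) + w(t) (\<psi>\<^sub>t(T-t) * \<theta>)\<close> is constant
  in \<open>t\<close>, so that \<open>w(T)\<close> is determined by the initial data.
\<close>

section \<open>Test functions on the line\<close>

text \<open>Differentiability in t is given only on each fixed test function, whereas the weak
  equation and the uniqueness argument pair the solution with test functions that themselves move
  with t. Equicontinuity on compact time intervals closes this gap. Test functions supported in a
  fixed compact set form a Frechet space and not a Banach space, so they are encoded as sequences of
  derivatives to make Baire's theorem available. The kernels jump at the edge of the cone and change
  sign at t = 0. In the rescaled variable the Jacobian absorbs the sign, so that the integrands are
  smooth in t across 0, and the two Dirac masses return as boundary terms of an integration by parts
  in s. A solution is only C^1, so a second time derivative has to be extracted from the weak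
  equation before the constancy argument can start. That argument runs the propagators backwards
  from time T: at t = T they are 0 and the identity, at t = 0 they reproduce the formula of the
  statement.\<close>

definition derivative_tower :: "(nat \<Rightarrow> real \<Rightarrow> 'a::real_normed_vector) \<Rightarrow> bool" where
  "derivative_tower F \<longleftrightarrow> (\<forall>n x. (F n has_vector_derivative F (Suc n) x) (at x))"

lemma derivative_towerD:
  "derivative_tower F \<Longrightarrow> (F n has_vector_derivative F (Suc n) x) (at x)"
  by (simp add: derivative_tower_def)

lemma derivative_tower_combine:
  fixes F G :: "nat \<Rightarrow> real \<Rightarrow> 'a::real_normed_algebra"
  assumes "derivative_tower F" "derivative_tower G"
  shows "derivative_tower (\<lambda>n x. a * F n x + b * G n x)"
  using assms unfolding derivative_tower_def
  by (auto intro!: derivative_eq_intros has_vector_derivative_mult_right)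

lemma derivative_tower_scaleR:
  assumes "derivative_tower F"
  shows "derivative_tower (\<lambda>n x. r *\<^sub>R F n x)"
  unfolding derivative_tower_def
proof (intro allI)
  fix n x
  have "((*\<^sub>R) r \<circ> F n has_vector_derivative r *\<^sub>R F (Suc n) x) (at x)"
    by (rule bounded_linear.has_vector_derivative[OF bounded_linear_scaleR_right, unfolded o_def[symmetric]])
       (rule derivative_towerD[OF assms])
  then show "((\<lambda>x. r *\<^sub>R F n x) has_vector_derivative r *\<^sub>R F (Suc n) x) (at x)"
    by (simp add: o_def)
qed

lemma derivative_tower_continuous: "derivative_tower F \<Longrightarrow> continuous_on S (F n)"
  by (meson continuous_at_imp_continuous_on derivative_towerD has_vector_derivative_continuous)

lemma frechet_derivative_vector:
  assumes "(f has_vector_derivative f') (at x)"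
  shows "frechet_derivative f (at x) e = e *\<^sub>R f'"
  using frechet_derivative_at[OF assms[unfolded has_vector_derivative_def]] by metis

text \<open>The directional derivative of a member is the next member scaled by the direction
  \<open>e\<close>, hence a member of the scaled tower; so the induction on the order has to range
  over all towers. Exhibiting a tower thus proves smoothness on the line.\<close>

lemma smooth_derivative_tower:
  assumes "derivative_tower F"
  shows "smooth (F n)"
proof -
  have "k_times_differentiable m (F n)" for m
    using assms
  proof (induction m arbitrary: F n)
    case 0
    then show ?case by (simp add: derivative_tower_continuous)
  next
    case (Suc m)
    have "k_times_differentiable m (\<lambda>x. frechet_derivative (F n) (at x) e)" for e
      using Suc.IH[OF derivative_tower_scaleR[OF Suc.prems], of e "Suc n"]
        frechet_derivative_vector[OF derivative_towerD[OF Suc.prems]] by simp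
    moreover have "F n differentiable at x" for x
      using derivative_towerD[OF Suc.prems] differentiableI_vector by blast
    ultimately show ?case by simp
  qed
  then show ?thesis by (simp add: smooth_def)
qed

lemma smooth_has_vderiv:
  assumes "smooth \<phi>"
  shows "(\<phi> has_vector_derivative vderiv \<phi> x) (at x)"
proof -
  have "k_times_differentiable 1 \<phi>" using assms by (simp only: smooth_def)
  then have "\<phi> differentiable at x" by simp
  then show ?thesis by (simp add: vderiv_def vector_derivative_works)
qed

lemma smooth_vderiv:
  assumes "smooth \<phi>"
  shows "smooth (vderiv \<phi>)"
  unfolding smooth_def
proof
  fix n
  have "k_times_differentiable (Suc n) \<phi>" using assms by (simp only: smooth_def)
  then have "k_times_differentiable n (\<lambda>x. frechet_derivative \<phi> (at x) 1)" by simp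
  then show "k_times_differentiable n (vderiv \<phi>)"
    using frechet_derivative_vector[OF smooth_has_vderiv[OF assms], of _ 1] by simp
qed

lemma derivative_tower_vderiv:
  assumes "smooth \<phi>"
  shows "derivative_tower (\<lambda>n. (vderiv ^^ n) \<phi>)"
proof -
  have "smooth ((vderiv ^^ n) \<phi>)" for n
    by (induction n) (auto simp: assms smooth_vderiv)
  then show ?thesis
    by (simp add: derivative_tower_def smooth_has_vderiv)
qed

text \<open>A tower that starts at a function determines all its iterated derivatives, so a formula
  for them is proved by writing down a tower that contains it.\<close>

lemma vderiv_funpow_tower:
  assumes "derivative_tower F"
  shows "(vderiv ^^ n) (F m) = F (n + m)"
proof (induction n)
  case (Suc n)
  have "vderiv (F k) = F (Suc k)" for k
    using derivative_towerD[OF assms] by (auto simp: vderiv_def fun_eq_iff vector_derivative_at)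
  with Suc show ?case by simp
qed simp

lemma supp_subset_iff:
  assumes "closed K"
  shows "supp \<phi> \<subseteq> K \<longleftrightarrow> (\<forall>x. x \<notin> K \<longrightarrow> \<phi> x = 0)"
  using assms closure_minimal[of "{x. \<phi> x \<noteq> 0}" K] closure_subset[of "{x. \<phi> x \<noteq> 0}"]
  unfolding supp_def by blast

lemma not_in_supp: "x \<notin> supp \<phi> \<Longrightarrow> \<phi> x = 0"
  using closure_subset[of "{x. \<phi> x \<noteq> 0}"] unfolding supp_def by blast

lemma compact_supp:
  fixes \<phi> :: "'b::t2_space \<Rightarrow> 'a::zero"
  assumes "compact K" "\<And>x. x \<notin> K \<Longrightarrow> \<phi> x = 0"
  shows "compact (supp \<phi>)"
proof -
  have "supp \<phi> \<subseteq> K"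
    using assms by (simp add: supp_subset_iff compact_imp_closed)
  then show ?thesis
    using assms(1) by (metis compact_Int_closed closed_closure inf.absorb_iff2 supp_def)
qed

lemma test_functions_tower:
  assumes "derivative_tower F" "compact K" "\<And>x. x \<notin> K \<Longrightarrow> F n x = 0"
  shows "F n \<in> test_functions"
proof -
  have "compact (supp (F n))" by (rule compact_supp[OF assms(2,3)])
  then show ?thesis
    using smooth_derivative_tower[OF assms(1)] by (simp add: test_functions_def)
qed

lemma test_functionsD:
  assumes "\<phi> \<in> test_functions"
  shows "smooth \<phi>" "compact (supp \<phi>)"
  using assms by (auto simp: test_functions_def)

lemma test_functions_derivative_tower:
  "\<phi> \<in> test_functions \<Longrightarrow> derivative_tower (\<lambda>n. (vderiv ^^ n) \<phi>)"
  by (simp add: derivative_tower_vderiv test_functionsD)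

text \<open>Vanishing on the open complement of \<open>K\<close> passes from each member to its
  derivative, because differentiation is local.\<close>

lemma derivative_tower_zero_outside:
  assumes F: "derivative_tower F" and K: "closed K" and z: "\<And>x. x \<notin> K \<Longrightarrow> F 0 x = 0" and "x \<notin> K"
  shows "F n x = 0"
  using \<open>x \<notin> K\<close>
proof (induction n arbitrary: x)
  case 0
  then show ?case by (simp add: z)
next
  case (Suc n)
  have "open (- K)" using K by auto
  then have "((\<lambda>_. 0) has_vector_derivative F (Suc n) x) (at x)"
    using has_vector_derivative_transform_within_open[OF derivative_towerD[OF F, of n x], of "- K" "\<lambda>_. 0"] Suc
    by auto
  then show ?case
    by (metis has_vector_derivative_const vector_derivative_at)
qed

lemma vderiv_zero_outside:
  assumes "\<phi> \<in> test_functions" "closed K" "supp \<phi> \<subseteq> K" "x \<notin> K"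
  shows "(vderiv ^^ n) \<phi> x = 0"
  using derivative_tower_zero_outside[OF test_functions_derivative_tower[OF assms(1)] assms(2), of x n]
    assms supp_subset_iff[OF assms(2)] by (metis funpow_0)

lemma test_functions_vderiv:
  assumes "\<phi> \<in> test_functions"
  shows "(vderiv ^^ n) \<phi> \<in> test_functions"
  using assms
  by (intro test_functions_tower[where F="\<lambda>n. (vderiv ^^ n) \<phi>" and K="supp \<phi>"]
      test_functions_derivative_tower vderiv_zero_outside[where K="supp \<phi>"])
     (auto simp: test_functionsD compact_imp_closed)

lemma test_functions_combine:
  fixes \<phi> \<theta> :: "real \<Rightarrow> 'a::real_normed_algebra"
  assumes "\<phi> \<in> test_functions" "\<theta> \<in> test_functions"
  shows "(\<lambda>x. a * \<phi> x + b * \<theta> x) \<in> test_functions"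
    and "(vderiv ^^ n) (\<lambda>x. a * \<phi> x + b * \<theta> x) = (\<lambda>x. a * (vderiv ^^ n) \<phi> x + b * (vderiv ^^ n) \<theta> x)"
proof -
  have T: "derivative_tower (\<lambda>n x. a * (vderiv ^^ n) \<phi> x + b * (vderiv ^^ n) \<theta> x)"
    by (intro derivative_tower_combine test_functions_derivative_tower assms)
  have "compact (supp \<phi> \<union> supp \<theta>)"
    using assms by (auto simp: test_functionsD)
  from test_functions_tower[OF T this, of 0]
  show "(\<lambda>x. a * \<phi> x + b * \<theta> x) \<in> test_functions"
    by (auto simp: not_in_supp)
  from vderiv_funpow_tower[OF T, of n 0]
  show "(vderiv ^^ n) (\<lambda>x. a * \<phi> x + b * \<theta> x) = (\<lambda>x. a * (vderiv ^^ n) \<phi> x + b * (vderiv ^^ n) \<theta> x)"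
    by simp
qed

lemma test_functions_combineR:
  fixes \<phi> \<theta> :: "real \<Rightarrow> 'a::real_normed_algebra_1"
  assumes "\<phi> \<in> test_functions" "\<theta> \<in> test_functions"
  shows "(\<lambda>x. r *\<^sub>R \<phi> x + s *\<^sub>R \<theta> x) \<in> test_functions"
    and "(vderiv ^^ n) (\<lambda>x. r *\<^sub>R \<phi> x + s *\<^sub>R \<theta> x) = (\<lambda>x. r *\<^sub>R (vderiv ^^ n) \<phi> x + s *\<^sub>R (vderiv ^^ n) \<theta> x)"
  using test_functions_combine[OF assms, where a="of_real r" and b="of_real s"]
  by (simp_all add: scaleR_conv_of_real)

lemma zero_test_function [simp]: "(\<lambda>x::real. 0 :: 'a::real_normed_vector) \<in> test_functions"
  using test_functions_tower[of "\<lambda>n x. 0" "{}" 0] by (auto simp: derivative_tower_def)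

lemma test_functions_reflect:
  fixes \<phi> :: "real \<Rightarrow> 'a::real_normed_vector"
  assumes "\<phi> \<in> test_functions"
  shows "(\<lambda>y. \<phi> (x - y)) \<in> test_functions"
proof -
  \<comment> \<open>The sign compensates the inner derivative of the reflection, so that the family
    is a tower.\<close>
  define F where "F = (\<lambda>n y. (- 1) ^ n *\<^sub>R (vderiv ^^ n) \<phi> (x - y))"
  have "derivative_tower F"
    unfolding derivative_tower_def
  proof (intro allI)
    fix n y
    have "((vderiv ^^ n) \<phi> \<circ> (\<lambda>y. x - y) has_vector_derivative (- 1) *\<^sub>R (vderiv ^^ Suc n) \<phi> (x - y)) (at y)"
      by (rule vector_diff_chain_at)
         (auto intro!: derivative_eq_intros derivative_towerD[OF test_functions_derivative_tower[OF assms], of n, simplified])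
    from bounded_linear.has_vector_derivative[OF bounded_linear_scaleR_right this, of "(- 1) ^ n"]
    show "(F n has_vector_derivative F (Suc n) y) (at y)"
      by (simp add: F_def o_def)
  qed
  moreover have "compact ((\<lambda>y. x - y) ` supp \<phi>)"
    using assms by (intro compact_continuous_image continuous_intros) (simp add: test_functionsD)
  moreover have "F 0 y = 0" if "y \<notin> (\<lambda>y. x - y) ` supp \<phi>" for y
  proof -
    have "x - y \<notin> supp \<phi>"
    proof
      assume "x - y \<in> supp \<phi>"
      then have "x - (x - y) \<in> (\<lambda>y. x - y) ` supp \<phi>" by blast
      then show False using that by simp
    qed
    then show ?thesis by (simp add: F_def not_in_supp)
  qed
  ultimately have "F 0 \<in> test_functions" by (rule test_functions_tower)
  then show ?thesis by (simp add: F_def)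
qed

text \<open>Makes the suprema in the definition of a distribution finite: each derivative is
  continuous and vanishes off a compact set.\<close>

lemma test_function_vderiv_bounded:
  assumes "\<phi> \<in> test_functions"
  shows "bounded (range ((vderiv ^^ n) \<phi>))"
proof -
  let ?g = "(vderiv ^^ n) \<phi>"
  have "bounded (?g ` supp \<phi>)"
    using assms
    by (intro compact_imp_bounded compact_continuous_image)
       (auto simp: test_functionsD intro: derivative_tower_continuous[OF test_functions_derivative_tower])
  then have "bounded (insert 0 (?g ` supp \<phi>))" by simp
  moreover have "range ?g \<subseteq> insert 0 (?g ` supp \<phi>)"
    using vderiv_zero_outside[OF assms, of "supp \<phi>"] assms
    by (auto simp: test_functionsD compact_imp_closed)
  ultimately show ?thesis by (rule bounded_subset)
qed

section \<open>Distributions and equicontinuity\<close>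

text \<open>An arbitrary common bound \<open>e\<close> stands in for the sum of suprema in the
  definition of a distribution. Estimates of this form compose under linear operators without any
  handling of suprema.\<close>

definition seminorm_bound ::
    "((real \<Rightarrow> 'a::{real_normed_field,euclidean_space}) \<Rightarrow> 'a) \<Rightarrow> real set \<Rightarrow> real \<Rightarrow> nat \<Rightarrow> bool" where
  "seminorm_bound u K C N \<longleftrightarrow> (\<forall>\<phi>\<in>test_functions. \<forall>e. supp \<phi> \<subseteq> K \<longrightarrow>
      (\<forall>j\<le>N. \<forall>x. norm ((vderiv ^^ j) \<phi> x) \<le> e) \<longrightarrow> norm (u \<phi>) \<le> C * e)"

text \<open>A common bound \<open>e\<close> dominates each of the \<open>N + 1\<close> suprema,
  which accounts for the factor \<open>Suc N\<close>; conversely the sum of suprema is itself a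
  common bound, since the suprema are finite and nonnegative. The absolute value of \<open>C\<close>
  appears because the constant in the definition may be negative.\<close>

lemma distributions_iff:
  "u \<in> distributions \<longleftrightarrow>
     (\<forall>\<phi>. \<phi> \<notin> test_functions \<longrightarrow> u \<phi> = 0) \<and>
     (\<forall>\<phi>\<in>test_functions. \<forall>\<theta>\<in>test_functions. \<forall>a b.
        u (\<lambda>x. a * \<phi> x + b * \<theta> x) = a * u \<phi> + b * u \<theta>) \<and>
     (\<forall>K. compact K \<longrightarrow> (\<exists>C N. seminorm_bound u K C N))"
proof -
  have "(\<exists>C N. \<forall>\<phi>\<in>test_functions. supp \<phi> \<subseteq> K \<longrightarrow>
        norm (u \<phi>) \<le> C * (\<Sum>j\<le>N. (SUP x. norm ((vderiv ^^ j) \<phi> x))))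
      \<longleftrightarrow> (\<exists>C N. seminorm_bound u K C N)" (is "?L \<longleftrightarrow> ?R") for K
  proof
    assume ?L
    then obtain C N where CN: "\<And>\<phi>. \<phi> \<in> test_functions \<Longrightarrow> supp \<phi> \<subseteq> K \<Longrightarrow>
        norm (u \<phi>) \<le> C * (\<Sum>j\<le>N. (SUP x. norm ((vderiv ^^ j) \<phi> x)))" by metis
    have "seminorm_bound u K (\<bar>C\<bar> * real (Suc N)) N"
      unfolding seminorm_bound_def
    proof (intro ballI allI impI)
      fix \<phi> :: "real \<Rightarrow> 'a" and e
      assume \<phi>: "\<phi> \<in> test_functions" and "supp \<phi> \<subseteq> K" and e: "\<forall>j\<le>N. \<forall>x. norm ((vderiv ^^ j) \<phi> x) \<le> e"
      let ?S = "\<Sum>j\<le>N. (SUP x. norm ((vderiv ^^ j) \<phi> x))"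
      have up: "norm ((vderiv ^^ j) \<phi> x) \<le> (SUP x. norm ((vderiv ^^ j) \<phi> x))" for j x
        using test_function_vderiv_bounded[OF \<phi>, of j]
        by (intro cSUP_upper) (auto simp: bounded_iff bdd_above_def)
      have "0 \<le> (SUP x. norm ((vderiv ^^ j) \<phi> x))" for j
        using up[of j 0] norm_ge_zero order_trans by blast
      then have "0 \<le> ?S" by (intro sum_nonneg) auto
      have "?S \<le> (\<Sum>j\<le>N. e)"
        using e by (intro sum_mono cSUP_least) auto
      then have S: "?S \<le> real (Suc N) * e" by simp
      have "norm (u \<phi>) \<le> C * ?S" using CN \<phi> \<open>supp \<phi> \<subseteq> K\<close> by auto
      also have "\<dots> \<le> \<bar>C\<bar> * ?S" using \<open>0 \<le> ?S\<close> by (intro mult_right_mono) auto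
      also have "\<dots> \<le> \<bar>C\<bar> * (real (Suc N) * e)" using S by (intro mult_left_mono) auto
      finally show "norm (u \<phi>) \<le> \<bar>C\<bar> * real (Suc N) * e" by simp
    qed
    then show ?R by blast
  next
    assume ?R
    then obtain C N where CN: "seminorm_bound u K C N" by blast
    have "norm (u \<phi>) \<le> C * (\<Sum>j\<le>N. (SUP x. norm ((vderiv ^^ j) \<phi> x)))"
      if \<phi>: "\<phi> \<in> test_functions" "supp \<phi> \<subseteq> K" for \<phi> :: "real \<Rightarrow> 'a"
    proof -
      have up: "norm ((vderiv ^^ j) \<phi> x) \<le> (SUP x. norm ((vderiv ^^ j) \<phi> x))" for j x
        using test_function_vderiv_bounded[OF \<phi>(1), of j]
        by (intro cSUP_upper) (auto simp: bounded_iff bdd_above_def)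
      have nn: "0 \<le> (SUP x. norm ((vderiv ^^ j) \<phi> x))" for j
        using up[of j 0] norm_ge_zero order_trans by blast
      have "norm ((vderiv ^^ j) \<phi> x) \<le> (\<Sum>j\<le>N. (SUP x. norm ((vderiv ^^ j) \<phi> x)))" if "j \<le> N" for j x
        by (rule order_trans[OF up]) (rule member_le_sum, use nn that in auto)
      then show ?thesis using CN \<phi> unfolding seminorm_bound_def by blast
    qed
    then show ?L by blast
  qed
  then show ?thesis unfolding distributions_def by simp
qed

lemma dist_outside: "u \<in> distributions \<Longrightarrow> \<phi> \<notin> test_functions \<Longrightarrow> u \<phi> = 0"
  by (simp add: distributions_def)

lemma dist_linear:
  assumes "u \<in> distributions" "\<phi> \<in> test_functions" "\<theta> \<in> test_functions"
  shows "u (\<lambda>x. a * \<phi> x + b * \<theta> x) = a * u \<phi> + b * u \<theta>"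
  using assms by (simp add: distributions_def)

lemma dist_linearR:
  assumes "u \<in> distributions" "\<phi> \<in> test_functions" "\<theta> \<in> test_functions"
  shows "u (\<lambda>x. r *\<^sub>R \<phi> x + s *\<^sub>R \<theta> x) = r *\<^sub>R u \<phi> + s *\<^sub>R u \<theta>"
  using dist_linear[OF assms, of "of_real r" "of_real s"] by (simp add: scaleR_conv_of_real)

lemma dist_diff:
  assumes "u \<in> distributions" "\<phi> \<in> test_functions" "\<theta> \<in> test_functions"
  shows "u (\<lambda>x. \<phi> x - \<theta> x) = u \<phi> - u \<theta>"
  using dist_linearR[OF assms, of 1 "-1"] by simp

lemma dist_zero:
  assumes "u \<in> distributions" shows "u (\<lambda>x. 0) = 0"
  using dist_linearR[OF assms zero_test_function zero_test_function, of 0 0] by simp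

lemma dist_scaleR:
  assumes "u \<in> distributions" "\<phi> \<in> test_functions"
  shows "u (\<lambda>x. r *\<^sub>R \<phi> x) = r *\<^sub>R u \<phi>"
  using dist_linearR[OF assms assms(2), of r 0] by simp

text \<open>The test functions supported in \<open>K\<close>, identified with their sequences of derivatives, form a
  closed subset of a countable power of a Banach space; Baire's theorem applies there.\<close>

definition tower_space :: "real set \<Rightarrow> (nat \<Rightarrow> real \<Rightarrow>\<^sub>C 'a::{real_normed_field,euclidean_space}) set" where
  "tower_space K = {F. derivative_tower (\<lambda>n. apply_bcontfun (F n)) \<and> (\<forall>x. x \<notin> K \<longrightarrow> apply_bcontfun (F 0) x = 0)}"

lemma tower_space_test_function:
  assumes "F \<in> tower_space K" "compact K"
  shows "apply_bcontfun (F 0) \<in> test_functions" "supp (apply_bcontfun (F 0)) \<subseteq> K"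
    "(vderiv ^^ n) (apply_bcontfun (F 0)) = apply_bcontfun (F n)"
proof -
  have T: "derivative_tower (\<lambda>n. apply_bcontfun (F n))"
    and z: "\<And>x. x \<notin> K \<Longrightarrow> apply_bcontfun (F 0) x = 0"
    using assms by (auto simp: tower_space_def)
  show "apply_bcontfun (F 0) \<in> test_functions"
    using test_functions_tower[OF T assms(2), of 0] z by simp
  show "supp (apply_bcontfun (F 0)) \<subseteq> K"
    using z by (simp add: supp_subset_iff compact_imp_closed assms(2))
  show "(vderiv ^^ n) (apply_bcontfun (F 0)) = apply_bcontfun (F n)"
    using vderiv_funpow_tower[OF T, of n 0] by simp
qed

lemma tower_space_of_test_function:
  assumes "\<phi> \<in> test_functions" "supp \<phi> \<subseteq> K"
  obtains F where "F \<in> tower_space K" "\<And>n. apply_bcontfun (F n) = (vderiv ^^ n) \<phi>"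
proof -
  define F where "F n = Bcontfun ((vderiv ^^ n) \<phi>)" for n
  have F: "apply_bcontfun (F n) = (vderiv ^^ n) \<phi>" for n
    unfolding F_def
    by (rule Bcontfun_inverse)
       (simp add: bcontfun_def test_function_vderiv_bounded assms
         derivative_tower_continuous[OF test_functions_derivative_tower])
  moreover have "F \<in> tower_space K"
    using assms not_in_supp[of _ \<phi>]
    by (auto simp: tower_space_def F test_functions_derivative_tower)
  ultimately show ?thesis using that by blast
qed

text \<open>Convergence in the product topology is uniform convergence of each derivative
  separately, so limit and differentiation may be interchanged at every level; the support condition
  survives pointwise limits.\<close>

lemma closed_tower_space: "closed (tower_space K)"
  unfolding closed_sequential_limits
proof (intro allI impI, elim conjE)
  fix f :: "nat \<Rightarrow> nat \<Rightarrow> real \<Rightarrow>\<^sub>C 'a" and l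
  assume f: "\<forall>k. f k \<in> tower_space K" and lim: "f \<longlonglongrightarrow> l"
  have coord: "(\<lambda>k. f k n) \<longlonglongrightarrow> l n" for n
    using continuous_on_tendsto_compose[OF continuous_on_product_coordinates lim, of n] by simp
  then have unif: "uniform_limit UNIV (\<lambda>k. apply_bcontfun (f k n)) (l n) sequentially" for n
    by (rule tendsto_bcontfun_uniform_limit)
  then have pw: "(\<lambda>k. apply_bcontfun (f k n) x) \<longlonglongrightarrow> apply_bcontfun (l n) x" for n x
    by (rule tendsto_uniform_limitI) simp
  have "(apply_bcontfun (l n) has_vector_derivative apply_bcontfun (l (Suc n)) x) (at x)" for n x
  proof -
    have "\<exists>g. \<forall>x\<in>UNIV. (\<lambda>k. apply_bcontfun (f k n) x) \<longlonglongrightarrow> g x \<and>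
        (g has_derivative (\<lambda>h. h *\<^sub>R apply_bcontfun (l (Suc n)) x)) (at x within UNIV)"
    proof (rule has_derivative_sequence)
      show "(apply_bcontfun (f k n) has_derivative (\<lambda>h. h *\<^sub>R apply_bcontfun (f k (Suc n)) x)) (at x within UNIV)"
        for k x
        using f derivative_towerD[of "\<lambda>n. apply_bcontfun (f k n)" n x]
        by (auto simp: tower_space_def has_vector_derivative_def)
      show "\<forall>\<^sub>F k in sequentially. \<forall>x\<in>UNIV. \<forall>h. norm (h *\<^sub>R apply_bcontfun (f k (Suc n)) x
          - h *\<^sub>R apply_bcontfun (l (Suc n)) x) \<le> e * norm h" if "e > 0" for e
        using uniform_limitD[OF unif[of "Suc n"] that]
      proof eventually_elim
        case (elim k)
        have "norm (h *\<^sub>R apply_bcontfun (f k (Suc n)) x - h *\<^sub>R apply_bcontfun (l (Suc n)) x) \<le> e * norm h" for x h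
        proof -
          have "norm (h *\<^sub>R apply_bcontfun (f k (Suc n)) x - h *\<^sub>R apply_bcontfun (l (Suc n)) x)
              = norm h * norm (apply_bcontfun (f k (Suc n)) x - apply_bcontfun (l (Suc n)) x)"
            by (simp add: scaleR_diff_right[symmetric])
          also have "\<dots> \<le> norm h * e"
            using elim by (intro mult_left_mono) (auto simp: dist_norm less_imp_le)
          finally show ?thesis by (simp add: mult.commute)
        qed
        then show ?case by blast
      qed
    qed (use pw[of n 0] in auto)
    then obtain g where g: "\<And>x. (\<lambda>k. apply_bcontfun (f k n) x) \<longlonglongrightarrow> g x"
      "\<And>x. (g has_derivative (\<lambda>h. h *\<^sub>R apply_bcontfun (l (Suc n)) x)) (at x)" by auto
    have "g = apply_bcontfun (l n)"
      using LIMSEQ_unique[OF g(1) pw] by auto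
    then show ?thesis using g(2) by (simp add: has_vector_derivative_def)
  qed
  moreover have "apply_bcontfun (l 0) x = 0" if "x \<notin> K" for x
  proof -
    have "apply_bcontfun (f k 0) x = 0" for k
      using f that by (auto simp: tower_space_def)
    then show ?thesis using LIMSEQ_unique[OF pw[of 0 x]] by simp
  qed
  ultimately show "l \<in> tower_space K"
    by (simp add: tower_space_def derivative_tower_def)
qed

lemma tower_space_diff:
  assumes "F \<in> tower_space K" "G \<in> tower_space K"
  shows "(\<lambda>n. F n - G n) \<in> tower_space K"
  using assms unfolding tower_space_def derivative_tower_def
  by (auto simp: minus_bcontfun.rep_eq intro!: derivative_eq_intros)

text \<open>On \<open>tower_space K\<close> a distribution is controlled by finitely many
  coordinates, hence sequentially continuous, and so a sublevel set of its norm is closed. This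
  supplies the closed sets for Baire's theorem.\<close>

lemma dist_closed_sublevel:
  assumes u: "u \<in> distributions" and K: "compact K"
  shows "closed {F \<in> tower_space K. norm (u (apply_bcontfun (F 0))) \<le> M}"
  unfolding closed_sequential_limits
proof (intro allI impI, elim conjE)
  fix f :: "nat \<Rightarrow> nat \<Rightarrow> real \<Rightarrow>\<^sub>C 'a" and l
  assume f: "\<forall>k. f k \<in> {F \<in> tower_space K. norm (u (apply_bcontfun (F 0))) \<le> M}" and lim: "f \<longlonglongrightarrow> l"
  have fK: "f k \<in> tower_space K" for k using f by blast
  have lK: "l \<in> tower_space K"
    using closed_sequentially[OF closed_tower_space fK lim] .
  obtain C N where CN: "seminorm_bound u K C N"
    using u K by (auto simp: distributions_iff)
  have coord: "(\<lambda>k. f k n) \<longlonglongrightarrow> l n" for n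
    using continuous_on_tendsto_compose[OF continuous_on_product_coordinates lim, of n] by simp
  define d where "d k = (\<Sum>j\<le>N. dist (f k j) (l j))" for k
  have "d \<longlonglongrightarrow> (\<Sum>j\<le>N. 0)"
    unfolding d_def by (intro tendsto_sum) (rule tendsto_dist_iff[THEN iffD1, OF coord])
  then have d: "(\<lambda>k. C * d k) \<longlonglongrightarrow> 0"
    using tendsto_mult_left[of d 0 sequentially C] by simp
  have "norm (u (apply_bcontfun (f k 0)) - u (apply_bcontfun (l 0))) \<le> C * d k" for k
  proof -
    note D = tower_space_test_function[OF tower_space_diff[OF fK[of k] lK] K]
    have "norm ((vderiv ^^ j) (apply_bcontfun (f k 0 - l 0)) x) \<le> d k" if "j \<le> N" for j x
    proof -
      have "norm ((vderiv ^^ j) (apply_bcontfun (f k 0 - l 0)) x) = dist (apply_bcontfun (f k j) x) (apply_bcontfun (l j) x)"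
        using D(3)[of j] by (simp add: minus_bcontfun.rep_eq dist_norm)
      also have "\<dots> \<le> dist (f k j) (l j)" by (rule dist_bounded)
      also have "\<dots> \<le> d k"
        unfolding d_def using that by (intro member_le_sum) auto
      finally show ?thesis .
    qed
    then have "norm (u (apply_bcontfun (f k 0 - l 0))) \<le> C * d k"
      using CN D(1,2) unfolding seminorm_bound_def by blast
    moreover have "apply_bcontfun (f k 0 - l 0) = (\<lambda>x. apply_bcontfun (f k 0) x - apply_bcontfun (l 0) x)"
      by (simp add: minus_bcontfun.rep_eq fun_eq_iff)
    ultimately show ?thesis
      using dist_diff[OF u tower_space_test_function(1)[OF fK K] tower_space_test_function(1)[OF lK K]] by simp
  qed
  then have "(\<lambda>k. u (apply_bcontfun (f k 0)) - u (apply_bcontfun (l 0))) \<longlonglongrightarrow> 0"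
    by (intro Lim_null_comparison[OF _ d] always_eventually) auto
  then have "(\<lambda>k. u (apply_bcontfun (f k 0))) \<longlonglongrightarrow> u (apply_bcontfun (l 0))"
    by (rule LIM_zero_cancel)
  then have "norm (u (apply_bcontfun (l 0))) \<le> M"
    by (rule Lim_norm_ubound[rotated]) (use f in auto)
  with lK show "l \<in> {F \<in> tower_space K. norm (u (apply_bcontfun (F 0))) \<le> M}" by blast
qed

text \<open>A basic open set of the product constrains only finitely many coordinates;
  \<open>N\<close> bounds their indices and \<open>d\<close> is the least of the radii up to
  \<open>N\<close>.\<close>

lemma open_fun_coordinates:
  fixes U :: "(nat \<Rightarrow> 'b::metric_space) set"
  assumes "open U" "F \<in> U"
  obtains N d where "d > 0" "\<And>G. (\<And>j. j \<le> N \<Longrightarrow> dist (G j) (F j) < d) \<Longrightarrow> G \<in> U"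
proof -
  obtain X where X: "F \<in> (\<Pi>\<^sub>E i\<in>UNIV. X i)" "\<And>i. open (X i)" "finite {i. X i \<noteq> UNIV}"
      "(\<Pi>\<^sub>E i\<in>UNIV. X i) \<subseteq> U"
    using product_topology_open_contains_basis[OF assms[unfolded open_fun_def]] by auto
  have "\<exists>e>0. \<forall>y. dist y (F i) < e \<longrightarrow> y \<in> X i" for i
    using X(1,2) by (auto simp: open_dist PiE_iff)
  then obtain e where e: "\<And>i. e i > 0" "\<And>i y. dist y (F i) < e i \<Longrightarrow> y \<in> X i" by metis
  obtain N where N: "\<And>i. X i \<noteq> UNIV \<Longrightarrow> i \<le> N"
    using X(3) by (auto simp: finite_nat_set_iff_bounded_le)
  define d where "d = Min (e ` {..N})"
  have "d > 0" using e(1) by (simp add: d_def)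
  moreover have "G \<in> U" if G: "\<And>j. j \<le> N \<Longrightarrow> dist (G j) (F j) < d" for G
  proof -
    have "G i \<in> X i" for i
    proof (cases "X i = UNIV")
      case False
      then have "i \<le> N" by (rule N)
      then have "d \<le> e i" by (simp add: d_def)
      then show ?thesis using G[OF \<open>i \<le> N\<close>] e(2) by force
    qed simp
    then show ?thesis using X(4) by (auto simp: PiE_iff)
  qed
  ultimately show ?thesis using that by blast
qed

text \<open>Banach-Steinhaus for test functions supported in \<open>K\<close>. By Baire, some set of
  towers on which the whole family is bounded by \<open>m\<close> contains a neighbourhood of a
  tower \<open>F\<close>, and this neighbourhood is described by finitely many derivatives.
  Subtracting the value at \<open>F\<close> gives one seminorm estimate for all \<open>u\<close> in
  \<open>U\<close>.\<close>

theorem distributions_uniform_boundedness: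
  fixes U :: "((real \<Rightarrow> 'a::{real_normed_field,euclidean_space}) \<Rightarrow> 'a) set"
  assumes U: "U \<subseteq> distributions" and K: "compact K"
    and bdd: "\<And>\<phi>. \<phi> \<in> test_functions \<Longrightarrow> \<exists>M. \<forall>u\<in>U. norm (u \<phi>) \<le> M"
  obtains C N where "C \<ge> 0" "\<And>u. u \<in> U \<Longrightarrow> seminorm_bound u K C N"
proof -
  \<comment> \<open>The intersection with \<open>tower_space K\<close> keeps \<open>E m\<close>
    inside that space also when \<open>U\<close> is empty.\<close>
  define E where "E m = (\<Inter>u\<in>U. {F \<in> tower_space K. norm (u (apply_bcontfun (F 0))) \<le> real m}) \<inter> tower_space K"
    for m :: nat
  let ?X = "top_of_set (tower_space K) :: (nat \<Rightarrow> real \<Rightarrow>\<^sub>C 'a) topology"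
  have "completely_metrizable_space ?X"
    using completely_metrizable_space_closedin[OF completely_metrizable_space_euclidean] closed_tower_space
    by auto
  moreover have "closed (E m)" for m
    unfolding E_def using U K by (intro closed_Int closed_INT ballI dist_closed_sublevel closed_tower_space) auto
  then have "closedin ?X (E m)" for m
    by (auto simp: closedin_closed E_def)
  moreover have "(\<Union>m. E m) = tower_space K"
  proof
    show "tower_space K \<subseteq> (\<Union>m. E m)"
    proof
      fix F :: "nat \<Rightarrow> real \<Rightarrow>\<^sub>C 'a" assume F: "F \<in> tower_space K"
      obtain M where M: "\<forall>u\<in>U. norm (u (apply_bcontfun (F 0))) \<le> M"
        using bdd[OF tower_space_test_function(1)[OF F K]] by blast
      obtain m :: nat where "M \<le> real m" using real_arch_simple by blast
      then have "F \<in> E m" using F M by (fastforce simp: E_def)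
      then show "F \<in> (\<Union>m. E m)" by blast
    qed
  qed (auto simp: E_def)
  then have "?X interior_of (\<Union>m. E m) = tower_space K"
    by (metis interior_of_topspace topspace_euclidean_subtopology)
  \<comment> \<open>The tower space is the union of the sets \<open>E m\<close> and is nonempty, so
    by Baire's theorem these sets cannot all have empty interior.\<close>
  moreover have "(\<lambda>n. 0) \<in> tower_space K"
    by (auto simp: tower_space_def derivative_tower_def zero_bcontfun.rep_eq)
  ultimately have "\<exists>m. ?X interior_of (E m) \<noteq> {}"
    using Baire_category_alt[of ?X "range E"] by auto
  then obtain m where "?X interior_of (E m) \<noteq> {}" ..
  then obtain F V where FV: "openin ?X V" "F \<in> V" "V \<subseteq> E m"
    by (auto simp: interior_of_def)
  then obtain W where W: "open W" "V = tower_space K \<inter> W"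
    by (auto simp: openin_open)
  obtain N d where d: "d > 0" and Nd: "\<And>G. (\<And>j. j \<le> N \<Longrightarrow> dist (G j) (F j) < d) \<Longrightarrow> G \<in> W"
    by (rule open_fun_coordinates[OF W(1), of F]) (use FV W in auto)
  have FK: "F \<in> tower_space K" using FV W by blast
  have bound: "norm (u \<phi>) \<le> 4 * real m / d * e"
    if u: "u \<in> U" and \<phi>: "\<phi> \<in> test_functions" "supp \<phi> \<subseteq> K"
      and e: "\<And>j x. j \<le> N \<Longrightarrow> norm ((vderiv ^^ j) \<phi> x) \<le> e" and "e > 0" for u \<phi> e
  proof -
    have ud: "u \<in> distributions" using u U by blast
    obtain G where G: "G \<in> tower_space K" "\<And>n. apply_bcontfun (G n) = (vderiv ^^ n) \<phi>"
      using tower_space_of_test_function[OF \<phi>] by metis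
    \<comment> \<open>With this \<open>r\<close> the scaled test function has derivatives of size at
      most \<open>d / 2\<close> up to order \<open>N\<close>, so adding it to \<open>F\<close> does
      not leave the neighbourhood. Both values of \<open>u\<close> are then at most
      \<open>m\<close>, and 2 m / r equals 4 m e / d.\<close>
    define r where "r = d / (2 * e)"
    have r: "r > 0" using d \<open>e > 0\<close> by (simp add: r_def)
    define H where "H n = F n + r *\<^sub>R G n" for n
    have HK: "H \<in> tower_space K"
      using FK G(1) derivative_tower_scaleR[of "\<lambda>n. apply_bcontfun (G n)" r]
      unfolding tower_space_def derivative_tower_def H_def
      by (auto simp: plus_bcontfun.rep_eq scaleR_bcontfun.rep_eq intro!: derivative_eq_intros)
    have "dist (H j) (F j) < d" if "j \<le> N" for j
    proof -
      have "dist (H j) (F j) \<le> d / 2"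
      proof (rule dist_bound)
        fix x
        have "dist (apply_bcontfun (H j) x) (apply_bcontfun (F j) x) = r * norm ((vderiv ^^ j) \<phi> x)"
          using r by (simp add: H_def plus_bcontfun.rep_eq scaleR_bcontfun.rep_eq G(2) dist_norm)
        also have "\<dots> \<le> r * e" using r e[OF that] by (intro mult_left_mono) auto
        finally show "dist (apply_bcontfun (H j) x) (apply_bcontfun (F j) x) \<le> d / 2"
          using \<open>e > 0\<close> by (simp add: r_def)
      qed
      then show ?thesis using d by simp
    qed
    then have "H \<in> E m" using Nd[of H] HK W FV by blast
    then have "norm (u (apply_bcontfun (H 0))) \<le> real m" using u by (auto simp: E_def)
    moreover have "F \<in> E m" using FV by blast
    then have "norm (u (apply_bcontfun (F 0))) \<le> real m" using u by (auto simp: E_def)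
    moreover have "u (apply_bcontfun (H 0)) = u (apply_bcontfun (F 0)) + r *\<^sub>R u \<phi>"
      using dist_linearR[OF ud tower_space_test_function(1)[OF FK K] \<phi>(1), of 1 r] G(2)[of 0]
      by (simp add: H_def plus_bcontfun.rep_eq scaleR_bcontfun.rep_eq)
    ultimately have "norm (r *\<^sub>R u \<phi>) \<le> 2 * real m"
      using norm_triangle_ineq4[of "u (apply_bcontfun (F 0)) + r *\<^sub>R u \<phi>" "u (apply_bcontfun (F 0))"] by simp
    then have "r * norm (u \<phi>) \<le> 2 * real m" using r by simp
    then show ?thesis using d \<open>e > 0\<close> by (simp add: r_def field_simps)
  qed
  have "seminorm_bound u K (4 * real m / d) N" if u: "u \<in> U" for u
    unfolding seminorm_bound_def
  proof (intro ballI allI impI)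
    fix \<phi> :: "real \<Rightarrow> 'a" and e
    assume \<phi>: "\<phi> \<in> test_functions" "supp \<phi> \<subseteq> K" and e: "\<forall>j\<le>N. \<forall>x. norm ((vderiv ^^ j) \<phi> x) \<le> e"
    have "0 \<le> e" using e[rule_format, of 0 0] norm_ge_zero order_trans by blast
    \<comment> \<open>The scaling above divides by the bound and so requires a positive one; the
      case \<open>e = 0\<close> is reached by letting \<open>h\<close> tend to 0 from the
      right.\<close>
    have "norm (u \<phi>) \<le> 4 * real m / d * (e + h)" if "h > 0" for h
      using e that \<open>0 \<le> e\<close> by (intro bound[OF u \<phi>]) (auto intro: add_increasing2)
    then have "\<forall>\<^sub>F h in at_right 0. norm (u \<phi>) \<le> 4 * real m / d * (e + h)"
      by (auto simp: eventually_at_right_field intro: exI[of _ 1])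
    moreover have "((\<lambda>h. 4 * real m / d * (e + h)) \<longlongrightarrow> 4 * real m / d * (e + 0)) (at_right 0)"
      by (intro tendsto_intros)
    ultimately show "norm (u \<phi>) \<le> 4 * real m / d * e"
      using tendsto_lowerbound[where F="at_right (0::real)"] by force
  qed
  then show ?thesis using that[of "4 * real m / d" N] d by simp
qed

section \<open>Curves of test functions and of distributions\<close>

lemma has_vector_derivative_iff_difference_quotient:
  fixes f :: "real \<Rightarrow> 'a::real_normed_vector"
  shows "(f has_vector_derivative D) (at t) \<longleftrightarrow> ((\<lambda>h. (f (t + h) - f t) /\<^sub>R h) \<longlongrightarrow> D) (at 0)"
proof -
  have "(f has_vector_derivative D) (at t)
      \<longleftrightarrow> ((\<lambda>h. norm (f (t + h) - f t - h *\<^sub>R D) / norm h) \<longlongrightarrow> 0) (at 0)"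
    unfolding has_vector_derivative_def has_derivative_at
    by (simp add: bounded_linear_scaleR_left)
  also have "\<dots> \<longleftrightarrow> ((\<lambda>h. norm ((f (t + h) - f t) /\<^sub>R h - D)) \<longlongrightarrow> 0) (at 0)"
  proof (rule filterlim_cong[OF refl refl])
    have "norm (f (t + h) - f t - h *\<^sub>R D) / norm h = norm ((f (t + h) - f t) /\<^sub>R h - D)" if "h \<noteq> 0" for h
    proof -
      have "(f (t + h) - f t) /\<^sub>R h - D = (f (t + h) - f t - h *\<^sub>R D) /\<^sub>R h"
        using that by (simp add: scaleR_diff_right)
      then show ?thesis by (simp add: divide_inverse mult.commute)
    qed
    then show "\<forall>\<^sub>F h in at 0. norm (f (t + h) - f t - h *\<^sub>R D) / norm h = norm ((f (t + h) - f t) /\<^sub>R h - D)"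
      by (auto simp: eventually_at_filter)
  qed
  also have "\<dots> \<longleftrightarrow> ((\<lambda>h. (f (t + h) - f t) /\<^sub>R h) \<longlongrightarrow> D) (at 0)"
    by (simp add: tendsto_norm_zero_iff LIM_zero_iff)
  finally show ?thesis .
qed

text \<open>Symmetry of mixed derivatives, with the existence of the second one as part of the
  conclusion: \<open>g\<close> is the time integral of \<open>gt\<close>, this integral is
  differentiated in \<open>x\<close> under the integral sign, and the result is differentiated in
  time by the fundamental theorem.\<close>

lemma mixed_partials:
  fixes g :: "real \<Rightarrow> real \<Rightarrow> 'a::banach"
  assumes gt: "\<And>t x. ((\<lambda>t. g t x) has_vector_derivative gt t x) (at t)"
    and gx: "\<And>t x. (g t has_vector_derivative gx t x) (at x)"
    and gtx: "\<And>t x. (gt t has_vector_derivative gtx t x) (at x)"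
    and cont: "continuous_on UNIV (\<lambda>(t, x). gt t x)" "continuous_on UNIV (\<lambda>(t, x). gtx t x)"
  shows "((\<lambda>t. gx t x) has_vector_derivative gtx t x) (at t)"
proof -
  \<comment> \<open>A margin of one unit on both sides puts \<open>t\<close> in the interior of the
    interval.\<close>
  let ?a = "t - 1" and ?b = "t + 1"
  have cont_t: "continuous_on S (\<lambda>s. gt s x)" "continuous_on S (\<lambda>s. gtx s x)" for x S
    using continuous_on_compose2[OF cont(1), of S "\<lambda>s. (s, x)"]
      continuous_on_compose2[OF cont(2), of S "\<lambda>s. (s, x)"]
    by (simp_all add: continuous_on_Pair)
  have eq: "gx s x = gx ?a x + integral {?a..s} (\<lambda>s. gtx s x)" if s: "s \<in> {?a..?b}" for s
  proof -
    have "g s y = g ?a y + integral {?a..s} (\<lambda>s. gt s y)" for y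
    proof -
      have "((\<lambda>s. gt s y) has_integral g s y - g ?a y) {?a..s}"
        using s by (intro fundamental_theorem_of_calculus[where f="\<lambda>s. g s y"] has_vector_derivative_at_within[OF gt]) auto
      then show ?thesis by (simp add: integral_unique)
    qed
    then have "g s = (\<lambda>y. g ?a y + integral {?a..s} (\<lambda>s. gt s y))" by blast
    moreover have "((\<lambda>y. g ?a y + integral (cbox ?a s) (\<lambda>s. gt s y))
        has_vector_derivative gx ?a x + integral (cbox ?a s) (\<lambda>s. gtx s x)) (at x)"
    proof (intro has_vector_derivative_add gx
        leibniz_rule_vector_derivative[where U=UNIV, simplified] gtx)
      show "(\<lambda>s. gt s y) integrable_on cbox ?a s" for y
        using cont_t(1) by (intro integrable_continuous)
      show "continuous_on (UNIV \<times> cbox ?a s) (\<lambda>(y, s). gtx s y)"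
        using continuous_on_compose2[OF cont(2), of "UNIV \<times> cbox ?a s" "\<lambda>(y, s). (s, y)"]
        by (simp add: case_prod_unfold continuous_on_Pair continuous_on_fst continuous_on_snd)
    qed
    ultimately show ?thesis
      using gx[of s x] vector_derivative_unique_at by fastforce
  qed
  have "((\<lambda>s. gx ?a x + integral {?a..s} (\<lambda>s. gtx s x)) has_vector_derivative 0 + gtx t x) (at t within {?a..?b})"
    by (intro has_vector_derivative_add has_vector_derivative_const integral_has_vector_derivative cont_t) auto
  then have "((\<lambda>s. gx ?a x + integral {?a..s} (\<lambda>s. gtx s x)) has_vector_derivative gtx t x) (at t)"
    by (simp add: at_within_Icc_at)
  then show ?thesis
    by (rule has_vector_derivative_transform_within_open[of _ _ _ "{?a<..<?b}"]) (auto intro!: eq[symmetric])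
qed

text \<open>Stands for continuity of a curve in the usual topology of test functions. Joint
  continuity is the form that explicit formulas satisfy at once; \<open>test_curve_uniform\<close>
  turns it into uniform convergence of each derivative.\<close>

definition test_curve :: "(real \<Rightarrow> real \<Rightarrow> 'a::real_normed_vector) \<Rightarrow> bool" where
  "test_curve E \<longleftrightarrow> (\<forall>t. E t \<in> test_functions) \<and>
     (\<forall>T. \<exists>K. compact K \<and> (\<forall>t. \<bar>t\<bar> \<le> T \<longrightarrow> supp (E t) \<subseteq> K)) \<and>
     (\<forall>j. continuous_on UNIV (\<lambda>(t, x). (vderiv ^^ j) (E t) x))"

definition test_curve_deriv ::
    "(real \<Rightarrow> real \<Rightarrow> 'a::real_normed_vector) \<Rightarrow> (real \<Rightarrow> real \<Rightarrow> 'a) \<Rightarrow> bool" where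
  "test_curve_deriv E E' \<longleftrightarrow> test_curve E \<and> test_curve E' \<and>
     (\<forall>t x. ((\<lambda>s. E s x) has_vector_derivative E' t x) (at t))"

lemma test_curve_test_functions: "test_curve E \<Longrightarrow> E t \<in> test_functions"
  by (simp add: test_curve_def)

lemma test_curve_support:
  assumes "test_curve E"
  obtains K where "compact K" "\<And>t. \<bar>t\<bar> \<le> T \<Longrightarrow> supp (E t) \<subseteq> K"
  using assms unfolding test_curve_def by metis

text \<open>The definition asks for a time derivative only pointwise in x and only of the curve
  itself; \<open>mixed_partials\<close> lifts it through one spatial derivative at a time.\<close>

lemma test_curve_deriv_vderiv:
  fixes E :: "real \<Rightarrow> real \<Rightarrow> 'a::banach"
  assumes "test_curve_deriv E E'"
  shows "((\<lambda>s. (vderiv ^^ j) (E s) x) has_vector_derivative (vderiv ^^ j) (E' t) x) (at t)"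
proof (induction j arbitrary: t x)
  case 0
  then show ?case using assms by (simp add: test_curve_deriv_def)
next
  case (Suc j)
  have E: "test_curve E" and E': "test_curve E'"
    using assms by (auto simp: test_curve_deriv_def)
  show ?case
  proof (rule mixed_partials[where gt="\<lambda>t. (vderiv ^^ j) (E' t)"])
    show "((vderiv ^^ j) (E t) has_vector_derivative (vderiv ^^ Suc j) (E t) x) (at x)"
      "((vderiv ^^ j) (E' t) has_vector_derivative (vderiv ^^ Suc j) (E' t) x) (at x)" for t x
      using derivative_towerD[OF test_functions_derivative_tower] test_curve_test_functions[OF E]
        test_curve_test_functions[OF E'] by blast+
    show "continuous_on UNIV (\<lambda>(t, x). (vderiv ^^ j) (E' t) x)"
      "continuous_on UNIV (\<lambda>(t, x). (vderiv ^^ Suc j) (E' t) x)"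
      using E' unfolding test_curve_def by blast+
  qed (rule Suc.IH)
qed

text \<open>Joint continuity is uniform on a compact box, and outside the compact set that carries
  all the supports both terms vanish, so smallness holds for all \<open>x\<close> at once.\<close>

lemma test_curve_uniform:
  assumes E: "test_curve E" and "e > 0"
  shows "\<forall>\<^sub>F s in nhds t. \<forall>x. norm ((vderiv ^^ j) (E s) x - (vderiv ^^ j) (E t) x) \<le> e"
proof -
  obtain K where K: "compact K" "\<And>s. \<bar>s\<bar> \<le> \<bar>t\<bar> + 1 \<Longrightarrow> supp (E s) \<subseteq> K"
    using test_curve_support[OF E] by metis
  let ?S = "cball t 1 \<times> K" and ?g = "\<lambda>(s, x). (vderiv ^^ j) (E s) x"
  have "uniformly_continuous_on ?S ?g"
    using E K(1) unfolding test_curve_def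
    by (intro compact_uniformly_continuous compact_Times) (auto intro: continuous_on_subset)
  then obtain d where d: "d > 0"
    "\<And>p q. p \<in> ?S \<Longrightarrow> q \<in> ?S \<Longrightarrow> dist q p < d \<Longrightarrow> dist (?g q) (?g p) < e"
    using \<open>e > 0\<close> unfolding uniformly_continuous_on_def by metis
  have "norm ((vderiv ^^ j) (E s) x - (vderiv ^^ j) (E t) x) \<le> e" if s: "dist s t < min d 1" for s x
  proof (cases "x \<in> K")
    case True
    have "dist (?g (s, x)) (?g (t, x)) < e"
      using s True by (intro d(2)) (auto simp: dist_commute dist_Pair_Pair)
    then show ?thesis by (simp add: dist_norm)
  next
    case False
    have "supp (E s) \<subseteq> K" "supp (E t) \<subseteq> K"
      using s by (auto intro!: K(2) simp: dist_real_def)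
    then show ?thesis
      using vderiv_zero_outside[OF test_curve_test_functions[OF E] compact_imp_closed[OF K(1)] _ False] \<open>e > 0\<close>
      by simp
  qed
  then show ?thesis
    unfolding eventually_nhds_metric using d(1) by (intro exI[of _ "min d 1"]) auto
qed

text \<open>The mean value inequality bounds the error of the difference quotient by the oscillation
  of the derivatives of \<open>E'\<close> near \<open>t\<close>, which is small uniformly in
  \<open>x\<close>.\<close>

lemma test_curve_difference_quotient:
  fixes E :: "real \<Rightarrow> real \<Rightarrow> 'a::banach"
  assumes E: "test_curve_deriv E E'" and "e > 0"
  shows "\<forall>\<^sub>F h in at 0. \<forall>x. norm (((vderiv ^^ j) (E (t + h)) x - (vderiv ^^ j) (E t) x) /\<^sub>R h
           - (vderiv ^^ j) (E' t) x) \<le> e"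
proof -
  have "test_curve E'" using E by (simp add: test_curve_deriv_def)
  from test_curve_uniform[OF this \<open>e > 0\<close>, of j t] obtain d where d: "d > 0"
    "\<And>s x. dist s t < d \<Longrightarrow> norm ((vderiv ^^ j) (E' s) x - (vderiv ^^ j) (E' t) x) \<le> e"
    unfolding eventually_nhds_metric by metis
  have "norm (((vderiv ^^ j) (E (t + h)) x - (vderiv ^^ j) (E t) x) /\<^sub>R h - (vderiv ^^ j) (E' t) x) \<le> e"
    if h: "h \<noteq> 0" "dist h 0 < d" for h x
  proof -
    let ?D = "(vderiv ^^ j) (E (t + h)) x - (vderiv ^^ j) (E t) x"
    have "norm (?D - (t + h - t) *\<^sub>R (vderiv ^^ j) (E' t) x) \<le> norm (t + h - t) * e"
    proof (rule vector_differentiable_bound_linearization[where S="ball t d" and f="\<lambda>s. (vderiv ^^ j) (E s) x" and f'="\<lambda>s. (vderiv ^^ j) (E' s) x"])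
      show "((\<lambda>s. (vderiv ^^ j) (E s) x) has_vector_derivative (vderiv ^^ j) (E' s) x) (at s within ball t d)" for s
        by (rule has_vector_derivative_at_within[OF test_curve_deriv_vderiv[OF E]])
      show "closed_segment t (t + h) \<subseteq> ball t d"
        using h d(1) by (intro closed_segment_subset) (auto simp: dist_real_def)
      show "norm ((vderiv ^^ j) (E' s) x - (vderiv ^^ j) (E' t) x) \<le> e" if "s \<in> ball t d" for s
        using that d(2) by (simp add: dist_commute)
    qed (use d in auto)
    moreover have "?D /\<^sub>R h - (vderiv ^^ j) (E' t) x = (?D - h *\<^sub>R (vderiv ^^ j) (E' t) x) /\<^sub>R h"
      using h(1) by (simp add: scaleR_diff_right)
    moreover have "norm ((?D - h *\<^sub>R (vderiv ^^ j) (E' t) x) /\<^sub>R h)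
        = norm (?D - h *\<^sub>R (vderiv ^^ j) (E' t) x) / \<bar>h\<bar>"
      by (simp add: divide_inverse mult.commute)
    ultimately show ?thesis using h(1) by (simp add: pos_divide_le_eq mult.commute)
  qed
  then show ?thesis
    unfolding eventually_at using d(1) by blast
qed

section \<open>Pairing moving distributions with moving test functions\<close>

lemma dist_curve_equicontinuous:
  fixes u :: "real \<Rightarrow> (real \<Rightarrow> 'a::{real_normed_field,euclidean_space}) \<Rightarrow> 'a"
  assumes "\<And>t. u t \<in> distributions" and "\<And>\<phi>. \<phi> \<in> test_functions \<Longrightarrow> continuous_on UNIV (\<lambda>t. u t \<phi>)"
    and "compact K"
  obtains C N where "C \<ge> 0" "\<And>t. \<bar>t\<bar> \<le> T \<Longrightarrow> seminorm_bound (u t) K C N"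
proof (rule distributions_uniform_boundedness[of "u ` {-T..T}" K])
  show "\<exists>M. \<forall>v\<in>u ` {-T..T}. norm (v \<phi>) \<le> M" if "\<phi> \<in> test_functions" for \<phi>
  proof -
    have "compact ((\<lambda>t. u t \<phi>) ` {-T..T})"
      by (intro compact_continuous_image continuous_on_subset[OF assms(2)[OF that]]) auto
    from compact_imp_bounded[OF this] show ?thesis unfolding bounded_iff by auto
  qed
next
  fix C N assume "C \<ge> 0" "\<And>v. v \<in> u ` {-T..T} \<Longrightarrow> seminorm_bound v K C N"
  then show thesis by (intro that[of C N]) (auto simp: abs_le_iff)
qed (use assms in auto)

text \<open>Both factors move here, and separate continuity in each would not give a limit.
  Continuity of each \<open>u t \<phi>\<close> in \<open>t\<close> makes the family bounded on every
  test function for times up to \<open>T\<close>, and uniform boundedness converts this into one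
  seminorm estimate for all these times.\<close>

lemma dist_curve_tendsto_zero:
  fixes u :: "real \<Rightarrow> (real \<Rightarrow> 'a::{real_normed_field,euclidean_space}) \<Rightarrow> 'a"
  assumes u: "\<And>t. u t \<in> distributions" "\<And>\<phi>. \<phi> \<in> test_functions \<Longrightarrow> continuous_on UNIV (\<lambda>t. u t \<phi>)"
    and K: "compact K"
    and \<Phi>: "\<forall>\<^sub>F h in F. \<Phi> h \<in> test_functions \<and> supp (\<Phi> h) \<subseteq> K \<and> \<bar>\<tau> h\<bar> \<le> T"
    and small: "\<And>j e. e > 0 \<Longrightarrow> \<forall>\<^sub>F h in F. \<forall>x. norm ((vderiv ^^ j) (\<Phi> h) x) \<le> e"
  shows "((\<lambda>h. u (\<tau> h) (\<Phi> h)) \<longlongrightarrow> 0) F"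
proof (rule tendstoI)
  fix e :: real assume "e > 0"
  obtain C N where CN: "C \<ge> 0" "\<And>t. \<bar>t\<bar> \<le> T \<Longrightarrow> seminorm_bound (u t) K C N"
    using dist_curve_equicontinuous[OF u K] by metis
  \<comment> \<open>\<open>C + 1\<close> and not \<open>C\<close>, to allow \<open>C = 0\<close> and
    to make the final inequality strict.\<close>
  define d where "d = e / (C + 1)"
  have "d > 0" using \<open>e > 0\<close> CN(1) by (simp add: d_def)
  have "C * d < e"
    using CN(1) \<open>e > 0\<close> by (simp add: d_def field_simps)
  have "\<forall>\<^sub>F h in F. \<forall>j\<in>{..N}. \<forall>x. norm ((vderiv ^^ j) (\<Phi> h) x) \<le> d"
    using small[OF \<open>d > 0\<close>] by (intro eventually_ball_finite) auto
  with \<Phi> show "\<forall>\<^sub>F h in F. dist (u (\<tau> h) (\<Phi> h)) 0 < e"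
  proof eventually_elim
    case (elim h)
    then have "norm (u (\<tau> h) (\<Phi> h)) \<le> C * d"
      using CN(2)[of "\<tau> h"] unfolding seminorm_bound_def by auto
    then show ?case using \<open>C * d < e\<close> by simp
  qed
qed

lemma dist_curve_continuous:
  fixes u :: "real \<Rightarrow> (real \<Rightarrow> 'a::{real_normed_field,euclidean_space}) \<Rightarrow> 'a"
  assumes u: "\<And>t. u t \<in> distributions" "\<And>\<phi>. \<phi> \<in> test_functions \<Longrightarrow> continuous_on UNIV (\<lambda>t. u t \<phi>)"
    and E: "test_curve E"
  shows "continuous_on UNIV (\<lambda>t. u t (E t))"
proof -
  note test = test_curve_test_functions[OF E]
  have "((\<lambda>t. u t (E t)) \<longlongrightarrow> u t0 (E t0)) (at t0)" for t0
  proof -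
    obtain K where K: "compact K" "\<And>t. \<bar>t\<bar> \<le> \<bar>t0\<bar> + 1 \<Longrightarrow> supp (E t) \<subseteq> K"
      using test_curve_support[OF E] by metis
    let ?\<Phi> = "\<lambda>t x. 1 *\<^sub>R E t x + (- 1) *\<^sub>R E t0 x"
    have "((\<lambda>t. u t (?\<Phi> t)) \<longlongrightarrow> 0) (at t0)"
    proof (rule dist_curve_tendsto_zero[OF u K(1)])
      have "supp (?\<Phi> t) \<subseteq> K" if "\<bar>t\<bar> \<le> \<bar>t0\<bar> + 1" for t
        using K(2)[OF that] K(2)[of t0] by (simp add: supp_subset_iff[OF compact_imp_closed[OF K(1)]])
      moreover have "\<forall>\<^sub>F t in at t0. \<bar>t\<bar> \<le> \<bar>t0\<bar> + 1"
        unfolding eventually_at by (intro exI[of _ 1]) (auto simp: dist_real_def)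
      ultimately show "\<forall>\<^sub>F t in at t0. ?\<Phi> t \<in> test_functions \<and> supp (?\<Phi> t) \<subseteq> K \<and> \<bar>t\<bar> \<le> \<bar>t0\<bar> + 1"
        using test_functions_combineR(1)[OF test test] by (blast intro: eventually_mono)
      show "\<forall>\<^sub>F t in at t0. \<forall>x. norm ((vderiv ^^ j) (?\<Phi> t) x) \<le> e" if "e > 0" for j e
        using test_curve_uniform[OF E that, of j t0]
        unfolding test_functions_combineR(2)[OF test test] eventually_at_filter
        by (auto elim: eventually_mono)
    qed
    moreover have "((\<lambda>t. u t (E t0)) \<longlongrightarrow> u t0 (E t0)) (at t0)"
      using u(2)[OF test, of t0] by (simp add: continuous_on_eq_continuous_at isCont_def)
    ultimately have "((\<lambda>t. u t (?\<Phi> t) + u t (E t0)) \<longlongrightarrow> 0 + u t0 (E t0)) (at t0)"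
      by (rule tendsto_add)
    then show ?thesis
      using dist_linearR[OF u(1) test test, of _ 1 _ "- 1"] by simp
  qed
  then show ?thesis by (simp add: continuous_on_def)
qed

lemma dist_C1_derivD:
  assumes "dist_C1_deriv u u'"
  shows "u t \<in> distributions" "u' t \<in> distributions"
    and "\<phi> \<in> test_functions \<Longrightarrow> ((\<lambda>s. u s \<phi>) has_vector_derivative u' t \<phi>) (at t)"
    and "\<phi> \<in> test_functions \<Longrightarrow> continuous_on UNIV (\<lambda>t. u t \<phi>)"
    and "\<phi> \<in> test_functions \<Longrightarrow> continuous_on UNIV (\<lambda>t. u' t \<phi>)"
proof -
  show "u t \<in> distributions" "u' t \<in> distributions"
    using assms by (auto simp: dist_C1_deriv_def)
  show D: "((\<lambda>s. u s \<phi>) has_vector_derivative u' t \<phi>) (at t)" if "\<phi> \<in> test_functions" for t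
    using assms that by (simp add: dist_C1_deriv_def has_vector_derivative_iff_difference_quotient)
  show "continuous_on UNIV (\<lambda>t. u t \<phi>)" if "\<phi> \<in> test_functions"
    using has_vector_derivative_continuous[OF D[OF that]] by (simp add: continuous_on_eq_continuous_at)
  show "continuous_on UNIV (\<lambda>t. u' t \<phi>)" if "\<phi> \<in> test_functions"
    using assms that by (simp add: dist_C1_deriv_def continuous_on_eq_continuous_at isCont_iff)
qed

text \<open>The difference quotient is split into three terms: the increment of \<open>u\<close>
  tested on \<open>E t\<close>, \<open>u (t + h)\<close> tested on the error of the difference
  quotient of \<open>E\<close>, and \<open>u (t + h)\<close> tested on \<open>E' t\<close>. The
  first and the last have fixed test functions and converge by hypothesis; the middle one is where
  equicontinuity enters.\<close>

theorem dist_curve_product_rule: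
  fixes u :: "real \<Rightarrow> (real \<Rightarrow> 'a::{real_normed_field,euclidean_space}) \<Rightarrow> 'a"
  assumes u: "dist_C1_deriv u u'" and E: "test_curve_deriv E E'"
  shows "((\<lambda>t. u t (E t)) has_vector_derivative u' t (E t) + u t (E' t)) (at t)"
proof -
  note ud = dist_C1_derivD(1)[OF u]
  have EE: "test_curve E" "test_curve E'" using E by (auto simp: test_curve_deriv_def)
  note test = test_curve_test_functions[OF EE(1)] and test' = test_curve_test_functions[OF EE(2)]
  obtain K where K: "compact K" "\<And>s. \<bar>s\<bar> \<le> \<bar>t\<bar> + 1 \<Longrightarrow> supp (E s) \<subseteq> K"
    using test_curve_support[OF EE(1)] by metis
  obtain K' where K': "compact K'" "\<And>s. \<bar>s\<bar> \<le> \<bar>t\<bar> + 1 \<Longrightarrow> supp (E' s) \<subseteq> K'"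
    using test_curve_support[OF EE(2)] by metis
  \<comment> \<open>Both are written as linear combinations, so that
    \<open>test_functions_combineR\<close> gives membership and derivatives at once.
    \<open>?\<Phi>\<close> is the error of the difference quotient of \<open>E\<close>.\<close>
  let ?Q = "\<lambda>h x. 1 *\<^sub>R E (t + h) x + (- 1) *\<^sub>R E t x"
  let ?\<Phi> = "\<lambda>h x. inverse h *\<^sub>R ?Q h x + (- 1) *\<^sub>R E' t x"
  note Q = test_functions_combineR[OF test test]
  note \<Phi> = test_functions_combineR[OF Q(1) test']
  have near: "\<forall>\<^sub>F h in at 0. \<bar>t + h\<bar> \<le> \<bar>t\<bar> + 1"
    unfolding eventually_at by (intro exI[of _ 1]) (auto simp: dist_real_def)
  have "((\<lambda>h. u (t + h) (?\<Phi> h)) \<longlongrightarrow> 0) (at 0)"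
  proof (rule dist_curve_tendsto_zero[OF ud dist_C1_derivD(4)[OF u] compact_Un[OF K(1) K'(1)]])
    have "supp (?\<Phi> h) \<subseteq> K \<union> K'" if "\<bar>t + h\<bar> \<le> \<bar>t\<bar> + 1" for h
      using K(2)[OF that] K(2)[of t] K'(2)[of t]
      by (simp add: supp_subset_iff compact_imp_closed K(1) K'(1) closed_Un)
    then show "\<forall>\<^sub>F h in at 0. ?\<Phi> h \<in> test_functions \<and> supp (?\<Phi> h) \<subseteq> K \<union> K' \<and> \<bar>t + h\<bar> \<le> \<bar>t\<bar> + 1"
      using near \<Phi>(1) by (blast intro: eventually_mono)
    show "\<forall>\<^sub>F h in at 0. \<forall>x. norm ((vderiv ^^ j) (?\<Phi> h) x) \<le> e" if "e > 0" for j e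
      using test_curve_difference_quotient[OF E that, of j t]
      unfolding \<Phi>(2) Q(2) by simp
  qed
  moreover have "((\<lambda>h. u (t + h) (E' t)) \<longlongrightarrow> u t (E' t)) (at 0)"
    using dist_C1_derivD(4)[OF u test', of t] by (simp add: continuous_on_eq_continuous_at isCont_iff)
  moreover have "((\<lambda>h. (u (t + h) (E t) - u t (E t)) /\<^sub>R h) \<longlongrightarrow> u' t (E t)) (at 0)"
    using dist_C1_derivD(3)[OF u test] by (simp add: has_vector_derivative_iff_difference_quotient)
  ultimately have "((\<lambda>h. (u (t + h) (E t) - u t (E t)) /\<^sub>R h + (u (t + h) (?\<Phi> h) + u (t + h) (E' t)))
      \<longlongrightarrow> u' t (E t) + (0 + u t (E' t))) (at 0)"
    by (intro tendsto_add)
  moreover have "(u (t + h) (E t) - u t (E t)) /\<^sub>R h + (u (t + h) (?\<Phi> h) + u (t + h) (E' t))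
      = (u (t + h) (E (t + h)) - u t (E t)) /\<^sub>R h" for h
    unfolding dist_linearR[OF ud Q(1) test'] dist_linearR[OF ud test test]
    by (simp add: scaleR_diff_right)
  ultimately show ?thesis by (simp add: has_vector_derivative_iff_difference_quotient)
qed

section \<open>The propagators\<close>

definition bessel_coeff :: "real \<Rightarrow> nat \<Rightarrow> real" where
  "bessel_coeff \<alpha> n = \<alpha> ^ (2 * n) / (fact n)\<^sup>2"

text \<open>\<open>bessel_kernel \<alpha> 0\<close> is the entire function \<open>F\<close> with \<open>F (z\<^sup>2) = I\<^sub>0 (2 \<alpha> z)\<close>, and
  \<open>bessel_kernel \<alpha> j\<close> is its \<open>j\<close>-th derivative.\<close>

definition bessel_kernel :: "real \<Rightarrow> nat \<Rightarrow> real \<Rightarrow> real" where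
  "bessel_kernel \<alpha> j s = (\<Sum>n. (diffs ^^ j) (bessel_coeff \<alpha>) n * s ^ n)"

text \<open>One of the two factorials is enough to dominate the terms by those of the exponential
  series at \<open>\<bar>\<alpha>\<^sup>2 * s\<bar>\<close>. Convergence on the whole line is
  inherited by the differentiated series.\<close>

lemma bessel_kernel_summable: "summable (\<lambda>n. (diffs ^^ j) (bessel_coeff \<alpha>) n * s ^ n)"
proof (induction j arbitrary: s)
  case 0
  have "norm (bessel_coeff \<alpha> n * s ^ n) \<le> inverse (fact n) * \<bar>\<alpha>\<^sup>2 * s\<bar> ^ n" for n
  proof -
    have "norm (bessel_coeff \<alpha> n * s ^ n) = inverse (fact n) * (inverse (fact n) * \<bar>\<alpha>\<^sup>2 * s\<bar> ^ n)"
      by (simp add: bessel_coeff_def abs_mult power_mult power_mult_distrib power_abs power2_eq_square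
          divide_inverse mult_ac)
    also have "\<dots> \<le> inverse (fact n) * (1 * \<bar>\<alpha>\<^sup>2 * s\<bar> ^ n)"
      by (intro mult_left_mono mult_right_mono) (auto simp: inverse_le_1_iff)
    finally show ?thesis by simp
  qed
  then show ?case
    unfolding funpow_0 by (rule summable_comparison_test'[OF summable_exp])
next
  case (Suc j)
  then show ?case using termdiff_converges_all[of "(diffs ^^ j) (bessel_coeff \<alpha>)"] by simp
qed

lemma bessel_kernel_deriv:
  "(bessel_kernel \<alpha> j has_real_derivative bessel_kernel \<alpha> (Suc j) s) (at s)"
  using termdiffs_strong_converges_everywhere[OF bessel_kernel_summable, of j \<alpha> s]
  by (simp add: bessel_kernel_def[abs_def])

lemma bessel_kernel_0 [simp]: "bessel_kernel \<alpha> 0 0 = 1"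
  unfolding bessel_kernel_def powser_zero by (simp add: bessel_coeff_def)

lemma bessel_kernel_1 [simp]: "bessel_kernel \<alpha> (Suc 0) 0 = \<alpha>\<^sup>2"
  unfolding bessel_kernel_def powser_zero by (simp add: bessel_coeff_def diffs_def power2_eq_square)

text \<open>Bessel's equation for \<open>I\<^sub>0\<close>, rewritten in the variable
  \<open>s = z\<^sup>2\<close>. On coefficients it is the recursion (n + 1)^2 b(n + 1) = \<alpha>^2
  b(n).\<close>

lemma bessel_kernel_ode:
  "bessel_kernel \<alpha> 1 s + s * bessel_kernel \<alpha> 2 s = \<alpha>\<^sup>2 * bessel_kernel \<alpha> 0 s"
proof -
  let ?b = "bessel_coeff \<alpha>"
  have "(\<lambda>n. real n * diffs ?b n * s ^ (n - Suc 0)) sums bessel_kernel \<alpha> 2 s"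
    using diffs_equiv[of "diffs ?b" s] bessel_kernel_summable[of 2 \<alpha> s]
    by (simp add: bessel_kernel_def numeral_2_eq_2)
  from sums_mult[OF this, of s]
  have "(\<lambda>n. s * (real n * diffs ?b n * s ^ (n - Suc 0))) sums (s * bessel_kernel \<alpha> 2 s)" .
  \<comment> \<open>The factor \<open>s\<close> restores the power lost by differentiation; for
    \<open>n = 0\<close> both sides are 0 because of the factor \<open>real n\<close>.\<close>
  moreover have "s * (real n * diffs ?b n * s ^ (n - Suc 0)) = real n * diffs ?b n * s ^ n" for n
    by (cases n) auto
  ultimately have "(\<lambda>n. real n * diffs ?b n * s ^ n) sums (s * bessel_kernel \<alpha> 2 s)" by simp
  moreover have "(\<lambda>n. diffs ?b n * s ^ n) sums bessel_kernel \<alpha> 1 s"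
    using summable_sums[OF bessel_kernel_summable[of 1 \<alpha> s]] by (simp add: bessel_kernel_def)
  ultimately have "(\<lambda>n. diffs ?b n * s ^ n + real n * diffs ?b n * s ^ n)
      sums (bessel_kernel \<alpha> 1 s + s * bessel_kernel \<alpha> 2 s)"
    by (intro sums_add)
  moreover have "diffs ?b n * s ^ n + real n * diffs ?b n * s ^ n = \<alpha>\<^sup>2 * (?b n * s ^ n)" for n
  proof -
    have "(real n + 1)\<^sup>2 * ?b (Suc n) = \<alpha>\<^sup>2 * ?b n"
    proof -
      have "?b (Suc n) = \<alpha>\<^sup>2 * ?b n / (real n + 1)\<^sup>2"
        by (simp add: bessel_coeff_def power_mult_distrib power2_eq_square mult_ac add.commute)
      then show ?thesis by simp
    qed
    then have "(real n + 1) * diffs ?b n = \<alpha>\<^sup>2 * ?b n"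
      by (simp add: diffs_def power2_eq_square algebra_simps)
    then have "(real n + 1) * diffs ?b n * s ^ n = \<alpha>\<^sup>2 * ?b n * s ^ n" by simp
    then show ?thesis by (simp add: algebra_simps)
  qed
  moreover have "(\<lambda>n. \<alpha>\<^sup>2 * (?b n * s ^ n)) sums (\<alpha>\<^sup>2 * bessel_kernel \<alpha> 0 s)"
    using summable_sums[OF bessel_kernel_summable[of 0 \<alpha> s]]
    by (intro sums_mult) (simp add: bessel_kernel_def)
  ultimately show ?thesis using sums_unique2 by simp
qed

lemma bessel_kernel_continuous [continuous_intros]:
  assumes "continuous_on S f"
  shows "continuous_on S (\<lambda>x. bessel_kernel \<alpha> j (f x))"
proof -
  have "continuous_on UNIV (bessel_kernel \<alpha> j)"
    using bessel_kernel_deriv by (meson DERIV_isCont continuous_at_imp_continuous_on)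
  then show ?thesis by (rule continuous_on_compose2[OF _ assms]) auto
qed

lemma bessel_I0_kernel: "bessel_I0 (2 * \<alpha> * z) = bessel_kernel \<alpha> 0 (z\<^sup>2)"
  unfolding bessel_I0_def bessel_kernel_def
  by (rule suminf_cong) (simp add: bessel_coeff_def power_mult_distrib power_mult[symmetric])

text \<open>Written through F, the derivative of \<open>I\<^sub>0\<close> at
  \<open>2 * \<alpha> * z\<close> is visibly divisible by \<open>z\<close>. The quotient F'(z^2) /
  \<alpha> has at \<open>z = 0\<close> the prescribed limit \<alpha>, because F'(0) =
  \<alpha>^2.\<close>

lemma deriv_bessel_I0:
  assumes "\<alpha> \<noteq> 0"
  shows "deriv bessel_I0 (2 * \<alpha> * z) = bessel_kernel \<alpha> 1 (z\<^sup>2) * z / \<alpha>"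
proof -
  have eq: "bessel_I0 = (\<lambda>y. bessel_kernel \<alpha> 0 ((y / (2 * \<alpha>))\<^sup>2))"
  proof
    fix y show "bessel_I0 y = bessel_kernel \<alpha> 0 ((y / (2 * \<alpha>))\<^sup>2)"
      using bessel_I0_kernel[of \<alpha> "y / (2 * \<alpha>)"] assms by simp
  qed
  have "((\<lambda>y. bessel_kernel \<alpha> 0 ((y / (2 * \<alpha>))\<^sup>2)) has_real_derivative
      bessel_kernel \<alpha> 1 (z\<^sup>2) * (z / \<alpha>)) (at (2 * \<alpha> * z))"
  proof (rule DERIV_chain2[where f="bessel_kernel \<alpha> 0" and g="\<lambda>y. (y / (2 * \<alpha>))\<^sup>2"])
    show "(bessel_kernel \<alpha> 0 has_real_derivative bessel_kernel \<alpha> 1 (z\<^sup>2)) (at ((2 * \<alpha> * z / (2 * \<alpha>))\<^sup>2))"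
      using bessel_kernel_deriv[of \<alpha> 0 "z\<^sup>2"] assms by simp
    show "((\<lambda>y. (y / (2 * \<alpha>))\<^sup>2) has_real_derivative z / \<alpha>) (at (2 * \<alpha> * z))"
      using assms by (auto intro!: derivative_eq_intros simp: power2_eq_square field_simps)
  qed
  then show ?thesis by (simp add: eq[symmetric] DERIV_imp_deriv)
qed

section \<open>Weighted integrals over the rescaled interval [-1,1]\<close>

definition ray_mean :: "real \<Rightarrow> (real \<Rightarrow> real \<Rightarrow> real) \<Rightarrow> (real \<Rightarrow> 'a::banach) \<Rightarrow> real \<Rightarrow> real \<Rightarrow> 'a" where
  "ray_mean c H \<theta> t x = integral {-1..1} (\<lambda>s. H t s *\<^sub>R \<theta> (x - c * t * s))"

lemma ray_mean_integrand_continuous: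
  fixes \<theta> :: "real \<Rightarrow> 'a::banach"
  assumes "continuous_on UNIV (\<lambda>(t, s). H t s)" "continuous_on UNIV \<theta>"
  shows "continuous_on S (\<lambda>((t, x), s). H t s *\<^sub>R \<theta> (x - c * t * s))"
proof -
  have "continuous_on S (\<lambda>p. (\<lambda>(t, s). H t s) (fst (fst p), snd p) *\<^sub>R \<theta> (snd (fst p) - c * fst (fst p) * snd p))"
    by (intro continuous_on_scaleR continuous_on_compose2[OF assms(1)] continuous_on_compose2[OF assms(2)]
        continuous_intros) auto
  then show ?thesis by (simp add: case_prod_unfold)
qed

lemma ray_mean_integrand_continuous_s:
  fixes \<theta> :: "real \<Rightarrow> 'a::banach"
  assumes "continuous_on UNIV (\<lambda>(t, s). H t s)" "continuous_on UNIV \<theta>"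
  shows "continuous_on S (\<lambda>s. H t s *\<^sub>R \<theta> (x - c * t * s))"
  using continuous_on_compose2[OF ray_mean_integrand_continuous[OF assms, of UNIV c], of S "\<lambda>s. ((t, x), s)"]
  by (simp add: continuous_on_Pair)

lemma ray_mean_continuous:
  fixes \<theta> :: "real \<Rightarrow> 'a::banach"
  assumes "continuous_on UNIV (\<lambda>(t, s). H t s)" "continuous_on UNIV \<theta>"
  shows "continuous_on UNIV (\<lambda>(t, x). ray_mean c H \<theta> t x)"
proof -
  have "continuous_on UNIV (\<lambda>p. integral (cbox (-1) 1) (\<lambda>s. H (fst p) s *\<^sub>R \<theta> (snd p - c * fst p * s)))"
    using ray_mean_integrand_continuous[OF assms, of "UNIV \<times> cbox (-1) 1" c]
    by (intro integral_continuous_on_param) (simp add: case_prod_unfold)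
  then show ?thesis by (simp add: ray_mean_def case_prod_unfold)
qed

lemma ray_mean_deriv_x:
  fixes \<theta> :: "real \<Rightarrow> 'a::banach"
  assumes H: "continuous_on UNIV (\<lambda>(t, s). H t s)"
    and \<theta>: "\<And>x. (\<theta> has_vector_derivative \<theta>' x) (at x)" and \<theta>': "continuous_on UNIV \<theta>'"
  shows "((\<lambda>x. ray_mean c H \<theta> t x) has_vector_derivative ray_mean c H \<theta>' t x) (at x)"
proof -
  have c\<theta>: "continuous_on UNIV \<theta>"
    using \<theta> by (meson continuous_at_imp_continuous_on has_vector_derivative_continuous)
  have "((\<lambda>x. integral (cbox (-1) 1) (\<lambda>s. H t s *\<^sub>R \<theta> (x - c * t * s))) has_vector_derivative
      integral (cbox (-1) 1) (\<lambda>s. H t s *\<^sub>R \<theta>' (x - c * t * s))) (at x within UNIV)"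
  proof (rule leibniz_rule_vector_derivative)
    show "((\<lambda>x. H t s *\<^sub>R \<theta> (x - c * t * s)) has_vector_derivative H t s *\<^sub>R \<theta>' (x - c * t * s)) (at x within UNIV)"
      for x s
    proof -
      have "(\<theta> \<circ> (\<lambda>x. x - c * t * s) has_vector_derivative 1 *\<^sub>R \<theta>' (x - c * t * s)) (at x)"
        by (rule vector_diff_chain_at) (auto intro!: derivative_eq_intros \<theta>)
      from bounded_linear.has_vector_derivative[OF bounded_linear_scaleR_right this, of "H t s"]
      show ?thesis by (simp add: o_def)
    qed
    show "(\<lambda>s. H t s *\<^sub>R \<theta> (x - c * t * s)) integrable_on cbox (-1) 1" for x
      by (intro integrable_continuous ray_mean_integrand_continuous_s H c\<theta>)
    show "continuous_on (UNIV \<times> cbox (-1) 1) (\<lambda>(x, s). H t s *\<^sub>R \<theta>' (x - c * t * s))"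
      using continuous_on_compose2[OF ray_mean_integrand_continuous[OF H \<theta>', of UNIV c],
          of "UNIV \<times> cbox (-1) 1" "\<lambda>p. ((t, fst p), snd p)"]
      by (simp add: continuous_on_Pair continuous_on_fst continuous_on_snd case_prod_unfold)
  qed auto
  then show ?thesis by (simp add: ray_mean_def)
qed

text \<open>The domain of integration does not depend on \<open>t\<close>, so differentiation
  produces no boundary terms; the second summand comes from the motion of the point
  \<open>x - c * t * s\<close>.\<close>

lemma ray_mean_deriv_t:
  fixes \<theta> :: "real \<Rightarrow> 'a::banach"
  assumes H: "continuous_on UNIV (\<lambda>(t, s). H t s)" and H': "continuous_on UNIV (\<lambda>(t, s). H' t s)"
    and dH: "\<And>t s. ((\<lambda>t. H t s) has_real_derivative H' t s) (at t)"
    and \<theta>: "\<And>x. (\<theta> has_vector_derivative \<theta>' x) (at x)" and \<theta>': "continuous_on UNIV \<theta>'"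
  shows "((\<lambda>t. ray_mean c H \<theta> t x) has_vector_derivative
    integral {-1..1} (\<lambda>s. H' t s *\<^sub>R \<theta> (x - c * t * s) - (c * s * H t s) *\<^sub>R \<theta>' (x - c * t * s))) (at t)"
proof -
  have c\<theta>: "continuous_on UNIV \<theta>"
    using \<theta> by (meson continuous_at_imp_continuous_on has_vector_derivative_continuous)
  have H2: "continuous_on UNIV (\<lambda>(t, s). c * s * H t s)"
    using H by (auto simp: case_prod_unfold intro!: continuous_intros)
  have "((\<lambda>t. integral (cbox (-1) 1) (\<lambda>s. H t s *\<^sub>R \<theta> (x - c * t * s))) has_vector_derivative
      integral (cbox (-1) 1) (\<lambda>s. H' t s *\<^sub>R \<theta> (x - c * t * s) - (c * s * H t s) *\<^sub>R \<theta>' (x - c * t * s)))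
      (at t within UNIV)"
  proof (rule leibniz_rule_vector_derivative)
    show "((\<lambda>t. H t s *\<^sub>R \<theta> (x - c * t * s)) has_vector_derivative
        H' t s *\<^sub>R \<theta> (x - c * t * s) - (c * s * H t s) *\<^sub>R \<theta>' (x - c * t * s)) (at t within UNIV)" for t s
    proof -
      have "(\<theta> \<circ> (\<lambda>t. x - c * t * s) has_vector_derivative (- c * s) *\<^sub>R \<theta>' (x - c * t * s)) (at t)"
        by (rule vector_diff_chain_at) (auto intro!: derivative_eq_intros \<theta>)
      from has_vector_derivative_scaleR[OF dH this, of s]
      show ?thesis by (simp add: o_def mult_ac)
    qed
    show "(\<lambda>s. H t s *\<^sub>R \<theta> (x - c * t * s)) integrable_on cbox (-1) 1" for t
      by (intro integrable_continuous ray_mean_integrand_continuous_s H c\<theta>)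
    have "continuous_on (UNIV \<times> cbox (-1) 1) (\<lambda>p. H' (fst p) (snd p) *\<^sub>R \<theta> (x - c * fst p * snd p))"
      "continuous_on (UNIV \<times> cbox (-1) 1) (\<lambda>p. (c * snd p * H (fst p) (snd p)) *\<^sub>R \<theta>' (x - c * fst p * snd p))"
      using continuous_on_compose2[OF ray_mean_integrand_continuous[OF H' c\<theta>, of UNIV c],
          of "UNIV \<times> cbox (-1) 1" "\<lambda>p. ((fst p, x), snd p)"]
        continuous_on_compose2[OF ray_mean_integrand_continuous[OF H2 \<theta>', of UNIV c],
          of "UNIV \<times> cbox (-1) 1" "\<lambda>p. ((fst p, x), snd p)"]
      by (simp_all add: continuous_on_Pair continuous_on_fst continuous_on_snd)
    from continuous_on_diff[OF this]
    show "continuous_on (UNIV \<times> cbox (-1) 1)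
        (\<lambda>(t, s). H' t s *\<^sub>R \<theta> (x - c * t * s) - (c * s * H t s) *\<^sub>R \<theta>' (x - c * t * s))"
      by (simp add: case_prod_unfold)
  qed auto
  then show ?thesis by (simp add: ray_mean_def)
qed

lemma ray_mean_zero_outside:
  assumes "\<And>y. R < \<bar>y\<bar> \<Longrightarrow> \<theta> y = 0" "R + \<bar>c * t\<bar> < \<bar>x\<bar>"
  shows "ray_mean c H \<theta> t x = 0"
proof -
  have "\<theta> (x - c * t * s) = 0" if "s \<in> {-1..1}" for s
  proof (rule assms(1))
    have "\<bar>c * t * s\<bar> \<le> \<bar>c * t\<bar> * 1"
      unfolding abs_mult[of "c * t"] using that by (intro mult_left_mono) auto
    then show "R < \<bar>x - c * t * s\<bar>" using assms(2) by linarith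
  qed
  then have "ray_mean c H \<theta> t x = integral {-1..1::real} (\<lambda>s. 0)"
    unfolding ray_mean_def by (intro integral_cong) auto
  then show ?thesis by simp
qed

lemma ray_mean_bound:
  fixes \<theta> :: "real \<Rightarrow> 'a::banach"
  assumes "continuous_on UNIV (\<lambda>(t, s). H t s)" "continuous_on UNIV \<theta>"
    and "\<And>s. s \<in> {-1..1} \<Longrightarrow> \<bar>H t s\<bar> \<le> M" "\<And>y. norm (\<theta> y) \<le> e"
  shows "norm (ray_mean c H \<theta> t x) \<le> 2 * M * e"
proof -
  have "M \<ge> 0" using assms(3)[of 0] by auto
  have "norm (integral {-1..1} (\<lambda>s. H t s *\<^sub>R \<theta> (x - c * t * s))) \<le> M * e * (1 - (- 1))"
  proof (rule integral_bound)
    show "norm (H t s *\<^sub>R \<theta> (x - c * t * s)) \<le> M * e" if "s \<in> {-1..1}" for s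
      using assms(3)[OF that] assms(4) \<open>M \<ge> 0\<close> by (auto intro: mult_mono)
  qed (use ray_mean_integrand_continuous_s[OF assms(1,2)] in auto)
  then show ?thesis by (simp add: ray_mean_def)
qed

section \<open>Operators with finite speed of propagation\<close>

definition wave_operator :: "real \<Rightarrow> real \<Rightarrow> (real \<Rightarrow> 'a::real_normed_vector) \<Rightarrow> real \<Rightarrow> 'a" where
  "wave_operator k c \<theta> = (\<lambda>x. c\<^sup>2 *\<^sub>R (vderiv ^^ 2) \<theta> x + (k\<^sup>2 / 4) *\<^sub>R \<theta> x)"

text \<open>Collects what transposition to distributions uses, so that ray means, the mean of
  boundary values and their sum are treated alike. Commuting with the derivative in x carries
  smoothness, finite speed carries supports, and the sup-norm bound at fixed \<open>t\<close>
  carries the seminorm estimates. Time derivatives are left out because they relate one propagator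
  to another.\<close>

definition finite_speed_propagator ::
    "real \<Rightarrow> ((real \<Rightarrow> 'a::{real_normed_field,euclidean_space}) \<Rightarrow> real \<Rightarrow> real \<Rightarrow> 'a) \<Rightarrow> bool" where
  "finite_speed_propagator c P \<longleftrightarrow>
     (\<forall>\<theta> \<theta>' t x. (\<forall>x. (\<theta> has_vector_derivative \<theta>' x) (at x)) \<longrightarrow> continuous_on UNIV \<theta>' \<longrightarrow>
        (P \<theta> t has_vector_derivative P \<theta>' t x) (at x)) \<and>
     (\<forall>\<theta>. continuous_on UNIV \<theta> \<longrightarrow> continuous_on UNIV (\<lambda>(t, x). P \<theta> t x)) \<and>
     (\<forall>\<theta> R t x. (\<forall>y. R < \<bar>y\<bar> \<longrightarrow> \<theta> y = 0) \<longrightarrow> R + \<bar>c * t\<bar> < \<bar>x\<bar> \<longrightarrow> P \<theta> t x = 0) \<and>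
     (\<forall>t. \<exists>M\<ge>0. \<forall>\<theta> e. continuous_on UNIV \<theta> \<longrightarrow> (\<forall>y. norm (\<theta> y) \<le> e) \<longrightarrow>
        (\<forall>x. norm (P \<theta> t x) \<le> M * e)) \<and>
     (\<forall>\<theta> \<phi> a b t x. continuous_on UNIV \<theta> \<longrightarrow> continuous_on UNIV \<phi> \<longrightarrow>
        P (\<lambda>y. a * \<theta> y + b * \<phi> y) t x = a * P \<theta> t x + b * P \<phi> t x)"

text \<open>One radius serves all functions supported in \<open>K\<close>, which keeps the support
  bounds uniform in the seminorm estimates.\<close>

lemma test_function_radius:
  fixes K :: "real set"
  assumes "compact K"
  obtains R where "\<And>(\<theta> :: real \<Rightarrow> 'b::zero) y. supp \<theta> \<subseteq> K \<Longrightarrow> R < \<bar>y\<bar> \<Longrightarrow> \<theta> y = 0"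
proof -
  obtain R where R: "\<And>y. y \<in> K \<Longrightarrow> norm y \<le> R"
    using compact_imp_bounded[OF assms] unfolding bounded_iff by blast
  have "\<theta> y = 0" if "supp \<theta> \<subseteq> K" "R < \<bar>y\<bar>" for \<theta> :: "real \<Rightarrow> 'b::zero" and y
    using R[of y] that not_in_supp[of y \<theta>] by auto
  then show ?thesis using that by blast
qed

lemma test_functions_continuous: "\<phi> \<in> test_functions \<Longrightarrow> continuous_on S ((vderiv ^^ j) \<phi>)"
  by (rule derivative_tower_continuous[OF test_functions_derivative_tower])

context
  fixes c :: real and P :: "(real \<Rightarrow> 'a::{real_normed_field,euclidean_space}) \<Rightarrow> real \<Rightarrow> real \<Rightarrow> 'a"
  assumes P: "finite_speed_propagator c P"
begin

lemma propagator_deriv: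
  assumes "\<And>x. (\<theta> has_vector_derivative \<theta>' x) (at x)" "continuous_on UNIV \<theta>'"
  shows "(P \<theta> t has_vector_derivative P \<theta>' t x) (at x)"
proof -
  have "\<forall>\<theta> \<theta>' t x. (\<forall>x. (\<theta> has_vector_derivative \<theta>' x) (at x)) \<longrightarrow> continuous_on UNIV \<theta>' \<longrightarrow>
        (P \<theta> t has_vector_derivative P \<theta>' t x) (at x)"
    using P unfolding finite_speed_propagator_def by (elim conjE) assumption
  then show ?thesis using assms by blast
qed

lemma propagator_continuous:
  assumes "continuous_on UNIV \<theta>"
  shows "continuous_on UNIV (\<lambda>(t, x). P \<theta> t x)"
proof -
  have "\<forall>\<theta>. continuous_on UNIV \<theta> \<longrightarrow> continuous_on UNIV (\<lambda>(t, x). P \<theta> t x)"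
    using P unfolding finite_speed_propagator_def by (elim conjE) assumption
  then show ?thesis using assms by blast
qed

lemma propagator_combine:
  assumes "continuous_on UNIV \<theta>" "continuous_on UNIV \<phi>"
  shows "P (\<lambda>y. a * \<theta> y + b * \<phi> y) t x = a * P \<theta> t x + b * P \<phi> t x"
  using P assms unfolding finite_speed_propagator_def by simp

lemma propagator_tower:
  assumes "\<phi> \<in> test_functions"
  shows "derivative_tower (\<lambda>n. P ((vderiv ^^ n) \<phi>) t)"
  unfolding derivative_tower_def
  using derivative_towerD[OF test_functions_derivative_tower[OF assms]]
  by (intro allI propagator_deriv test_functions_continuous assms)

lemma propagator_vderiv:
  assumes "\<phi> \<in> test_functions"
  shows "(vderiv ^^ n) (P \<phi> t) = P ((vderiv ^^ n) \<phi>) t"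
  using vderiv_funpow_tower[OF propagator_tower[OF assms], of n 0] by simp

lemma propagator_zero_outside:
  assumes "\<And>y. R < \<bar>y\<bar> \<Longrightarrow> \<theta> y = 0" "R + \<bar>c * t\<bar> < \<bar>x\<bar>"
  shows "P \<theta> t x = 0"
proof -
  have "\<forall>\<theta> R t x. (\<forall>y. R < \<bar>y\<bar> \<longrightarrow> \<theta> y = 0) \<longrightarrow> R + \<bar>c * t\<bar> < \<bar>x\<bar> \<longrightarrow> P \<theta> t x = 0"
    using P unfolding finite_speed_propagator_def by (elim conjE) assumption
  then show ?thesis using assms by blast
qed

lemma propagator_bound:
  obtains M where "M \<ge> 0"
    "\<And>\<theta> e x. continuous_on UNIV \<theta> \<Longrightarrow> (\<And>y. norm (\<theta> y) \<le> e) \<Longrightarrow> norm (P \<theta> t x) \<le> M * e"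
proof -
  have "\<forall>t. \<exists>M\<ge>0. \<forall>\<theta> e. continuous_on UNIV \<theta> \<longrightarrow> (\<forall>y. norm (\<theta> y) \<le> e) \<longrightarrow> (\<forall>x. norm (P \<theta> t x) \<le> M * e)"
    using P unfolding finite_speed_propagator_def by (elim conjE) assumption
  then show ?thesis using that by blast
qed

lemma propagator_supp:
  assumes "\<And>y. R < \<bar>y\<bar> \<Longrightarrow> \<theta> y = 0" "\<bar>t\<bar> \<le> T"
  shows "supp (P \<theta> t) \<subseteq> cball 0 (R + \<bar>c\<bar> * T)"
proof -
  have "\<bar>c * t\<bar> \<le> \<bar>c\<bar> * T" using assms(2) by (simp add: abs_mult mult_left_mono)
  then show ?thesis
    unfolding supp_subset_iff[OF closed_cball]
    by (auto intro!: propagator_zero_outside[OF assms(1)])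
qed

lemma propagator_test_function:
  assumes "\<phi> \<in> test_functions"
  shows "P \<phi> t \<in> test_functions"
proof -
  obtain R where "\<And>\<theta> y. supp \<theta> \<subseteq> supp \<phi> \<Longrightarrow> R < \<bar>y\<bar> \<Longrightarrow> \<theta> y = (0::'a)"
    using test_function_radius[OF test_functionsD(2)[OF assms]] by metis
  then have "P \<phi> t x = 0" if "x \<notin> cball 0 (R + \<bar>c * t\<bar>)" for x
    using that by (intro propagator_zero_outside[of R]) auto
  then show ?thesis
    using test_functions_tower[OF propagator_tower[OF assms], of "cball 0 (R + \<bar>c * t\<bar>)" 0 t] by simp
qed

lemma propagator_test_curve:
  assumes "\<phi> \<in> test_functions"
  shows "test_curve (P \<phi>)"
  unfolding test_curve_def
proof (intro conjI allI)
  show "P \<phi> t \<in> test_functions" for t by (rule propagator_test_function[OF assms])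
  show "\<exists>K. compact K \<and> (\<forall>t. \<bar>t\<bar> \<le> T \<longrightarrow> supp (P \<phi> t) \<subseteq> K)" for T
  proof -
    obtain R where "\<And>\<theta> y. supp \<theta> \<subseteq> supp \<phi> \<Longrightarrow> R < \<bar>y\<bar> \<Longrightarrow> \<theta> y = (0::'a)"
      using test_function_radius[OF test_functionsD(2)[OF assms]] by metis
    then show ?thesis
      using propagator_supp[of R \<phi>] by (intro exI[of _ "cball 0 (R + \<bar>c\<bar> * T)"]) auto
  qed
  show "continuous_on UNIV (\<lambda>(t, x). (vderiv ^^ j) (P \<phi> t) x)" for j
    unfolding propagator_vderiv[OF assms]
    by (intro propagator_continuous test_functions_continuous assms)
qed

lemma propagator_linear:
  assumes "\<theta> \<in> test_functions" "\<phi> \<in> test_functions"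
  shows "P (\<lambda>y. a * \<theta> y + b * \<phi> y) t = (\<lambda>x. a * P \<theta> t x + b * P \<phi> t x)"
  using test_functions_continuous[OF assms(1), of UNIV 0] test_functions_continuous[OF assms(2), of UNIV 0]
  by (auto simp: fun_eq_iff propagator_combine)

end

text \<open>Transposition of a linear map on test functions. The number \<open>m\<close> is the loss
  of derivatives: 0 for the propagators, which commute with differentiation, and 2 for the wave
  operator.\<close>

lemma distributions_compose:
  fixes u :: "(real \<Rightarrow> 'a::{real_normed_field,euclidean_space}) \<Rightarrow> 'a"
  assumes u: "u \<in> distributions"
    and test: "\<And>\<phi>. \<phi> \<in> test_functions \<Longrightarrow> P \<phi> \<in> test_functions"
    and lin: "\<And>\<phi> \<theta> a b. \<phi> \<in> test_functions \<Longrightarrow> \<theta> \<in> test_functions \<Longrightarrow>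
        P (\<lambda>x. a * \<phi> x + b * \<theta> x) = (\<lambda>x. a * P \<phi> x + b * P \<theta> x)"
    and bound: "\<And>K. compact K \<Longrightarrow> \<exists>K' M. compact K' \<and> (\<forall>\<phi>\<in>test_functions. supp \<phi> \<subseteq> K \<longrightarrow> supp (P \<phi>) \<subseteq> K' \<and>
        (\<forall>N e. (\<forall>j\<le>N + m. \<forall>x. norm ((vderiv ^^ j) \<phi> x) \<le> e) \<longrightarrow> (\<forall>j\<le>N. \<forall>x. norm ((vderiv ^^ j) (P \<phi>) x) \<le> M * e)))"
  shows "on_test_functions (\<lambda>\<phi>. u (P \<phi>)) \<in> distributions"
  unfolding distributions_iff
proof (intro conjI allI ballI impI)
  fix \<phi> :: "real \<Rightarrow> 'a" assume "\<phi> \<notin> test_functions"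
  then show "on_test_functions (\<lambda>\<phi>. u (P \<phi>)) \<phi> = 0" by (simp add: on_test_functions_def)
next
  fix \<phi> \<theta> :: "real \<Rightarrow> 'a" and a b assume "\<phi> \<in> test_functions" "\<theta> \<in> test_functions"
  then show "on_test_functions (\<lambda>\<phi>. u (P \<phi>)) (\<lambda>x. a * \<phi> x + b * \<theta> x) =
      a * on_test_functions (\<lambda>\<phi>. u (P \<phi>)) \<phi> + b * on_test_functions (\<lambda>\<phi>. u (P \<phi>)) \<theta>"
    by (simp add: on_test_functions_def test_functions_combine(1) lin dist_linear[OF u] test)
next
  fix K :: "real set" assume "compact K"
  from bound[OF this] obtain K' M where K': "compact K'" and
    M: "\<And>\<phi>. \<phi> \<in> test_functions \<Longrightarrow> supp \<phi> \<subseteq> K \<Longrightarrow> supp (P \<phi>) \<subseteq> K'"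
      "\<And>\<phi> N e. \<phi> \<in> test_functions \<Longrightarrow> supp \<phi> \<subseteq> K \<Longrightarrow> (\<forall>j\<le>N + m. \<forall>x. norm ((vderiv ^^ j) \<phi> x) \<le> e) \<Longrightarrow>
        (\<forall>j\<le>N. \<forall>x. norm ((vderiv ^^ j) (P \<phi>) x) \<le> M * e)" by metis
  obtain C N where CN: "seminorm_bound u K' C N"
    using u K' by (auto simp: distributions_iff)
  have "seminorm_bound (on_test_functions (\<lambda>\<phi>. u (P \<phi>))) K (C * M) (N + m)"
    unfolding seminorm_bound_def
  proof (intro ballI allI impI)
    fix \<phi> :: "real \<Rightarrow> 'a" and e
    assume \<phi>: "\<phi> \<in> test_functions" "supp \<phi> \<subseteq> K" "\<forall>j\<le>N + m. \<forall>x. norm ((vderiv ^^ j) \<phi> x) \<le> e"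
    have "norm (u (P \<phi>)) \<le> C * (M * e)"
      using CN[unfolded seminorm_bound_def, rule_format, of "P \<phi>" "M * e"] test[OF \<phi>(1)] M(1)[OF \<phi>(1,2)] M(2)[OF \<phi>]
      by blast
    then show "norm (on_test_functions (\<lambda>\<phi>. u (P \<phi>)) \<phi>) \<le> C * M * e"
      using \<phi>(1) by (simp add: on_test_functions_def mult.assoc)
  qed
  then show "\<exists>C N. seminorm_bound (on_test_functions (\<lambda>\<phi>. u (P \<phi>))) K C N" by blast
qed

lemma distributions_propagate:
  fixes u :: "(real \<Rightarrow> 'a::{real_normed_field,euclidean_space}) \<Rightarrow> 'a"
  assumes P: "finite_speed_propagator c P" and u: "u \<in> distributions"
  shows "on_test_functions (\<lambda>\<phi>. u (P \<phi> t)) \<in> distributions"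
proof (rule distributions_compose[OF u, where m=0])
  show "\<phi> \<in> test_functions \<Longrightarrow> P \<phi> t \<in> test_functions" for \<phi>
    by (rule propagator_test_function[OF P])
  show "\<phi> \<in> test_functions \<Longrightarrow> \<theta> \<in> test_functions \<Longrightarrow>
      P (\<lambda>x. a * \<phi> x + b * \<theta> x) t = (\<lambda>x. a * P \<phi> t x + b * P \<theta> t x)" for \<phi> \<theta> a b
    by (rule propagator_linear[OF P])
  fix K :: "real set" assume "compact K"
  then obtain R where R: "\<And>\<theta> y. supp \<theta> \<subseteq> K \<Longrightarrow> R < \<bar>y\<bar> \<Longrightarrow> \<theta> y = (0::'a)"
    using test_function_radius by metis
  obtain M where M: "\<And>\<theta> e x. continuous_on UNIV \<theta> \<Longrightarrow> (\<And>y. norm (\<theta> y) \<le> e) \<Longrightarrow> norm (P \<theta> t x) \<le> M * e"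
    using propagator_bound[OF P, of t] by metis
  have "supp (P \<phi> t) \<subseteq> cball 0 (R + \<bar>c\<bar> * \<bar>t\<bar>)" if "supp \<phi> \<subseteq> K" for \<phi>
    by (rule propagator_supp[OF P]) (use R[OF that] in auto)
  moreover have "norm ((vderiv ^^ j) (P \<phi> t) x) \<le> M * e"
    if "\<phi> \<in> test_functions" "\<forall>j\<le>N + 0. \<forall>x. norm ((vderiv ^^ j) \<phi> x) \<le> e" "j \<le> N" for \<phi> N e j x
    unfolding propagator_vderiv[OF P that(1)]
    using that by (intro M test_functions_continuous) auto
  ultimately show "\<exists>K' M. compact K' \<and> (\<forall>\<phi>\<in>test_functions. supp \<phi> \<subseteq> K \<longrightarrow> supp (P \<phi> t) \<subseteq> K' \<and>
      (\<forall>N e. (\<forall>j\<le>N + 0. \<forall>x. norm ((vderiv ^^ j) \<phi> x) \<le> e) \<longrightarrow>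
        (\<forall>j\<le>N. \<forall>x. norm ((vderiv ^^ j) (P \<phi> t) x) \<le> M * e)))"
    by (intro exI[of _ "cball 0 (R + \<bar>c\<bar> * \<bar>t\<bar>)"] exI[of _ M]) auto
qed

lemma distributions_add:
  assumes "u \<in> distributions" "w \<in> distributions"
  shows "(\<lambda>\<phi>. u \<phi> + w \<phi>) \<in> distributions"
  unfolding distributions_iff
proof (intro conjI allI ballI impI)
  fix K :: "real set" assume K: "compact K"
  obtain C N D M where CN: "seminorm_bound u K C N" "seminorm_bound w K D M"
    using assms K unfolding distributions_iff by metis
  have "seminorm_bound (\<lambda>\<phi>. u \<phi> + w \<phi>) K (C + D) (max N M)"
    unfolding seminorm_bound_def
  proof (intro ballI allI impI)
    fix \<phi> :: "real \<Rightarrow> 'a" and e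
    assume \<phi>: "\<phi> \<in> test_functions" "supp \<phi> \<subseteq> K" "\<forall>j\<le>max N M. \<forall>x. norm ((vderiv ^^ j) \<phi> x) \<le> e"
    have "norm (u \<phi>) \<le> C * e" "norm (w \<phi>) \<le> D * e"
      using CN \<phi> unfolding seminorm_bound_def by auto
    then show "norm (u \<phi> + w \<phi>) \<le> (C + D) * e"
      using norm_triangle_ineq[of "u \<phi>" "w \<phi>"] by (simp add: distrib_right)
  qed
  then show "\<exists>C N. seminorm_bound (\<lambda>\<phi>. u \<phi> + w \<phi>) K C N" by blast
qed (use assms in \<open>auto simp: dist_outside dist_linear algebra_simps\<close>)

lemma distributions_scaleR:
  assumes "u \<in> distributions"
  shows "(\<lambda>\<phi>. r *\<^sub>R u \<phi>) \<in> distributions"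
  unfolding distributions_iff
proof (intro conjI allI ballI impI)
  fix K :: "real set" assume K: "compact K"
  obtain C N where CN: "seminorm_bound u K C N"
    using assms K unfolding distributions_iff by metis
  have "seminorm_bound (\<lambda>\<phi>. r *\<^sub>R u \<phi>) K (\<bar>r\<bar> * C) N"
    using CN unfolding seminorm_bound_def by (auto simp: mult.assoc intro!: mult_left_mono)
  then show "\<exists>C N. seminorm_bound (\<lambda>\<phi>. r *\<^sub>R u \<phi>) K C N" by blast
qed (use assms in \<open>auto simp: dist_outside dist_linear scaleR_add_right\<close>)

lemma wave_operator_test_function:
  fixes \<theta> :: "real \<Rightarrow> 'a::real_normed_algebra_1"
  assumes "\<theta> \<in> test_functions"
  shows "wave_operator k c \<theta> \<in> test_functions"
    "(vderiv ^^ j) (wave_operator k c \<theta>) = (\<lambda>x. c\<^sup>2 *\<^sub>R (vderiv ^^ (j + 2)) \<theta> x + (k\<^sup>2 / 4) *\<^sub>R (vderiv ^^ j) \<theta> x)"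
proof -
  note test_functions_combineR[OF test_functions_vderiv[OF assms, of 2] assms, where r="c\<^sup>2" and s="k\<^sup>2 / 4"]
  then show "wave_operator k c \<theta> \<in> test_functions"
    "(vderiv ^^ j) (wave_operator k c \<theta>) = (\<lambda>x. c\<^sup>2 *\<^sub>R (vderiv ^^ (j + 2)) \<theta> x + (k\<^sup>2 / 4) *\<^sub>R (vderiv ^^ j) \<theta> x)"
    unfolding wave_operator_def funpow_add by simp_all
qed

lemma distributions_wave_operator:
  fixes u :: "(real \<Rightarrow> 'a::{real_normed_field,euclidean_space}) \<Rightarrow> 'a"
  assumes u: "u \<in> distributions"
  shows "on_test_functions (\<lambda>\<phi>. u (wave_operator k c \<phi>)) \<in> distributions"
proof (rule distributions_compose[OF u, where m=2])
  show "\<phi> \<in> test_functions \<Longrightarrow> wave_operator k c \<phi> \<in> test_functions" for \<phi> :: "real \<Rightarrow> 'a"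
    by (rule wave_operator_test_function)
  show "wave_operator k c (\<lambda>x. a * \<phi> x + b * \<theta> x) = (\<lambda>x. a * wave_operator k c \<phi> x + b * wave_operator k c \<theta> x)"
    if "\<phi> \<in> test_functions" "\<theta> \<in> test_functions" for \<phi> \<theta> :: "real \<Rightarrow> 'a" and a b
    unfolding wave_operator_def test_functions_combine(2)[OF that] by (simp add: algebra_simps)
  fix K :: "real set" assume K: "compact K"
  have "supp (wave_operator k c \<phi>) \<subseteq> K" if "\<phi> \<in> test_functions" "supp \<phi> \<subseteq> K" for \<phi> :: "real \<Rightarrow> 'a"
    using vderiv_zero_outside[OF that(1) compact_imp_closed[OF K] that(2), of _ 2]
      vderiv_zero_outside[OF that(1) compact_imp_closed[OF K] that(2), of _ 0]
    by (simp add: supp_subset_iff[OF compact_imp_closed[OF K]] wave_operator_def)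
  moreover have "norm ((vderiv ^^ j) (wave_operator k c \<phi>) x) \<le> (c\<^sup>2 + k\<^sup>2 / 4) * e"
    if "\<phi> \<in> test_functions" "\<forall>j\<le>N + 2. \<forall>x. norm ((vderiv ^^ j) \<phi> x) \<le> e" "j \<le> N" for \<phi> :: "real \<Rightarrow> 'a" and N e j x
  proof -
    have "norm (c\<^sup>2 *\<^sub>R (vderiv ^^ (j + 2)) \<phi> x + (k\<^sup>2 / 4) *\<^sub>R (vderiv ^^ j) \<phi> x)
        \<le> c\<^sup>2 * norm ((vderiv ^^ (j + 2)) \<phi> x) + k\<^sup>2 / 4 * norm ((vderiv ^^ j) \<phi> x)"
      by (rule order_trans[OF norm_triangle_ineq]) simp
    also have "\<dots> \<le> c\<^sup>2 * e + k\<^sup>2 / 4 * e"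
      using that(2)[rule_format, of "j + 2"] that(2)[rule_format, of j] that(3)
      by (intro add_mono mult_left_mono) auto
    finally show ?thesis by (simp add: wave_operator_test_function(2)[OF that(1)] distrib_right)
  qed
  ultimately show "\<exists>K' M. compact K' \<and> (\<forall>\<phi>\<in>test_functions :: (real \<Rightarrow> 'a) set. supp \<phi> \<subseteq> K \<longrightarrow> supp (wave_operator k c \<phi>) \<subseteq> K' \<and>
      (\<forall>N e. (\<forall>j\<le>N + 2. \<forall>x. norm ((vderiv ^^ j) \<phi> x) \<le> e) \<longrightarrow>
        (\<forall>j\<le>N. \<forall>x. norm ((vderiv ^^ j) (wave_operator k c \<phi>) x) \<le> M * e)))"
    using K by (intro exI[of _ K] exI[of _ "c\<^sup>2 + k\<^sup>2 / 4"]) auto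
qed

section \<open>The kernels in rescaled form and their time derivatives\<close>

definition psi_conv :: "real \<Rightarrow> real \<Rightarrow> (real \<Rightarrow> 'a::banach) \<Rightarrow> real \<Rightarrow> real \<Rightarrow> 'a" where
  "psi_conv \<alpha> c = ray_mean c (\<lambda>t s. t / 2 * bessel_kernel \<alpha> 0 (c\<^sup>2 * t\<^sup>2 * (1 - s\<^sup>2)))"

text \<open>The weight is the density of \<psi>_t times the Jacobian |c t|: the factor |c t| c |t|
  becomes c^2 t^2. In the same way |c t| sgn t / (2 c) = t / 2 yields the weight of
  \<open>psi_conv\<close>. Both weights are smooth in \<open>t\<close> across 0, unlike the factors
  they come from.\<close>

definition psi_t_conv :: "real \<Rightarrow> real \<Rightarrow> (real \<Rightarrow> 'a::banach) \<Rightarrow> real \<Rightarrow> real \<Rightarrow> 'a" where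
  "psi_t_conv \<alpha> c \<theta> t x = (1 / 2) *\<^sub>R (\<theta> (x - c * t) + \<theta> (x + c * t)) +
     ray_mean c (\<lambda>t s. c\<^sup>2 * t\<^sup>2 * bessel_kernel \<alpha> 1 (c\<^sup>2 * t\<^sup>2 * (1 - s\<^sup>2))) \<theta> t x"

lemma ray_mean_propagator:
  assumes H: "continuous_on UNIV (\<lambda>(t, s). H t s)"
  shows "finite_speed_propagator c (ray_mean c H :: (real \<Rightarrow> 'a::{real_normed_field,euclidean_space}) \<Rightarrow> _)"
  unfolding finite_speed_propagator_def
proof (intro conjI allI impI)
  fix \<theta> \<theta>' :: "real \<Rightarrow> 'a" and t x
  assume "\<forall>x. (\<theta> has_vector_derivative \<theta>' x) (at x)" "continuous_on UNIV \<theta>'"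
  then show "(ray_mean c H \<theta> t has_vector_derivative ray_mean c H \<theta>' t x) (at x)"
    using ray_mean_deriv_x[OF H] by blast
next
  fix t
  have "continuous_on {-1..1} (\<lambda>s. H t s)"
    using continuous_on_compose2[OF H, of "{-1..1}" "\<lambda>s. (t, s)"] by (simp add: continuous_on_Pair)
  then have "bounded ((\<lambda>s. H t s) ` {-1..1})"
    by (intro compact_imp_bounded compact_continuous_image) auto
  then obtain M where "\<forall>y\<in>(\<lambda>s. H t s) ` {-1..1}. norm y \<le> M"
    unfolding bounded_iff by blast
  then have M: "\<bar>H t s\<bar> \<le> M" if "s \<in> {-1..1}" for s using that by auto
  from M[of 0] have "M \<ge> 0" by simp
  then show "\<exists>M\<ge>0. \<forall>\<theta> e. continuous_on UNIV \<theta> \<longrightarrow> (\<forall>y. norm (\<theta> y) \<le> e) \<longrightarrow>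
      (\<forall>x. norm (ray_mean c H \<theta> t x :: 'a) \<le> M * e)"
    using ray_mean_bound[OF H _ M] by (intro exI[of _ "2 * M"]) auto
next
  fix \<theta> \<phi> :: "real \<Rightarrow> 'a" and a b t x assume c: "continuous_on UNIV \<theta>" "continuous_on UNIV \<phi>"
  let ?I = "\<lambda>\<theta> s. H t s *\<^sub>R \<theta> (x - c * t * s)"
  have "?I \<theta> integrable_on {-1..1}" "?I \<phi> integrable_on {-1..1}"
    by (intro integrable_continuous_real ray_mean_integrand_continuous_s H c)+
  then have "((\<lambda>s. a * ?I \<theta> s + b * ?I \<phi> s) has_integral a * ray_mean c H \<theta> t x + b * ray_mean c H \<phi> t x) {-1..1}"
    unfolding ray_mean_def by (intro has_integral_add has_integral_mult_right) (auto simp: has_integral_integral)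
  then show "ray_mean c H (\<lambda>y. a * \<theta> y + b * \<phi> y) t x = a * ray_mean c H \<theta> t x + b * ray_mean c H \<phi> t x"
    unfolding ray_mean_def[of c H "\<lambda>y. a * \<theta> y + b * \<phi> y"] by (intro integral_unique) (simp add: scaleR_add_right)
qed (auto intro: ray_mean_continuous[OF H] ray_mean_zero_outside)

lemma psi_conv_propagator:
  "finite_speed_propagator c (psi_conv \<alpha> c :: (real \<Rightarrow> 'a::{real_normed_field,euclidean_space}) \<Rightarrow> _)"
  unfolding psi_conv_def
  by (rule ray_mean_propagator) (auto simp: case_prod_unfold intro!: continuous_intros)

lemma propagator_add:
  assumes "finite_speed_propagator c P" "finite_speed_propagator c Q"
  shows "finite_speed_propagator c (\<lambda>\<theta> t x. P \<theta> t x + Q \<theta> t x)"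
  unfolding finite_speed_propagator_def
proof (intro conjI)
  show "\<forall>t. \<exists>M\<ge>0. \<forall>\<theta> e. continuous_on UNIV \<theta> \<longrightarrow> (\<forall>y. norm (\<theta> y) \<le> e) \<longrightarrow>
      (\<forall>x. norm (P \<theta> t x + Q \<theta> t x) \<le> M * e)"
  proof
    fix t
    obtain M where M: "M \<ge> 0"
      "\<And>\<theta> e x. continuous_on UNIV \<theta> \<Longrightarrow> (\<And>y. norm (\<theta> y) \<le> e) \<Longrightarrow> norm (P \<theta> t x) \<le> M * e"
      using propagator_bound[OF assms(1), of t] by metis
    obtain N where N: "N \<ge> 0"
      "\<And>\<theta> e x. continuous_on UNIV \<theta> \<Longrightarrow> (\<And>y. norm (\<theta> y) \<le> e) \<Longrightarrow> norm (Q \<theta> t x) \<le> N * e"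
      using propagator_bound[OF assms(2), of t] by metis
    have "norm (P \<theta> t x + Q \<theta> t x) \<le> (M + N) * e"
      if "continuous_on UNIV \<theta>" "\<And>y. norm (\<theta> y) \<le> e" for \<theta> e x
      using norm_triangle_ineq[of "P \<theta> t x" "Q \<theta> t x"] M(2)[OF that, of x] N(2)[OF that, of x]
      by (simp add: distrib_right)
    then show "\<exists>M\<ge>0. \<forall>\<theta> e. continuous_on UNIV \<theta> \<longrightarrow> (\<forall>y. norm (\<theta> y) \<le> e) \<longrightarrow>
        (\<forall>x. norm (P \<theta> t x + Q \<theta> t x) \<le> M * e)"
      using M(1) N(1) by (intro exI[of _ "M + N"]) auto
  qed
  show "\<forall>\<theta>. continuous_on UNIV \<theta> \<longrightarrow> continuous_on UNIV (\<lambda>(t, x). P \<theta> t x + Q \<theta> t x)"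
    using continuous_on_add[OF propagator_continuous[OF assms(1)] propagator_continuous[OF assms(2)]]
    by (simp add: case_prod_unfold)
  show "\<forall>\<theta> \<phi> a b t x. continuous_on UNIV \<theta> \<longrightarrow> continuous_on UNIV \<phi> \<longrightarrow>
      P (\<lambda>y. a * \<theta> y + b * \<phi> y) t x + Q (\<lambda>y. a * \<theta> y + b * \<phi> y) t x
      = a * (P \<theta> t x + Q \<theta> t x) + b * (P \<phi> t x + Q \<phi> t x)"
    by (simp add: propagator_combine[OF assms(1)] propagator_combine[OF assms(2)] algebra_simps)
  show "\<forall>\<theta> R t x. (\<forall>y. R < \<bar>y\<bar> \<longrightarrow> \<theta> y = 0) \<longrightarrow> R + \<bar>c * t\<bar> < \<bar>x\<bar> \<longrightarrow> P \<theta> t x + Q \<theta> t x = 0"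
    using propagator_zero_outside[OF assms(1)] propagator_zero_outside[OF assms(2)] by (metis add_0)
  show "\<forall>\<theta> \<theta>' t x. (\<forall>x. (\<theta> has_vector_derivative \<theta>' x) (at x)) \<longrightarrow> continuous_on UNIV \<theta>' \<longrightarrow>
      ((\<lambda>x. P \<theta> t x + Q \<theta> t x) has_vector_derivative P \<theta>' t x + Q \<theta>' t x) (at x)"
    by (intro allI impI has_vector_derivative_add propagator_deriv[OF assms(1)] propagator_deriv[OF assms(2)]) auto
qed

text \<open>The d'Alembert part of \<open>psi_t_conv\<close>, which comes from the two Dirac
  masses.\<close>

lemma boundary_mean_propagator:
  "finite_speed_propagator c (\<lambda>(\<theta> :: real \<Rightarrow> 'a::{real_normed_field,euclidean_space}) t x.
     (1 / 2) *\<^sub>R (\<theta> (x - c * t) + \<theta> (x + c * t)))"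
  unfolding finite_speed_propagator_def
proof (intro conjI allI impI)
  fix \<theta> \<theta>' :: "real \<Rightarrow> 'a" and t x
  assume \<theta>: "\<forall>x. (\<theta> has_vector_derivative \<theta>' x) (at x)"
  have "(\<theta> \<circ> (\<lambda>x. x - c * t) has_vector_derivative 1 *\<^sub>R \<theta>' (x - c * t)) (at x)"
    "(\<theta> \<circ> (\<lambda>x. x + c * t) has_vector_derivative 1 *\<^sub>R \<theta>' (x + c * t)) (at x)"
    by (rule vector_diff_chain_at; auto intro!: derivative_eq_intros \<theta>[rule_format])+
  from bounded_linear.has_vector_derivative[OF bounded_linear_scaleR_right has_vector_derivative_add[OF this], of "1 / 2"]
  show "((\<lambda>x. (1 / 2) *\<^sub>R (\<theta> (x - c * t) + \<theta> (x + c * t))) has_vector_derivative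
      (1 / 2) *\<^sub>R (\<theta>' (x - c * t) + \<theta>' (x + c * t))) (at x)" by (simp add: o_def)
next
  fix \<theta> :: "real \<Rightarrow> 'a" assume \<theta>: "continuous_on UNIV \<theta>"
  have "continuous_on UNIV (\<lambda>p. (1 / 2) *\<^sub>R (\<theta> (snd p - c * fst p) + \<theta> (snd p + c * fst p)))"
    by (intro continuous_on_scaleR continuous_on_add continuous_on_const continuous_on_compose2[OF \<theta>])
       (auto intro!: continuous_intros)
  then show "continuous_on UNIV (\<lambda>(t, x). (1 / 2) *\<^sub>R (\<theta> (x - c * t) + \<theta> (x + c * t)))"
    by (simp add: case_prod_unfold)
next
  fix \<theta> :: "real \<Rightarrow> 'a" and R t x assume "\<forall>y. R < \<bar>y\<bar> \<longrightarrow> \<theta> y = 0" "R + \<bar>c * t\<bar> < \<bar>x\<bar>"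
  moreover from this have "R < \<bar>x - c * t\<bar>" "R < \<bar>x + c * t\<bar>" by linarith+
  ultimately show "(1 / 2) *\<^sub>R (\<theta> (x - c * t) + \<theta> (x + c * t)) = 0" by simp
next
  fix t
  have "norm ((1 / 2) *\<^sub>R (\<theta> (x - c * t) + \<theta> (x + c * t))) \<le> 1 * e" if "\<forall>y. norm (\<theta> y) \<le> e" for \<theta> :: "real \<Rightarrow> 'a" and e x
    using norm_triangle_ineq[of "\<theta> (x - c * t)" "\<theta> (x + c * t)"] that[rule_format, of "x - c * t"]
      that[rule_format, of "x + c * t"] by simp
  then show "\<exists>M\<ge>0. \<forall>(\<theta> :: real \<Rightarrow> 'a) e. continuous_on UNIV \<theta> \<longrightarrow> (\<forall>y. norm (\<theta> y) \<le> e) \<longrightarrow>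
      (\<forall>x. norm ((1 / 2) *\<^sub>R (\<theta> (x - c * t) + \<theta> (x + c * t))) \<le> M * e)"
    by (intro exI[of _ 1]) auto
qed (simp add: algebra_simps)

lemma psi_t_conv_propagator:
  "finite_speed_propagator c (psi_t_conv \<alpha> c :: (real \<Rightarrow> 'a::{real_normed_field,euclidean_space}) \<Rightarrow> _)"
proof -
  let ?H = "\<lambda>t s. c\<^sup>2 * t\<^sup>2 * bessel_kernel \<alpha> 1 (c\<^sup>2 * t\<^sup>2 * (1 - s\<^sup>2))"
  have "finite_speed_propagator c (ray_mean c ?H :: (real \<Rightarrow> 'a) \<Rightarrow> _)"
    by (rule ray_mean_propagator) (auto simp: case_prod_unfold intro!: continuous_intros)
  from propagator_add[OF boundary_mean_propagator this] show ?thesis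
    by (simp add: psi_t_conv_def[abs_def])
qed

lemma has_vector_derivative_ray:
  fixes \<theta> :: "real \<Rightarrow> 'a::real_normed_vector"
  assumes "\<And>x. (\<theta> has_vector_derivative \<theta>' x) (at x)"
  shows "((\<lambda>s. \<theta> (x - a * s)) has_vector_derivative (- a) *\<^sub>R \<theta>' (x - a * s)) (at s within S)"
    and "((\<lambda>s. \<theta> (x + a * s)) has_vector_derivative a *\<^sub>R \<theta>' (x + a * s)) (at s within S)"
proof -
  have "(\<theta> \<circ> (\<lambda>s. x - a * s) has_vector_derivative (- a) *\<^sub>R \<theta>' (x - a * s)) (at s)"
    "(\<theta> \<circ> (\<lambda>s. x + a * s) has_vector_derivative a *\<^sub>R \<theta>' (x + a * s)) (at s)"
    by (rule vector_diff_chain_at; auto intro!: derivative_eq_intros assms)+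
  then show "((\<lambda>s. \<theta> (x - a * s)) has_vector_derivative (- a) *\<^sub>R \<theta>' (x - a * s)) (at s within S)"
    "((\<lambda>s. \<theta> (x + a * s)) has_vector_derivative a *\<^sub>R \<theta>' (x + a * s)) (at s within S)"
    by (simp_all add: o_def has_vector_derivative_at_within)
qed

text \<open>The differentiated integrand equals half the s-derivative of s F(c^2 t^2 (1 - s^2))
  \<theta>(x - c t s) plus the integrand of the ray mean in \<open>psi_t_conv\<close>. The total
  derivative integrates to boundary values, and these are the two Dirac terms.\<close>

lemma psi_conv_deriv:
  fixes \<theta> :: "real \<Rightarrow> 'a::banach"
  assumes \<theta>: "\<And>x. (\<theta> has_vector_derivative \<theta>' x) (at x)" and \<theta>': "continuous_on UNIV \<theta>'"
  shows "((\<lambda>t. psi_conv \<alpha> c \<theta> t x) has_vector_derivative psi_t_conv \<alpha> c \<theta> t x) (at t)"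
proof -
  let ?w = "\<lambda>t s. c\<^sup>2 * t\<^sup>2 * (1 - s\<^sup>2)"
  let ?F = "\<lambda>j t s. bessel_kernel \<alpha> j (?w t s)"
  let ?H' = "\<lambda>t s. 1 / 2 * ?F 0 t s + t / 2 * (?F 1 t s * (2 * c\<^sup>2 * t * (1 - s\<^sup>2)))"
  have dF: "((\<lambda>t. ?F j t s) has_real_derivative ?F (Suc j) t s * (2 * c\<^sup>2 * t * (1 - s\<^sup>2))) (at t)" for j t s
    by (rule DERIV_chain2[OF bessel_kernel_deriv]) (auto intro!: derivative_eq_intros)
  have "((\<lambda>t. t / 2 * ?F 0 t s) has_real_derivative ?H' t s) (at t)" for t s
    by (rule DERIV_cong[OF DERIV_mult[OF DERIV_cdivide[OF DERIV_ident, of 2] dF[of 0 s t]]]) simp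
  then have D: "((\<lambda>t. psi_conv \<alpha> c \<theta> t x) has_vector_derivative integral {-1..1} (\<lambda>s. ?H' t s *\<^sub>R \<theta> (x - c * t * s)
      - (c * s * (t / 2 * ?F 0 t s)) *\<^sub>R \<theta>' (x - c * t * s))) (at t)"
    unfolding psi_conv_def
    by (intro ray_mean_deriv_t \<theta> \<theta>') (auto simp: case_prod_unfold intro!: continuous_intros)
  let ?G = "\<lambda>s. ?F 0 t s *\<^sub>R \<theta> (x - c * t * s) - (2 * c\<^sup>2 * t\<^sup>2 * s\<^sup>2 * ?F 1 t s) *\<^sub>R \<theta> (x - c * t * s)
      - (c * t * s * ?F 0 t s) *\<^sub>R \<theta>' (x - c * t * s)"
  have "((\<lambda>s. (s * ?F 0 t s) *\<^sub>R \<theta> (x - c * t * s)) has_vector_derivative ?G s) (at s within {-1..1})" for s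
  proof -
    have "((\<lambda>s. s * ?F 0 t s) has_real_derivative ?F 0 t s - 2 * c\<^sup>2 * t\<^sup>2 * s\<^sup>2 * ?F 1 t s) (at s within {-1..1})"
    proof -
      have "((\<lambda>s. ?F 0 t s) has_real_derivative ?F 1 t s * (- 2 * c\<^sup>2 * t\<^sup>2 * s)) (at s within {-1..1})"
        using bessel_kernel_deriv[of \<alpha> 0 "?w t s"]
        by (intro DERIV_chain2[where f="bessel_kernel \<alpha> 0"]) (auto intro!: derivative_eq_intros)
      from DERIV_mult[OF DERIV_ident this] show ?thesis by (simp add: power2_eq_square mult_ac)
    qed
    from has_vector_derivative_scaleR[OF this has_vector_derivative_ray(1)[of \<theta> \<theta>' x "c * t", OF \<theta>]]
    show ?thesis
      by (rule has_vector_derivative_eq_rhs) (simp add: scaleR_diff_left algebra_simps)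
  qed
  \<comment> \<open>At both ends of the interval the argument of F is 0 and F(0) = 1, so the
    boundary values carry no Bessel factor.\<close>
  then have "(?G has_integral (1 * ?F 0 t 1) *\<^sub>R \<theta> (x - c * t * 1) - (- 1 * ?F 0 t (- 1)) *\<^sub>R \<theta> (x - c * t * (- 1))) {-1..1}"
    by (intro fundamental_theorem_of_calculus[where f="\<lambda>s. (s * ?F 0 t s) *\<^sub>R \<theta> (x - c * t * s)"]) auto
  then have "((\<lambda>s. (1 / 2) *\<^sub>R ?G s) has_integral (1 / 2) *\<^sub>R (\<theta> (x - c * t) + \<theta> (x + c * t))) {-1..1}"
    by (intro has_integral_cmul) simp
  moreover have "((\<lambda>s. (c\<^sup>2 * t\<^sup>2 * ?F 1 t s) *\<^sub>R \<theta> (x - c * t * s)) has_integral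
      ray_mean c (\<lambda>t s. c\<^sup>2 * t\<^sup>2 * ?F 1 t s) \<theta> t x) {-1..1}"
    unfolding ray_mean_def
    by (intro integrable_integral integrable_continuous_real ray_mean_integrand_continuous_s)
       (use \<theta> in \<open>auto simp: case_prod_unfold intro!: continuous_intros
          intro: continuous_at_imp_continuous_on has_vector_derivative_continuous\<close>)
  ultimately have "((\<lambda>s. (1 / 2) *\<^sub>R ?G s + (c\<^sup>2 * t\<^sup>2 * ?F 1 t s) *\<^sub>R \<theta> (x - c * t * s)) has_integral psi_t_conv \<alpha> c \<theta> t x) {-1..1}"
    unfolding psi_t_conv_def by (rule has_integral_add)
  moreover have "(1 / 2) *\<^sub>R ?G s + (c\<^sup>2 * t\<^sup>2 * ?F 1 t s) *\<^sub>R \<theta> (x - c * t * s)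
      = ?H' t s *\<^sub>R \<theta> (x - c * t * s) - (c * s * (t / 2 * ?F 0 t s)) *\<^sub>R \<theta>' (x - c * t * s)" for s
  proof -
    have "(1 / 2) *\<^sub>R ?G s + (c\<^sup>2 * t\<^sup>2 * ?F 1 t s) *\<^sub>R \<theta> (x - c * t * s)
      = (1 / 2 * ?F 0 t s - c\<^sup>2 * t\<^sup>2 * s\<^sup>2 * ?F 1 t s + c\<^sup>2 * t\<^sup>2 * ?F 1 t s) *\<^sub>R \<theta> (x - c * t * s)
        - (1 / 2 * (c * t * s * ?F 0 t s)) *\<^sub>R \<theta>' (x - c * t * s)"
      by (simp add: scaleR_diff_right scaleR_diff_left scaleR_add_left)
    also have "1 / 2 * ?F 0 t s - c\<^sup>2 * t\<^sup>2 * s\<^sup>2 * ?F 1 t s + c\<^sup>2 * t\<^sup>2 * ?F 1 t s = ?H' t s"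
      by (simp add: power2_eq_square algebra_simps)
    also have "1 / 2 * (c * t * s * ?F 0 t s) = c * s * (t / 2 * ?F 0 t s)" by simp
    finally show ?thesis .
  qed
  ultimately show ?thesis using D by (simp add: integral_unique)
qed

text \<open>The total derivative in s is now that of (c / 2) F \<theta>'(x - c t s): under the
  integral it trades \<theta>' for \<theta>'', and its boundary values cancel the time derivative of
  the Dirac terms. The remaining coefficient of \<theta> is matched by the differential equation for
  F.\<close>

lemma psi_t_conv_deriv:
  fixes \<theta> :: "real \<Rightarrow> 'a::banach"
  assumes \<alpha>: "4 * c\<^sup>2 * \<alpha>\<^sup>2 = k\<^sup>2 / 4"
    and \<theta>: "\<And>x. (\<theta> has_vector_derivative \<theta>' x) (at x)" and \<theta>': "\<And>x. (\<theta>' has_vector_derivative \<theta>'' x) (at x)"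
    and \<theta>'': "continuous_on UNIV \<theta>''"
  shows "((\<lambda>t. psi_t_conv \<alpha> c \<theta> t x) has_vector_derivative
    psi_conv \<alpha> c (\<lambda>x. c\<^sup>2 *\<^sub>R \<theta>'' x + (k\<^sup>2 / 4) *\<^sub>R \<theta> x) t x) (at t)"
proof -
  let ?w = "\<lambda>t s. c\<^sup>2 * t\<^sup>2 * (1 - s\<^sup>2)"
  let ?F = "\<lambda>j t s. bessel_kernel \<alpha> j (?w t s)"
  let ?H' = "\<lambda>t s. 2 * c\<^sup>2 * t * ?F 1 t s + c\<^sup>2 * t\<^sup>2 * (?F 2 t s * (2 * c\<^sup>2 * t * (1 - s\<^sup>2)))"
  let ?y = "\<lambda>s. x - c * t * s"
  have c\<theta>: "continuous_on UNIV \<theta>" "continuous_on UNIV \<theta>'"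
    using \<theta> \<theta>' by (meson continuous_at_imp_continuous_on has_vector_derivative_continuous)+
  have dF: "((\<lambda>t. ?F j t s) has_real_derivative ?F (Suc j) t s * (2 * c\<^sup>2 * t * (1 - s\<^sup>2))) (at t)" for j t s
    by (rule DERIV_chain2[OF bessel_kernel_deriv]) (auto intro!: derivative_eq_intros)
  have "((\<lambda>t. c\<^sup>2 * t\<^sup>2) has_real_derivative 2 * c\<^sup>2 * t) (at t)" for t
    by (auto intro!: derivative_eq_intros)
  then have "((\<lambda>t. c\<^sup>2 * t\<^sup>2 * ?F 1 t s) has_real_derivative ?H' t s) (at t)" for t s
    by (rule DERIV_cong[OF DERIV_mult[OF _ dF[of 1 s t]]]) (simp add: numeral_2_eq_2 mult_ac)
  then have "((\<lambda>t. ray_mean c (\<lambda>t s. c\<^sup>2 * t\<^sup>2 * ?F 1 t s) \<theta> t x) has_vector_derivative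
      integral {-1..1} (\<lambda>s. ?H' t s *\<^sub>R \<theta> (?y s) - (c * s * (c\<^sup>2 * t\<^sup>2 * ?F 1 t s)) *\<^sub>R \<theta>' (?y s))) (at t)"
    by (intro ray_mean_deriv_t \<theta> c\<theta>) (auto simp: case_prod_unfold intro!: continuous_intros)
  moreover have "((\<lambda>t. (1 / 2) *\<^sub>R (\<theta> (x - c * t) + \<theta> (x + c * t))) has_vector_derivative
      (1 / 2) *\<^sub>R ((- c) *\<^sub>R \<theta>' (x - c * t) + c *\<^sub>R \<theta>' (x + c * t))) (at t)"
    by (intro bounded_linear.has_vector_derivative[OF bounded_linear_scaleR_right]
        has_vector_derivative_add has_vector_derivative_ray \<theta>)
  ultimately have D: "((\<lambda>t. psi_t_conv \<alpha> c \<theta> t x) has_vector_derivative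
      (1 / 2) *\<^sub>R ((- c) *\<^sub>R \<theta>' (x - c * t) + c *\<^sub>R \<theta>' (x + c * t)) +
      integral {-1..1} (\<lambda>s. ?H' t s *\<^sub>R \<theta> (?y s) - (c * s * (c\<^sup>2 * t\<^sup>2 * ?F 1 t s)) *\<^sub>R \<theta>' (?y s))) (at t)"
    unfolding psi_t_conv_def by (intro has_vector_derivative_add)
  let ?G = "\<lambda>s. - (c ^ 3 * t\<^sup>2 * s * ?F 1 t s) *\<^sub>R \<theta>' (?y s) - (c\<^sup>2 * t / 2 * ?F 0 t s) *\<^sub>R \<theta>'' (?y s)"
  have "((\<lambda>s. (c / 2 * ?F 0 t s) *\<^sub>R \<theta>' (?y s)) has_vector_derivative ?G s) (at s within {-1..1})" for s
  proof -
    have "((\<lambda>s. ?F 0 t s) has_real_derivative ?F 1 t s * (- 2 * c\<^sup>2 * t\<^sup>2 * s)) (at s within {-1..1})"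
      using bessel_kernel_deriv[of \<alpha> 0 "?w t s"]
      by (intro DERIV_chain2[where f="bessel_kernel \<alpha> 0"]) (auto intro!: derivative_eq_intros)
    from DERIV_cmult[OF this, of "c / 2"]
    have "((\<lambda>s. c / 2 * ?F 0 t s) has_real_derivative - (c ^ 3 * t\<^sup>2 * s * ?F 1 t s)) (at s within {-1..1})"
      by (simp add: power2_eq_square power3_eq_cube mult_ac)
    from has_vector_derivative_scaleR[OF this has_vector_derivative_ray(1)[of \<theta>' \<theta>'' x "c * t", OF \<theta>']]
    show ?thesis by (rule has_vector_derivative_eq_rhs) (simp add: power2_eq_square mult_ac)
  qed
  then have "(?G has_integral (c / 2 * ?F 0 t 1) *\<^sub>R \<theta>' (x - c * t * 1) - (c / 2 * ?F 0 t (- 1)) *\<^sub>R \<theta>' (x - c * t * (- 1))) {-1..1}"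
    by (intro fundamental_theorem_of_calculus[where f="\<lambda>s. (c / 2 * ?F 0 t s) *\<^sub>R \<theta>' (?y s)"]) auto
  then have G: "(?G has_integral (c / 2) *\<^sub>R (\<theta>' (x - c * t) - \<theta>' (x + c * t))) {-1..1}"
    by (simp add: scaleR_diff_right)
  let ?L = "\<lambda>x. c\<^sup>2 *\<^sub>R \<theta>'' x + (k\<^sup>2 / 4) *\<^sub>R \<theta> x"
  have "((\<lambda>s. (t / 2 * ?F 0 t s) *\<^sub>R ?L (?y s)) has_integral psi_conv \<alpha> c ?L t x) {-1..1}"
    unfolding ray_mean_def psi_conv_def
    by (intro integrable_integral integrable_continuous_real
          ray_mean_integrand_continuous_s[of "\<lambda>t s. t / 2 * ?F 0 t s"] continuous_intros \<theta>'' c\<theta>)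
       (auto simp: case_prod_unfold intro!: continuous_intros)
  from has_integral_add[OF this G]
  have "((\<lambda>s. (t / 2 * ?F 0 t s) *\<^sub>R ?L (?y s) + ?G s) has_integral
      psi_conv \<alpha> c ?L t x + (c / 2) *\<^sub>R (\<theta>' (x - c * t) - \<theta>' (x + c * t))) {-1..1}" .
  moreover have "(t / 2 * ?F 0 t s) *\<^sub>R ?L (?y s) + ?G s
      = ?H' t s *\<^sub>R \<theta> (?y s) - (c * s * (c\<^sup>2 * t\<^sup>2 * ?F 1 t s)) *\<^sub>R \<theta>' (?y s)" for s
  proof -
    \<comment> \<open>With w = c^2 t^2 (1 - s^2), the coefficient of \<theta> is 2 c^2 t (F' + w
      F''), which Bessel's equation turns into 2 c^2 t \<alpha>^2 F = (t / 2) (k^2 / 4) F.\<close>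
    have "k\<^sup>2 / 4 * ?F 0 t s = 4 * c\<^sup>2 * (?F 1 t s + ?w t s * ?F 2 t s)"
      unfolding \<alpha>[symmetric] bessel_kernel_ode by simp
    then have "t / 2 * (k\<^sup>2 / 4 * ?F 0 t s) = t / 2 * (4 * c\<^sup>2 * (?F 1 t s + ?w t s * ?F 2 t s))" by simp
    also have "\<dots> = ?H' t s" by (simp add: power2_eq_square algebra_simps)
    finally have e1: "t / 2 * ?F 0 t s * (k\<^sup>2 / 4) = ?H' t s" by (simp add: mult_ac)
    have "(t / 2 * ?F 0 t s) *\<^sub>R ?L (?y s) + ?G s = (t / 2 * ?F 0 t s * (k\<^sup>2 / 4)) *\<^sub>R \<theta> (?y s)
        - (c ^ 3 * t\<^sup>2 * s * ?F 1 t s) *\<^sub>R \<theta>' (?y s)"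
      by (simp add: scaleR_add_right mult_ac)
    then show ?thesis unfolding e1 by (simp add: power2_eq_square power3_eq_cube mult_ac)
  qed
  ultimately have I: "integral {-1..1} (\<lambda>s. ?H' t s *\<^sub>R \<theta> (?y s) - (c * s * (c\<^sup>2 * t\<^sup>2 * ?F 1 t s)) *\<^sub>R \<theta>' (?y s))
      = psi_conv \<alpha> c ?L t x + (c / 2) *\<^sub>R (\<theta>' (x - c * t) - \<theta>' (x + c * t))"
    by (simp add: integral_unique)
  show ?thesis
    using D unfolding I by (simp add: scaleR_diff_right scaleR_add_right)
qed

text \<open>A propagator is linear and commutes with derivatives in x; real scalars are read as
  field elements because linearity is stated over the field. The uniqueness argument moves the
  operator past \<open>psi_conv\<close> in this way.\<close>

lemma wave_operator_propagator:
  assumes P: "finite_speed_propagator c' P" and \<theta>: "\<theta> \<in> test_functions"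
  shows "wave_operator k c (P \<theta> t) = P (wave_operator k c \<theta>) t"
proof -
  have "P (\<lambda>x. of_real (c\<^sup>2) * (vderiv ^^ 2) \<theta> x + of_real (k\<^sup>2 / 4) * \<theta> x) t
      = (\<lambda>x. of_real (c\<^sup>2) * P ((vderiv ^^ 2) \<theta>) t x + of_real (k\<^sup>2 / 4) * P \<theta> t x)"
    by (rule propagator_linear[OF P test_functions_vderiv[OF \<theta>] \<theta>])
  then show ?thesis
    by (simp only: wave_operator_def propagator_vderiv[OF P \<theta>] scaleR_conv_of_real)
qed

lemma psi_conv_curve:
  fixes \<theta> :: "real \<Rightarrow> 'a::{real_normed_field,euclidean_space}"
  assumes "\<theta> \<in> test_functions"
  shows "test_curve_deriv (psi_conv \<alpha> c \<theta>) (psi_t_conv \<alpha> c \<theta>)"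
  unfolding test_curve_deriv_def
  using derivative_towerD[OF test_functions_derivative_tower[OF assms], of 0]
    test_functions_continuous[OF assms, of UNIV 1]
  by (auto intro!: propagator_test_curve[OF psi_conv_propagator] propagator_test_curve[OF psi_t_conv_propagator]
      assms psi_conv_deriv)

lemma psi_t_conv_curve:
  fixes \<theta> :: "real \<Rightarrow> 'a::{real_normed_field,euclidean_space}"
  assumes "4 * c\<^sup>2 * \<alpha>\<^sup>2 = k\<^sup>2 / 4" "\<theta> \<in> test_functions"
  shows "test_curve_deriv (psi_t_conv \<alpha> c \<theta>) (psi_conv \<alpha> c (wave_operator k c \<theta>))"
  unfolding test_curve_deriv_def
proof (intro conjI allI)
  fix t x
  show "((\<lambda>t. psi_t_conv \<alpha> c \<theta> t x) has_vector_derivative psi_conv \<alpha> c (wave_operator k c \<theta>) t x) (at t)"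
    unfolding wave_operator_def
    using derivative_towerD[OF test_functions_derivative_tower[OF assms(2)], of 0]
      derivative_towerD[OF test_functions_derivative_tower[OF assms(2)], of 1]
      test_functions_continuous[OF assms(2), of UNIV 2]
    by (intro psi_t_conv_deriv[OF assms(1), of \<theta> "(vderiv ^^ 1) \<theta>" "(vderiv ^^ 2) \<theta>"])
       (auto simp: numeral_2_eq_2)
qed (intro propagator_test_curve[OF psi_conv_propagator] propagator_test_curve[OF psi_t_conv_propagator]
      wave_operator_test_function(1) assms)+

lemma psi_conv_0 [simp]: "psi_conv \<alpha> c \<theta> 0 = (\<lambda>x. 0)"
  by (simp add: psi_conv_def ray_mean_def fun_eq_iff)

lemma psi_t_conv_0 [simp]: "psi_t_conv \<alpha> c \<theta> 0 = \<theta>"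
  by (simp add: psi_t_conv_def ray_mean_def fun_eq_iff scaleR_2[symmetric])

section \<open>Identification with the convolutions against the kernels\<close>

lemma lborel_integral_ray:
  fixes G :: "real \<Rightarrow> 'a::euclidean_space"
  assumes G: "continuous_on UNIV G" and "a \<noteq> 0"
  shows "(LINT y|lborel. indicator {-\<bar>a\<bar>..\<bar>a\<bar>} y *\<^sub>R G y) = \<bar>a\<bar> *\<^sub>R integral {-1..1} (\<lambda>s. G (a * s))"
proof -
  \<comment> \<open>The absolute value in the Jacobian and the symmetry of the interval treat both
    signs of \<open>a\<close> at once.\<close>
  have "(LINT y|lborel. indicator {-\<bar>a\<bar>..\<bar>a\<bar>} y *\<^sub>R G y)
      = \<bar>a\<bar> *\<^sub>R (LINT s|lborel. indicator {-\<bar>a\<bar>..\<bar>a\<bar>} (0 + a * s) *\<^sub>R G (0 + a * s))"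
    by (rule lborel_integral_real_affine[OF \<open>a \<noteq> 0\<close>])
  also have "(\<lambda>s. indicator {-\<bar>a\<bar>..\<bar>a\<bar>} (0 + a * s) *\<^sub>R G (0 + a * s)) = (\<lambda>s. indicator {-1..1} s *\<^sub>R G (a * s))"
  proof
    fix s
    have "\<bar>a * s\<bar> \<le> \<bar>a\<bar> \<longleftrightarrow> \<bar>s\<bar> \<le> 1"
      using \<open>a \<noteq> 0\<close> by (simp add: abs_mult)
    then have "a * s \<in> {-\<bar>a\<bar>..\<bar>a\<bar>} \<longleftrightarrow> s \<in> {-1..1}"
      by (auto simp: abs_le_iff)
    then show "indicator {-\<bar>a\<bar>..\<bar>a\<bar>} (0 + a * s) *\<^sub>R G (0 + a * s) = indicator {-1..1} s *\<^sub>R G (a * s)"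
      by (simp add: indicator_def)
  qed
  also have "(LINT s|lborel. indicator {-1..1} s *\<^sub>R G (a * s)) = integral {-1..1} (\<lambda>s. G (a * s))"
  proof -
    have "continuous_on {-1..1} (\<lambda>s. G (a * s))"
      by (rule continuous_on_compose2[OF G]) (auto intro!: continuous_intros)
    then show ?thesis
      using set_borel_integral_eq_integral(2)[OF borel_integrable_atLeastAtMost']
      by (simp add: set_lebesgue_integral_def)
  qed
  finally show ?thesis .
qed

lemma ray_region:
  assumes "c > 0" "x \<in> {-\<bar>c * t\<bar>..\<bar>c * t\<bar>}"
  shows "(sqrt (c\<^sup>2 * t\<^sup>2 - x\<^sup>2))\<^sup>2 = c\<^sup>2 * t\<^sup>2 - x\<^sup>2"
proof -
  have "x\<^sup>2 \<le> (c * t)\<^sup>2" using assms(2) by (intro abs_le_square_iff[THEN iffD1]) auto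
  then show ?thesis by (simp add: power_mult_distrib)
qed

lemma psi_fun_kernel:
  assumes "c > 0"
  shows "psi_fun k c t x = indicator {-\<bar>c * t\<bar>..\<bar>c * t\<bar>} x *
    (sgn t / (2 * c) * bessel_kernel (k / (4 * c)) 0 (c\<^sup>2 * t\<^sup>2 - x\<^sup>2))"
proof (cases "x \<in> {-\<bar>c * t\<bar>..\<bar>c * t\<bar>}")
  case True
  then show ?thesis
    unfolding psi_fun_def Let_def bessel_I0_kernel ray_region[OF assms True]
    using assms by (simp add: abs_mult)
next
  case False
  then show ?thesis using assms by (auto simp: psi_fun_def Let_def abs_mult indicator_def)
qed

text \<open>On the whole cone, including its edge, the quotient is given by F' at z^2: the value
  prescribed at \<open>z = 0\<close> is the one that continues it, so the case distinction
  disappears.\<close>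

lemma psi_t_fun_kernel:
  assumes "c > 0" "k > 0"
  shows "psi_t_fun k c t x = indicator {-\<bar>c * t\<bar>..\<bar>c * t\<bar>} x *
    (c * \<bar>t\<bar> * bessel_kernel (k / (4 * c)) 1 (c\<^sup>2 * t\<^sup>2 - x\<^sup>2))"
proof (cases "x \<in> {-\<bar>c * t\<bar>..\<bar>c * t\<bar>}")
  case True
  define \<alpha> where "\<alpha> = k / (4 * c)"
  have "\<alpha> \<noteq> 0" using assms by (simp add: \<alpha>_def)
  define z where "z = sqrt (c\<^sup>2 * t\<^sup>2 - x\<^sup>2)"
  have z2: "z\<^sup>2 = c\<^sup>2 * t\<^sup>2 - x\<^sup>2"
    unfolding z_def by (rule ray_region[OF assms(1) True])
  have "\<alpha> * (if z = 0 then \<alpha> else deriv bessel_I0 (2 * \<alpha> * z) / z) = bessel_kernel \<alpha> 1 (z\<^sup>2)"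
    using \<open>\<alpha> \<noteq> 0\<close> by (simp add: deriv_bessel_I0 power2_eq_square)
  then have "\<alpha> * c * \<bar>t\<bar> * (if z = 0 then \<alpha> else deriv bessel_I0 (2 * \<alpha> * z) / z) = c * \<bar>t\<bar> * bessel_kernel \<alpha> 1 (c\<^sup>2 * t\<^sup>2 - x\<^sup>2)"
    unfolding z2[symmetric] by (metis mult.assoc mult.commute)
  then show ?thesis
    using True assms(1) unfolding psi_t_fun_def Let_def \<alpha>_def[symmetric] z_def[symmetric]
    by (simp add: abs_mult)
next
  case False
  then show ?thesis using assms by (auto simp: psi_t_fun_def Let_def abs_mult indicator_def)
qed

lemma continuous_on_kernel_reflect:
  fixes \<theta> :: "real \<Rightarrow> 'a::real_normed_vector"
  assumes "continuous_on UNIV \<theta>"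
  shows "continuous_on UNIV (\<lambda>y. (r * bessel_kernel \<alpha> j (b - y\<^sup>2)) *\<^sub>R \<theta> (x - y))"
  by (intro continuous_on_scaleR continuous_on_compose2[OF assms] continuous_intros) auto

lemma psi_convolution:
  fixes \<theta> :: "real \<Rightarrow> 'a::{real_normed_field,euclidean_space}"
  assumes c: "c > 0" and \<theta>: "\<theta> \<in> test_functions"
  shows "psi k c t \<star> \<theta> = psi_conv (k / (4 * c)) c \<theta> t"
proof
  fix x
  let ?F = "bessel_kernel (k / (4 * c)) 0"
  have "(psi k c t \<star> \<theta>) x = (LINT y|lborel. psi_fun k c t y *\<^sub>R \<theta> (x - y))"
    by (simp add: dist_convolution_def psi_def dist_of_fun_def on_test_functions_def test_functions_reflect[OF \<theta>])
  also have "\<dots> = psi_conv (k / (4 * c)) c \<theta> t x"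
  proof (cases "t = 0")
    \<comment> \<open>The substitution degenerates at \<open>t = 0\<close>; there the factor
      \<open>sgn t\<close> makes the kernel vanish.\<close>
    case True
    then show ?thesis by (simp add: psi_fun_kernel[OF c])
  next
    case False
    let ?G = "\<lambda>y. (sgn t / (2 * c) * ?F (c\<^sup>2 * t\<^sup>2 - y\<^sup>2)) *\<^sub>R \<theta> (x - y)"
    have cont: "continuous_on UNIV ?G"
      using test_functions_continuous[OF \<theta>, of UNIV 0] by (intro continuous_on_kernel_reflect) simp
    have "(LINT y|lborel. psi_fun k c t y *\<^sub>R \<theta> (x - y)) = (LINT y|lborel. indicator {-\<bar>c * t\<bar>..\<bar>c * t\<bar>} y *\<^sub>R ?G y)"
      by (simp add: psi_fun_kernel[OF c])
    also have "\<dots> = \<bar>c * t\<bar> *\<^sub>R integral {-1..1} (\<lambda>s. ?G (c * t * s))"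
      using c False by (intro lborel_integral_ray cont) auto
    also have "\<dots> = integral {-1..1} (\<lambda>s. \<bar>c * t\<bar> *\<^sub>R ?G (c * t * s))"
      by (rule integral_cmul[symmetric])
    also have "(\<lambda>s. \<bar>c * t\<bar> *\<^sub>R ?G (c * t * s))
        = (\<lambda>s. (t / 2 * ?F (c\<^sup>2 * t\<^sup>2 * (1 - s\<^sup>2))) *\<^sub>R \<theta> (x - c * t * s))"
    proof
      fix s
      have "c\<^sup>2 * t\<^sup>2 - (c * t * s)\<^sup>2 = c\<^sup>2 * t\<^sup>2 * (1 - s\<^sup>2)"
        by (simp add: power_mult_distrib right_diff_distrib)
      \<comment> \<open>The Jacobian absorbs the sign of \<open>t\<close>.\<close>
      moreover have "\<bar>c * t\<bar> * (sgn t / (2 * c)) = t / 2"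
        using c by (simp add: abs_mult sgn_if)
      ultimately show "\<bar>c * t\<bar> *\<^sub>R ?G (c * t * s) = (t / 2 * ?F (c\<^sup>2 * t\<^sup>2 * (1 - s\<^sup>2))) *\<^sub>R \<theta> (x - c * t * s)"
        by (simp only: scaleR_scaleR mult.assoc[symmetric])
    qed
    finally show ?thesis by (simp add: psi_conv_def ray_mean_def)
  qed
  finally show "(psi k c t \<star> \<theta>) x = psi_conv (k / (4 * c)) c \<theta> t x" .
qed

lemma psi_t_convolution:
  fixes \<theta> :: "real \<Rightarrow> 'a::{real_normed_field,euclidean_space}"
  assumes c: "c > 0" and k: "k > 0" and \<theta>: "\<theta> \<in> test_functions"
  shows "psi_t k c t \<star> \<theta> = psi_t_conv (k / (4 * c)) c \<theta> t"
proof
  fix x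
  let ?F = "bessel_kernel (k / (4 * c)) 1"
  have "(psi_t k c t \<star> \<theta>) x = (1 / 2) *\<^sub>R (\<theta> (x - c * t) + \<theta> (x + c * t))
      + (LINT y|lborel. psi_t_fun k c t y *\<^sub>R \<theta> (x - y))"
    by (simp add: dist_convolution_def psi_t_def dist_of_fun_def dirac_delta_def on_test_functions_def
        test_functions_reflect[OF \<theta>])
  also have "(LINT y|lborel. psi_t_fun k c t y *\<^sub>R \<theta> (x - y))
      = ray_mean c (\<lambda>t s. c\<^sup>2 * t\<^sup>2 * ?F (c\<^sup>2 * t\<^sup>2 * (1 - s\<^sup>2))) \<theta> t x"
  proof (cases "t = 0")
    case True
    then show ?thesis by (simp add: psi_t_fun_kernel[OF c k] ray_mean_def)
  next
    case False
    let ?G = "\<lambda>y. (c * \<bar>t\<bar> * ?F (c\<^sup>2 * t\<^sup>2 - y\<^sup>2)) *\<^sub>R \<theta> (x - y)"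
    have cont: "continuous_on UNIV ?G"
      using test_functions_continuous[OF \<theta>, of UNIV 0] by (intro continuous_on_kernel_reflect) simp
    have "(LINT y|lborel. psi_t_fun k c t y *\<^sub>R \<theta> (x - y)) = (LINT y|lborel. indicator {-\<bar>c * t\<bar>..\<bar>c * t\<bar>} y *\<^sub>R ?G y)"
      by (simp add: psi_t_fun_kernel[OF c k])
    also have "\<dots> = \<bar>c * t\<bar> *\<^sub>R integral {-1..1} (\<lambda>s. ?G (c * t * s))"
      using c False by (intro lborel_integral_ray cont) auto
    also have "\<dots> = integral {-1..1} (\<lambda>s. \<bar>c * t\<bar> *\<^sub>R ?G (c * t * s))"
      by (rule integral_cmul[symmetric])
    also have "(\<lambda>s. \<bar>c * t\<bar> *\<^sub>R ?G (c * t * s))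
        = (\<lambda>s. (c\<^sup>2 * t\<^sup>2 * ?F (c\<^sup>2 * t\<^sup>2 * (1 - s\<^sup>2))) *\<^sub>R \<theta> (x - c * t * s))"
    proof
      fix s
      have "c\<^sup>2 * t\<^sup>2 - (c * t * s)\<^sup>2 = c\<^sup>2 * t\<^sup>2 * (1 - s\<^sup>2)"
        by (simp add: power_mult_distrib right_diff_distrib)
      moreover have "\<bar>c * t\<bar> * (c * \<bar>t\<bar>) = c\<^sup>2 * t\<^sup>2"
        using c by (simp add: abs_mult power2_eq_square)
      ultimately show "\<bar>c * t\<bar> *\<^sub>R ?G (c * t * s) = (c\<^sup>2 * t\<^sup>2 * ?F (c\<^sup>2 * t\<^sup>2 * (1 - s\<^sup>2))) *\<^sub>R \<theta> (x - c * t * s)"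
        by (simp only: scaleR_scaleR mult.assoc[symmetric])
    qed
    finally show ?thesis by (simp add: ray_mean_def)
  qed
  finally show "(psi_t k c t \<star> \<theta>) x = psi_t_conv (k / (4 * c)) c \<theta> t x"
    by (simp add: psi_t_conv_def)
qed

section \<open>Evolution of the Cauchy data by transposition\<close>

lemma dist_C1_derivI:
  fixes u :: "real \<Rightarrow> (real \<Rightarrow> 'a::{real_normed_field,euclidean_space}) \<Rightarrow> 'a"
  assumes "\<And>t. u t \<in> distributions" "\<And>t. u' t \<in> distributions"
    and "\<And>\<phi> t. \<phi> \<in> test_functions \<Longrightarrow> ((\<lambda>s. u s \<phi>) has_vector_derivative u' t \<phi>) (at t)"
    and "\<And>\<phi>. \<phi> \<in> test_functions \<Longrightarrow> continuous_on UNIV (\<lambda>t. u' t \<phi>)"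
  shows "dist_C1_deriv u u'"
  unfolding dist_C1_deriv_def
proof (intro conjI allI ballI)
  fix \<phi> :: "real \<Rightarrow> 'a" and t assume \<phi>: "\<phi> \<in> test_functions"
  show "((\<lambda>h. (u (t + h) \<phi> - u t \<phi>) /\<^sub>R h) \<longlongrightarrow> u' t \<phi>) (at 0)"
    using assms(3)[OF \<phi>] by (simp add: has_vector_derivative_iff_difference_quotient)
  show "((\<lambda>h. u' (t + h) \<phi>) \<longlongrightarrow> u' t \<phi>) (at 0)"
    using assms(4)[OF \<phi>] by (simp add: continuous_on_eq_continuous_at isCont_iff)
qed (use assms in auto)

text \<open>The product rule for the constant curve \<open>u\<close>, whose derivative is the zero
  distribution.\<close>

lemma dist_test_curve_deriv:
  assumes u: "u \<in> distributions" and E: "test_curve_deriv E E'"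
  shows "((\<lambda>t. u (E t)) has_vector_derivative u (E' t)) (at t)"
proof -
  have "(\<lambda>_. 0) \<in> distributions"
    unfolding distributions_iff seminorm_bound_def by (auto intro: exI[of _ 0])
  then have "dist_C1_deriv (\<lambda>_. u) (\<lambda>_ _. 0)"
    using u by (intro dist_C1_derivI) auto
  from dist_curve_product_rule[OF this E] show ?thesis by simp
qed

lemma dist_test_curve_continuous:
  assumes "u \<in> distributions" "test_curve E"
  shows "continuous_on UNIV (\<lambda>t. u (E t))"
  using dist_curve_continuous[of "\<lambda>_. u" E] assms by simp

definition wave_evolution where
  "wave_evolution \<alpha> c f g t = on_test_functions (\<lambda>\<phi>. f (psi_t_conv \<alpha> c \<phi> t) + g (psi_conv \<alpha> c \<phi> t))"

definition wave_evolution_t where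
  "wave_evolution_t \<alpha> k c f g t =
     on_test_functions (\<lambda>\<phi>. f (psi_conv \<alpha> c (wave_operator k c \<phi>) t) + g (psi_t_conv \<alpha> c \<phi> t))"

lemma on_test_functions_add:
  "on_test_functions (\<lambda>\<phi>. u \<phi> + w \<phi>) = (\<lambda>\<phi>. on_test_functions u \<phi> + on_test_functions w \<phi>)"
  by (simp add: on_test_functions_def fun_eq_iff)

context
  fixes \<alpha> k c :: real and f g :: "(real \<Rightarrow> 'a::{real_normed_field,euclidean_space}) \<Rightarrow> 'a"
  assumes \<alpha>: "4 * c\<^sup>2 * \<alpha>\<^sup>2 = k\<^sup>2 / 4" and f: "f \<in> distributions" and g: "g \<in> distributions"
begin

lemma wave_evolution_distribution: "wave_evolution \<alpha> c f g t \<in> distributions"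
  unfolding wave_evolution_def on_test_functions_add
  by (intro distributions_add distributions_propagate[OF psi_conv_propagator g]
      distributions_propagate[OF psi_t_conv_propagator f])

lemma wave_evolution_t_distribution: "wave_evolution_t \<alpha> k c f g t \<in> distributions"
proof -
  \<comment> \<open>The wave operator acts before the propagator, so the functional is the transpose
    of the wave operator applied to the transpose of the propagator, and each of the two steps stays
    within distributions.\<close>
  have "on_test_functions (\<lambda>\<phi>. on_test_functions (\<lambda>\<phi>. f (psi_conv \<alpha> c \<phi> t)) (wave_operator k c \<phi>)) \<in> distributions"
    by (intro distributions_wave_operator distributions_propagate[OF psi_conv_propagator f])
  also have "on_test_functions (\<lambda>\<phi>. on_test_functions (\<lambda>\<phi>. f (psi_conv \<alpha> c \<phi> t)) (wave_operator k c \<phi>))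
      = on_test_functions (\<lambda>\<phi>. f (psi_conv \<alpha> c (wave_operator k c \<phi>) t))"
    by (auto simp: on_test_functions_def wave_operator_test_function(1))
  finally show ?thesis
    unfolding wave_evolution_t_def on_test_functions_add
    by (intro distributions_add distributions_propagate[OF psi_t_conv_propagator g])
qed

lemma wave_evolution_C1: "dist_C1_deriv (wave_evolution \<alpha> c f g) (wave_evolution_t \<alpha> k c f g)"
proof (rule dist_C1_derivI[OF wave_evolution_distribution wave_evolution_t_distribution])
  fix \<phi> :: "real \<Rightarrow> 'a" and t assume \<phi>: "\<phi> \<in> test_functions"
  note L\<phi> = wave_operator_test_function(1)[OF \<phi>, of k c]
  show "((\<lambda>s. wave_evolution \<alpha> c f g s \<phi>) has_vector_derivative wave_evolution_t \<alpha> k c f g t \<phi>) (at t)"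
    unfolding wave_evolution_def wave_evolution_t_def on_test_functions_def if_P[OF \<phi>]
    by (intro has_vector_derivative_add dist_test_curve_deriv f g psi_t_conv_curve[OF \<alpha> \<phi>] psi_conv_curve[OF \<phi>])
  show "continuous_on UNIV (\<lambda>t. wave_evolution_t \<alpha> k c f g t \<phi>)"
    unfolding wave_evolution_t_def on_test_functions_def if_P[OF \<phi>]
    by (intro continuous_on_add dist_test_curve_continuous f g
        propagator_test_curve[OF psi_conv_propagator L\<phi>] propagator_test_curve[OF psi_t_conv_propagator \<phi>])
qed

text \<open>Differentiating once more turns \<open>psi_conv\<close> of
  \<open>wave_operator k c \<phi>\<close> into \<open>psi_t_conv\<close> of it, and
  \<open>psi_t_conv\<close> of \<open>\<phi>\<close> into \<open>psi_conv\<close> of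
  \<open>wave_operator k c \<phi>\<close>. Together this is the evolution tested on
  \<open>wave_operator k c \<phi>\<close>.\<close>

lemma wave_evolution_C2:
  "dist_C1_deriv (wave_evolution_t \<alpha> k c f g)
    (\<lambda>t. on_test_functions (\<lambda>\<phi>. wave_evolution \<alpha> c f g t (wave_operator k c \<phi>)))"
proof (rule dist_C1_derivI[OF wave_evolution_t_distribution
      distributions_wave_operator[OF wave_evolution_distribution]])
  fix \<phi> :: "real \<Rightarrow> 'a" and t assume \<phi>: "\<phi> \<in> test_functions"
  note L\<phi> = wave_operator_test_function(1)[OF \<phi>, of k c]
  show "((\<lambda>s. wave_evolution_t \<alpha> k c f g s \<phi>) has_vector_derivative
      on_test_functions (\<lambda>\<phi>. wave_evolution \<alpha> c f g t (wave_operator k c \<phi>)) \<phi>) (at t)"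
    unfolding wave_evolution_def wave_evolution_t_def on_test_functions_def if_P[OF \<phi>] if_P[OF L\<phi>]
    by (intro has_vector_derivative_add dist_test_curve_deriv f g psi_t_conv_curve[OF \<alpha> \<phi>] psi_conv_curve[OF L\<phi>])
  show "continuous_on UNIV (\<lambda>t. on_test_functions (\<lambda>\<phi>. wave_evolution \<alpha> c f g t (wave_operator k c \<phi>)) \<phi>)"
    using dist_C1_derivD(4)[OF wave_evolution_C1 L\<phi>] \<phi> by (simp add: on_test_functions_def)
qed

end

lemma wave_evolution_0:
  assumes "f \<in> distributions" "g \<in> distributions"
  shows "wave_evolution \<alpha> c f g 0 = f" "wave_evolution_t \<alpha> k c f g 0 = g"
  using assms by (auto simp: wave_evolution_def wave_evolution_t_def on_test_functions_def fun_eq_iff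
      dist_zero dist_outside)

section \<open>Smooth functions of several variables\<close>

lemma k_times_differentiable_add:
  fixes f g :: "'b::real_normed_vector \<Rightarrow> 'a::real_normed_vector"
  assumes "k_times_differentiable n f" "k_times_differentiable n g"
  shows "k_times_differentiable n (\<lambda>x. f x + g x)"
  using assms
proof (induction n arbitrary: f g)
  case 0
  then show ?case by (simp add: continuous_on_add)
next
  case (Suc n)
  have "frechet_derivative (\<lambda>x. f x + g x) (at x) e = frechet_derivative f (at x) e + frechet_derivative g (at x) e" for x e
    using Suc.prems by (subst frechet_derivative_at[OF has_derivative_add, symmetric]) (auto simp: frechet_derivative_works)
  then show ?case using Suc by simp
qed

lemma k_times_differentiable_scaleR:
  fixes f :: "'b::real_normed_vector \<Rightarrow> 'a::real_normed_vector"
  assumes "k_times_differentiable n f"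
  shows "k_times_differentiable n (\<lambda>x. r *\<^sub>R f x)"
  using assms
proof (induction n arbitrary: f)
  case 0
  then show ?case by (simp add: continuous_on_scaleR)
next
  case (Suc n)
  have "frechet_derivative (\<lambda>x. r *\<^sub>R f x) (at x) e = r *\<^sub>R frechet_derivative f (at x) e" for x e
    using Suc.prems by (subst frechet_derivative_at[OF has_derivative_scaleR_right, symmetric]) (auto simp: frechet_derivative_works)
  then show ?case using Suc by simp
qed

lemma k_times_differentiable_affine:
  fixes f :: "'b::real_normed_vector \<Rightarrow> 'a::real_normed_vector"
  assumes "k_times_differentiable n f" "bounded_linear L"
  shows "k_times_differentiable n (\<lambda>x. f (L x + b))"
  using assms(1)
proof (induction n arbitrary: f)
  case 0
  then show ?case
    using bounded_linear.continuous_on[OF assms(2) continuous_on_id]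
    by (auto intro!: continuous_on_compose2[of UNIV f] continuous_intros)
next
  case (Suc n)
  have D: "((\<lambda>x. f (L x + b)) has_derivative (\<lambda>e. frechet_derivative f (at (L x + b)) (L e))) (at x)" for x
  proof -
    have "((\<lambda>x. L x + b) has_derivative L) (at x)"
      using bounded_linear.has_derivative[OF assms(2) has_derivative_ident] by (auto intro: has_derivative_add_const)
    moreover have "(f has_derivative frechet_derivative f (at (L x + b))) (at (L x + b))"
      using Suc.prems by (simp add: frechet_derivative_works)
    ultimately show ?thesis using diff_chain_at by (fastforce simp: o_def)
  qed
  have "frechet_derivative (\<lambda>x. f (L x + b)) (at x) e = frechet_derivative f (at (L x + b)) (L e)" for x e
    using frechet_derivative_at[OF D] by metis
  moreover have "(\<lambda>x. f (L x + b)) differentiable (at x)" for x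
    using D unfolding differentiable_def by blast
  moreover have "k_times_differentiable n (\<lambda>x. frechet_derivative f (at (L x + b)) (L e))" for e
    using Suc.prems by (intro Suc.IH) simp
  ultimately show ?case by simp
qed

lemma smooth_affine: "smooth f \<Longrightarrow> bounded_linear L \<Longrightarrow> smooth (\<lambda>x. f (L x + b))"
  by (simp add: smooth_def k_times_differentiable_affine)

lemma smooth_add: "smooth f \<Longrightarrow> smooth g \<Longrightarrow> smooth (\<lambda>x. f x + g x)"
  by (simp add: smooth_def k_times_differentiable_add)

lemma smooth_scaleR_const: "smooth f \<Longrightarrow> smooth (\<lambda>x. r *\<^sub>R f x)"
  by (simp add: smooth_def k_times_differentiable_scaleR)

lemma smooth_frechet_derivative:
  assumes "smooth f"
  shows "(f has_derivative frechet_derivative f (at x)) (at x)"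
    and "smooth (\<lambda>x. frechet_derivative f (at x) e)"
proof -
  have "k_times_differentiable (Suc n) f" for n using assms by (simp only: smooth_def)
  then show "(f has_derivative frechet_derivative f (at x)) (at x)"
    and "smooth (\<lambda>x. frechet_derivative f (at x) e)"
    by (simp_all add: smooth_def frechet_derivative_works)
qed

lemma smooth_continuous:
  assumes "smooth f"
  shows "continuous_on S f"
proof -
  have "k_times_differentiable 0 f" using assms by (simp only: smooth_def)
  then show ?thesis by (auto intro: continuous_on_subset)
qed

text \<open>Both factors are assumed smooth and not merely differentiable to order \<open>n\<close>,
  so the induction hypothesis applies to both terms of the product rule, where one factor is
  differentiated and the other keeps its order.\<close>

lemma smooth_scaleR:
  fixes f :: "'b::real_normed_vector \<Rightarrow> real" and g :: "'b \<Rightarrow> 'a::real_normed_vector"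
  assumes "smooth f" "smooth g"
  shows "smooth (\<lambda>x. f x *\<^sub>R g x)"
proof -
  have "k_times_differentiable n (\<lambda>x. f x *\<^sub>R g x)" for n
    using assms
  proof (induction n arbitrary: f g)
    case 0
    then show ?case by (auto intro: continuous_on_scaleR smooth_continuous)
  next
    case (Suc n)
    note f = smooth_frechet_derivative[OF Suc.prems(1)] and g = smooth_frechet_derivative[OF Suc.prems(2)]
    note D = has_derivative_scaleR[OF f(1) g(1)]
    have "frechet_derivative (\<lambda>x. f x *\<^sub>R g x) (at x) e
        = f x *\<^sub>R frechet_derivative g (at x) e + frechet_derivative f (at x) e *\<^sub>R g x" for x e
      using frechet_derivative_at[OF D] by metis
    moreover have "k_times_differentiable n (\<lambda>x. f x *\<^sub>R frechet_derivative g (at x) e + frechet_derivative f (at x) e *\<^sub>R g x)" for e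
      by (intro k_times_differentiable_add Suc.IH f g Suc.prems)
    moreover have "(\<lambda>x. f x *\<^sub>R g x) differentiable (at x)" for x
      using D unfolding differentiable_def by blast
    ultimately show ?case by simp
  qed
  then show ?thesis by (simp add: smooth_def)
qed

section \<open>Test functions on the plane\<close>

text \<open>Used in place of the support: the same box serves both partial derivatives and confines
  every slice to one compact interval.\<close>

definition zero_outside_box :: "real \<Rightarrow> (real \<times> real \<Rightarrow> 'a::zero) \<Rightarrow> bool" where
  "zero_outside_box R \<phi> \<longleftrightarrow> (\<forall>x t. R < \<bar>x\<bar> \<or> R < \<bar>t\<bar> \<longrightarrow> \<phi> (x, t) = 0)"

lemma test_function_zero_outside_box:
  assumes "\<phi> \<in> test_functions"
  obtains R where "R > 0" "zero_outside_box R \<phi>"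
proof -
  have "compact (supp \<phi>)" using assms by (simp add: test_functions_def)
  from compact_imp_bounded[OF this] obtain R where R: "R > 0" "\<And>p. p \<in> supp \<phi> \<Longrightarrow> norm p \<le> R"
    unfolding bounded_pos by blast
  have "\<phi> (x, t) = 0" if "R < \<bar>x\<bar> \<or> R < \<bar>t\<bar>" for x t
  proof (rule not_in_supp[of "(x, t)" \<phi>])
    show "(x, t) \<notin> supp \<phi>"
      using R(2)[of "(x, t)"] that norm_fst_le[of x t] norm_snd_le[of t x] by auto
  qed
  then have "zero_outside_box R \<phi>" by (simp add: zero_outside_box_def)
  with R(1) show ?thesis by (rule that)
qed

text \<open>The partial derivative is the Frechet derivative in the direction (1, 0), whose
  smoothness is built into the recursive definition.\<close>

lemma smooth_partial_x:
  assumes "smooth \<phi>"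
  shows "((\<lambda>s. \<phi> (s, t)) has_vector_derivative partial_x \<phi> (x, t)) (at x)" "smooth (partial_x \<phi>)"
proof -
  have D: "((\<lambda>s. \<phi> (s, t)) has_vector_derivative frechet_derivative \<phi> (at (x, t)) (1, 0)) (at x)" for x t
  proof -
    have "((\<lambda>s. (s, t)) has_derivative (\<lambda>h. (h, 0))) (at x)" by (auto intro!: derivative_eq_intros)
    from diff_chain_at[OF this smooth_frechet_derivative(1)[OF assms]]
    have "((\<lambda>s. \<phi> (s, t)) has_derivative (\<lambda>h. frechet_derivative \<phi> (at (x, t)) (h, 0))) (at x)"
      by (simp add: o_def)
    then show ?thesis
      unfolding has_vector_derivative_def
    proof (rule has_derivative_eq_rhs, intro ext)
      fix h show "frechet_derivative \<phi> (at (x, t)) (h, 0) = h *\<^sub>R frechet_derivative \<phi> (at (x, t)) (1, 0)"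
        using linear_scale[OF has_derivative_linear[OF smooth_frechet_derivative(1)[OF assms]], of "(x, t)" h "(1, 0)"] by simp
    qed
  qed
  have eq: "partial_x \<phi> = (\<lambda>p. frechet_derivative \<phi> (at p) (1, 0))"
    using vector_derivative_at[OF D] by (auto simp: partial_x_def fun_eq_iff)
  show "((\<lambda>s. \<phi> (s, t)) has_vector_derivative partial_x \<phi> (x, t)) (at x)" using D by (simp add: eq)
  show "smooth (partial_x \<phi>)" unfolding eq by (rule smooth_frechet_derivative(2)[OF assms])
qed

lemma smooth_partial_t:
  assumes "smooth \<phi>"
  shows "((\<lambda>s. \<phi> (x, s)) has_vector_derivative partial_t \<phi> (x, t)) (at t)" "smooth (partial_t \<phi>)"
proof -
  have D: "((\<lambda>s. \<phi> (x, s)) has_vector_derivative frechet_derivative \<phi> (at (x, t)) (0, 1)) (at t)" for x t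
  proof -
    have "((\<lambda>s. (x, s)) has_derivative (\<lambda>h. (0, h))) (at t)" by (auto intro!: derivative_eq_intros)
    from diff_chain_at[OF this smooth_frechet_derivative(1)[OF assms]]
    have "((\<lambda>s. \<phi> (x, s)) has_derivative (\<lambda>h. frechet_derivative \<phi> (at (x, t)) (0, h))) (at t)"
      by (simp add: o_def)
    then show ?thesis
      unfolding has_vector_derivative_def
    proof (rule has_derivative_eq_rhs, intro ext)
      fix h show "frechet_derivative \<phi> (at (x, t)) (0, h) = h *\<^sub>R frechet_derivative \<phi> (at (x, t)) (0, 1)"
        using linear_scale[OF has_derivative_linear[OF smooth_frechet_derivative(1)[OF assms]], of "(x, t)" h "(0, 1)"] by simp
    qed
  qed
  have eq: "partial_t \<phi> = (\<lambda>p. frechet_derivative \<phi> (at p) (0, 1))"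
    using vector_derivative_at[OF D] by (auto simp: partial_t_def fun_eq_iff)
  show "((\<lambda>s. \<phi> (x, s)) has_vector_derivative partial_t \<phi> (x, t)) (at t)" using D by (simp add: eq)
  show "smooth (partial_t \<phi>)" unfolding eq by (rule smooth_frechet_derivative(2)[OF assms])
qed

lemma has_vector_derivative_zero_outside:
  fixes f :: "real \<Rightarrow> 'a::real_normed_vector"
  assumes "(f has_vector_derivative D) (at x)" "\<And>y. R < \<bar>y\<bar> \<Longrightarrow> f y = 0" "R < \<bar>x\<bar>"
  shows "D = 0"
proof -
  have "open {y::real. R < \<bar>y\<bar>}" by (intro open_Collect_less continuous_intros)
  from has_vector_derivative_transform_within_open[OF assms(1) this, of "\<lambda>_. 0"]
  have "((\<lambda>_. 0) has_vector_derivative D) (at x)" using assms by auto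
  then show ?thesis by (metis has_vector_derivative_const vector_derivative_at)
qed

text \<open>If the variable of differentiation leaves the interval, the function vanishes near the
  point; if the other variable does, the whole slice is zero.\<close>

lemma zero_outside_box_partial:
  assumes "smooth \<phi>" "zero_outside_box R \<phi>"
  shows "zero_outside_box R (partial_x \<phi>)" "zero_outside_box R (partial_t \<phi>)"
proof -
  have z: "\<phi> (x, t) = 0" if "R < \<bar>x\<bar> \<or> R < \<bar>t\<bar>" for x t
    using assms(2) that unfolding zero_outside_box_def by blast
  have "partial_x \<phi> (x, t) = 0" if "R < \<bar>x\<bar> \<or> R < \<bar>t\<bar>" for x t
  proof (cases "R < \<bar>x\<bar>")
    case True
    then show ?thesis
      by (intro has_vector_derivative_zero_outside[OF smooth_partial_x(1)[OF assms(1)]]) (auto intro: z)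
  next
    case False
    then have "(\<lambda>s. \<phi> (s, t)) = (\<lambda>s. 0)" using that z by auto
    then show ?thesis by (simp add: partial_x_def)
  qed
  then show "zero_outside_box R (partial_x \<phi>)" by (simp add: zero_outside_box_def)
  have "partial_t \<phi> (x, t) = 0" if "R < \<bar>x\<bar> \<or> R < \<bar>t\<bar>" for x t
  proof (cases "R < \<bar>t\<bar>")
    case True
    then show ?thesis
      by (intro has_vector_derivative_zero_outside[OF smooth_partial_t(1)[OF assms(1)]]) (auto intro: z)
  next
    case False
    then have "(\<lambda>s. \<phi> (x, s)) = (\<lambda>s. 0)" using that z by auto
    then show ?thesis by (simp add: partial_t_def)
  qed
  then show "zero_outside_box R (partial_t \<phi>)" by (simp add: zero_outside_box_def)
qed

text \<open>Slices of the iterates of \<open>partial_x\<close> form a tower, which identifies the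
  spatial derivatives of a slice.\<close>

lemma smooth_slice:
  assumes "smooth \<phi>" "zero_outside_box R \<phi>"
  shows "(\<lambda>x. \<phi> (x, t)) \<in> test_functions"
    and "(vderiv ^^ j) (\<lambda>x. \<phi> (x, t)) = (\<lambda>x. (partial_x ^^ j) \<phi> (x, t))"
    and "test_curve (\<lambda>t x. \<phi> (x, t))"
proof -
  have sm: "smooth ((partial_x ^^ j) \<phi>)" for j
    by (induction j) (auto simp: assms smooth_partial_x(2))
  have T: "derivative_tower (\<lambda>j x. (partial_x ^^ j) \<phi> (x, t))" for t
    using smooth_partial_x(1)[OF sm] by (simp add: derivative_tower_def)
  have z: "\<phi> (x, t) = 0" if "x \<notin> cball 0 R" for x t
    using assms(2) that by (simp add: zero_outside_box_def)
  show test: "(\<lambda>x. \<phi> (x, t)) \<in> test_functions" for t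
  proof -
    have "(\<lambda>x. (partial_x ^^ 0) \<phi> (x, t)) \<in> test_functions"
      by (rule test_functions_tower[OF T compact_cball[of 0 R]]) (use z in simp)
    then show ?thesis by simp
  qed
  show vd: "(vderiv ^^ j) (\<lambda>x. \<phi> (x, t)) = (\<lambda>x. (partial_x ^^ j) \<phi> (x, t))" for t j
    using vderiv_funpow_tower[OF T, of j 0] by simp
  have "continuous_on UNIV (\<lambda>p. (partial_x ^^ j) \<phi> (snd p, fst p))" for j
    by (rule continuous_on_compose2[OF smooth_continuous[OF sm]]) (auto intro!: continuous_intros)
  moreover have "supp (\<lambda>x. \<phi> (x, t)) \<subseteq> cball 0 R" for t
    using z by (simp add: supp_subset_iff)
  ultimately show "test_curve (\<lambda>t x. \<phi> (x, t))"
    unfolding test_curve_def vd using test by (auto simp: case_prod_unfold intro!: exI[of _ "cball 0 R"])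
qed

lemma smooth_slice_deriv:
  fixes \<phi> :: "real \<times> real \<Rightarrow> 'a::real_normed_vector"
  assumes "smooth \<phi>" "zero_outside_box R \<phi>"
  shows "test_curve_deriv (\<lambda>t x. \<phi> (x, t)) (\<lambda>t x. partial_t \<phi> (x, t))"
  unfolding test_curve_deriv_def
  using smooth_slice(3)[OF assms] smooth_partial_t[OF assms(1)]
    smooth_slice(3)[OF smooth_partial_t(2)[OF assms(1)] zero_outside_box_partial(2)[OF assms]] by blast

lemma wave_operator_slice:
  assumes "smooth \<phi>" "zero_outside_box R \<phi>"
  shows "wave_operator k c (\<lambda>x. \<phi> (x, t)) = (\<lambda>x. c\<^sup>2 *\<^sub>R partial_x (partial_x \<phi>) (x, t) + (k\<^sup>2 / 4) *\<^sub>R \<phi> (x, t))"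
  unfolding wave_operator_def smooth_slice(2)[OF assms] by (simp add: numeral_2_eq_2)

lemma weak_solutionI:
  fixes v :: "real \<Rightarrow> (real \<Rightarrow> 'a::{real_normed_field,euclidean_space}) \<Rightarrow> 'a"
  assumes v: "dist_C1_deriv v v'"
    and v': "dist_C1_deriv v' (\<lambda>t. on_test_functions (\<lambda>\<phi>. v t (wave_operator k c \<phi>)))"
  shows "weak_solution k c v"
  unfolding weak_solution_def
proof
  fix \<phi> :: "real \<times> real \<Rightarrow> 'a" assume \<phi>: "\<phi> \<in> test_functions"
  then have s: "smooth \<phi>" by (simp add: test_functions_def)
  obtain R where R: "R > 0" "zero_outside_box R \<phi>" using test_function_zero_outside_box[OF \<phi>] .
  note s1 = smooth_partial_t(2)[OF s] and z1 = zero_outside_box_partial(2)[OF s R(2)]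
  note s2 = smooth_partial_t(2)[OF s1] and z2 = zero_outside_box_partial(2)[OF s1 z1]
  let ?E = "\<lambda>t x. \<phi> (x, t)" and ?E1 = "\<lambda>t x. partial_t \<phi> (x, t)" and ?E2 = "\<lambda>t x. partial_t (partial_t \<phi>) (x, t)"
  note E = smooth_slice(1)[OF s R(2)] and E2 = smooth_slice(1)[OF s2 z2]
  let ?g = "\<lambda>t. v t (?E2 t) - v t (wave_operator k c (?E t))"
  let ?G = "\<lambda>t. v t (?E1 t) - v' t (?E t)"
  have eq: "v t (\<lambda>x. partial_t (partial_t \<phi>) (x, t) - c\<^sup>2 *\<^sub>R partial_x (partial_x \<phi>) (x, t) - (k\<^sup>2 / 4) *\<^sub>R \<phi> (x, t)) = ?g t" for t
    using dist_diff[OF dist_C1_derivD(1)[OF v] E2 wave_operator_test_function(1)[OF E, of k c], of t]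
    by (simp add: wave_operator_slice[OF s R(2)] diff_diff_eq)
  have "(?G has_vector_derivative (v' t (?E1 t) + v t (?E2 t)) - (v t (wave_operator k c (?E t)) + v' t (?E1 t))) (at t)" for t
    using dist_curve_product_rule[OF v smooth_slice_deriv[OF s1 z1], of t]
      dist_curve_product_rule[OF v' smooth_slice_deriv[OF s R(2)], of t] E
    by (intro has_vector_derivative_diff) (simp_all add: on_test_functions_def)
  then have G: "(?G has_vector_derivative ?g t) (at t)" for t by simp
  have "continuous_on UNIV (\<lambda>t. v t (?E2 t))"
    by (rule dist_curve_continuous[OF dist_C1_derivD(1,4)[OF v] smooth_slice(3)[OF s2 z2]])
  moreover have "continuous_on UNIV (\<lambda>t. v t (wave_operator k c (?E t)))"
    using dist_curve_continuous[OF dist_C1_derivD(2,5)[OF v'] smooth_slice(3)[OF s R(2)]] E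
    by (simp add: on_test_functions_def)
  ultimately have g: "continuous_on UNIV ?g" by (rule continuous_on_diff)
  have out: "?E t = (\<lambda>x. 0)" "?E1 t = (\<lambda>x. 0)" "?E2 t = (\<lambda>x. 0)" if "R < \<bar>t\<bar>" for t
    using R(2) z1 z2 that by (auto simp: zero_outside_box_def)
  have L0: "wave_operator k c (\<lambda>x. 0 :: 'a) = (\<lambda>x. 0)"
  proof -
    have "(vderiv ^^ 2) (\<lambda>x. 0 :: 'a) = (\<lambda>x. 0)"
      using test_functions_combine(2)[OF zero_test_function zero_test_function, of 2 "0 :: 'a" 0] by simp
    then show ?thesis by (simp add: wave_operator_def)
  qed
  have G0: "?G t = 0" and g0: "?g t = 0" if "R < \<bar>t\<bar>" for t
    by (simp_all only: out[OF that] L0 dist_zero[OF dist_C1_derivD(1)[OF v]] dist_zero[OF dist_C1_derivD(1)[OF v']] diff_self)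
  \<comment> \<open>One unit beyond \<open>R\<close>, since vanishing is known only where
    \<open>R < \<bar>t\<bar>\<close> holds strictly; both end values of the primitive are then
    0.\<close>
  have "has_bochner_integral lborel (\<lambda>t. indicator {- (R + 1)..R + 1} t *\<^sub>R ?g t) (?G (R + 1) - ?G (- (R + 1)))"
    using R(1) g by (intro has_bochner_integral_FTC_Icc has_vector_derivative_at_within[OF G])
      (auto intro: continuous_on_subset)
  also have "?G (R + 1) - ?G (- (R + 1)) = 0"
    using G0[of "R + 1"] G0[of "- (R + 1)"] R(1) by simp
  also have "(\<lambda>t. indicator {- (R + 1)..R + 1} t *\<^sub>R ?g t) = ?g"
  proof
    fix t show "indicator {- (R + 1)..R + 1} t *\<^sub>R ?g t = ?g t"
      using g0[of t] by (cases "t \<in> {- (R + 1)..R + 1}") (auto simp: abs_if)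
  qed
  finally show "has_bochner_integral lborel
      (\<lambda>t. v t (\<lambda>x. partial_t (partial_t \<phi>) (x, t) - c\<^sup>2 *\<^sub>R partial_x (partial_x \<phi>) (x, t) - (k\<^sup>2 / 4) *\<^sub>R \<phi> (x, t))) 0"
    unfolding eq .
qed

section \<open>Weak solutions are twice differentiable in time\<close>

definition flat_exp :: "nat \<Rightarrow> real \<Rightarrow> real" where
  "flat_exp k x = (if x \<le> 0 then 0 else inverse x ^ k * exp (- inverse x))"

lemma flat_exp_tendsto_0: "(flat_exp k \<longlongrightarrow> 0) (at 0)"
proof (rule filterlim_split_at)
  show "(flat_exp k \<longlongrightarrow> 0) (at_left 0)"
    by (rule tendsto_eventually) (auto simp: flat_exp_def eventually_at_left_field intro: exI[of _ "-1"])
  have "((\<lambda>x. inverse x ^ k / exp (inverse x)) \<longlongrightarrow> (0::real)) (at_right 0)"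
    by (rule filterlim_compose[OF tendsto_power_div_exp_0 filterlim_inverse_at_top_right])
  moreover have "\<forall>\<^sub>F x in at_right 0. inverse x ^ k / exp (inverse x) = flat_exp k x"
    by (auto simp: flat_exp_def eventually_at_right_field exp_minus divide_inverse intro: exI[of _ 1])
  ultimately show "(flat_exp k \<longlongrightarrow> 0) (at_right 0)" by (rule Lim_transform_eventually)
qed

text \<open>The powers of 1/x make the family closed under differentiation up to linear
  combinations. At 0 the difference quotient of \<open>flat_exp k\<close> is
  \<open>flat_exp (Suc k)\<close>, which tends to 0.\<close>

lemma flat_exp_deriv:
  "(flat_exp k has_real_derivative - real k * flat_exp (Suc k) x + flat_exp (Suc (Suc k)) x) (at x)"
proof (cases x "0 :: real" rule: linorder_cases)
  case less
  have "((\<lambda>_. 0) has_real_derivative 0) (at x)" by simp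
  then have "(flat_exp k has_real_derivative 0) (at x)"
    by (rule has_field_derivative_transform_within_open[of _ _ _ "{..<0}"]) (use less in \<open>auto simp: flat_exp_def\<close>)
  then show ?thesis using less by (simp add: flat_exp_def)
next
  case equal
  have "((\<lambda>h. (flat_exp k (0 + h) - flat_exp k 0) / h) \<longlongrightarrow> 0) (at 0)"
  proof (rule Lim_transform_eventually[OF flat_exp_tendsto_0[of "Suc k"]])
    show "\<forall>\<^sub>F h in at 0. flat_exp (Suc k) h = (flat_exp k (0 + h) - flat_exp k 0) / h"
      by (auto simp: eventually_at_filter flat_exp_def divide_inverse)
  qed
  then have "(flat_exp k has_real_derivative 0) (at 0)" by (simp add: DERIV_def)
  then show ?thesis using equal by (simp add: flat_exp_def)
next
  case greater
  have I: "(inverse has_real_derivative - (inverse x ^ 2)) (at x)"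
    using DERIV_inverse[of x UNIV] greater by (simp add: numeral_2_eq_2)
  have "((\<lambda>x. exp (- inverse x)) has_real_derivative exp (- inverse x) * inverse x ^ 2) (at x)"
    using DERIV_chain2[OF DERIV_exp DERIV_minus[OF I]] by simp
  from DERIV_mult[OF DERIV_power[OF I, of k] this]
  have "((\<lambda>x. inverse x ^ k * exp (- inverse x)) has_real_derivative
      - real k * (inverse x ^ Suc k * exp (- inverse x)) + inverse x ^ Suc (Suc k) * exp (- inverse x)) (at x)"
    by (rule DERIV_cong) (cases k; simp add: power2_eq_square algebra_simps)
  then have "(flat_exp k has_real_derivative
      - real k * (inverse x ^ Suc k * exp (- inverse x)) + inverse x ^ Suc (Suc k) * exp (- inverse x)) (at x)"
    by (rule has_field_derivative_transform_within_open[of _ _ _ "{0<..}"]) (use greater in \<open>auto simp: flat_exp_def\<close>)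
  then show ?thesis using greater by (simp add: flat_exp_def)
qed

lemma smooth_flat_exp: "smooth (flat_exp k)"
proof -
  have vd: "(flat_exp k has_vector_derivative - real k * flat_exp (Suc k) x + flat_exp (Suc (Suc k)) x) (at x)" for k x
    using flat_exp_deriv by (simp add: has_real_derivative_iff_has_vector_derivative)
  have "k_times_differentiable n (flat_exp k)" for n
  proof (induction n arbitrary: k)
    case 0
    then show ?case
      using vd by (auto intro: continuous_at_imp_continuous_on has_vector_derivative_continuous)
  next
    case (Suc n)
    have "k_times_differentiable n (\<lambda>x. e *\<^sub>R ((- real k) *\<^sub>R flat_exp (Suc k) x + flat_exp (Suc (Suc k)) x))" for e
      by (intro k_times_differentiable_scaleR k_times_differentiable_add Suc.IH)
    moreover have "flat_exp k differentiable (at x)" for x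
      using vd by (rule differentiableI_vector)
    ultimately show ?case by (simp add: frechet_derivative_vector[OF vd])
  qed
  then show ?thesis by (simp add: smooth_def)
qed

lemma antiderivative_exists:
  fixes f :: "real \<Rightarrow> 'a::euclidean_space"
  assumes "continuous_on UNIV f"
  obtains F where "\<And>x. (F has_vector_derivative f x) (at x)"
  using einterval_antiderivative[of "-\<infinity>" \<infinity> f] assms
  by (auto simp: continuous_on_eq_continuous_at)

text \<open>The step \<open>N\<close> is a primitive of a bump. Its height is only required to be
  positive: it is carried along as the mass of a mollifier and cancelled at the end of the lemma of
  du Bois-Reymond.\<close>

lemma smooth_step_exists:
  obtains N \<eta> :: "real \<Rightarrow> real" where "smooth N" "\<And>x. (N has_vector_derivative \<eta> x) (at x)"
    "\<And>x. \<eta> x \<ge> 0" "\<And>x. 1 < \<bar>x\<bar> \<Longrightarrow> \<eta> x = 0" "N (- 1) < N 1"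
    "\<And>x. x \<le> - 1 \<Longrightarrow> N x = N (- 1)" "\<And>x. x \<ge> 1 \<Longrightarrow> N x = N 1" "continuous_on UNIV \<eta>"
proof -
  \<comment> \<open>This is exp(-1/(1+x)) exp(-1/(1-x)) between -1 and 1, and 0 elsewhere.\<close>
  define \<eta> where "\<eta> x = flat_exp 0 (x + 1) *\<^sub>R flat_exp 0 (- x + 1)" for x
  have s\<eta>: "smooth \<eta>"
    unfolding \<eta>_def
    by (intro smooth_scaleR smooth_affine[OF smooth_flat_exp, where L="\<lambda>x. x"]
        smooth_affine[OF smooth_flat_exp, where L="\<lambda>x. - x"] bounded_linear_ident bounded_linear_minus)
  then have c\<eta>: "continuous_on UNIV \<eta>" by (rule smooth_continuous)
  obtain N where N: "\<And>x. (N has_vector_derivative \<eta> x) (at x)"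
    using antiderivative_exists[OF c\<eta>] by metis
  have pos: "\<eta> x \<ge> 0" for x by (simp add: \<eta>_def flat_exp_def)
  have out: "\<eta> x = 0" if "1 \<le> \<bar>x\<bar>" for x
    using that by (auto simp: \<eta>_def flat_exp_def abs_if split: if_splits)
  \<comment> \<open>Putting \<open>N\<close> in front of the derivatives of \<open>\<eta>\<close>
    gives a tower, hence smoothness of \<open>N\<close>.\<close>
  have "derivative_tower (\<lambda>n. case n of 0 \<Rightarrow> N | Suc m \<Rightarrow> (vderiv ^^ m) \<eta>)"
    unfolding derivative_tower_def
    using N derivative_towerD[OF derivative_tower_vderiv[OF s\<eta>]] by (auto split: nat.split)
  from smooth_derivative_tower[OF this, of 0] have sN: "smooth N" by simp
  have lt: "N (- 1) < N 1"
  proof (rule DERIV_pos_imp_increasing_open[where f=N and a="- 1" and b=1])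
    show "\<exists>y. DERIV N x :> y \<and> y > 0" if "- 1 < x" "x < 1" for x
      using N[of x] that by (intro exI[of _ "\<eta> x"])
        (auto simp: has_real_derivative_iff_has_vector_derivative \<eta>_def flat_exp_def)
    show "continuous_on {- 1..1} N" by (rule smooth_continuous[OF sN])
  qed simp
  have const: "N x = N y" if "\<And>z. z \<in> closed_segment x y \<Longrightarrow> \<eta> z = 0" for x y
  proof -
    have "\<exists>c. \<forall>z\<in>closed_segment x y. N z = c"
    proof (rule has_derivative_zero_constant)
      show "(N has_derivative (\<lambda>h. 0)) (at z within closed_segment x y)" if "z \<in> closed_segment x y" for z
        using has_vector_derivative_at_within[OF N[of z], of "closed_segment x y"] \<open>\<And>z. z \<in> closed_segment x y \<Longrightarrow> \<eta> z = 0\<close>[OF that]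
        by (simp add: has_vector_derivative_def)
    qed simp
    then show ?thesis by auto
  qed
  have left: "N x = N (- 1)" if "x \<le> - 1" for x
    using that by (intro const out) (auto simp: closed_segment_eq_real_ivl split: if_splits)
  have right: "N x = N 1" if "x \<ge> 1" for x
    using that by (intro const out) (auto simp: closed_segment_eq_real_ivl split: if_splits)
  have "\<eta> x = 0" if "1 < \<bar>x\<bar>" for x using out[of x] that by simp
  from that[OF sN N pos this lt left right c\<eta>] show ?thesis .
qed

lemma has_integral_zero_compact_support:
  fixes f :: "real \<Rightarrow> 'a::banach"
  assumes f: "\<And>x. (f has_vector_derivative f' x) (at x)" and z: "\<And>x. R < \<bar>x\<bar> \<Longrightarrow> f x = 0" and "R > 0"
  shows "(f' has_integral 0) UNIV"
proof -
  have "(f' has_integral f (R + 1) - f (- (R + 1))) {- (R + 1)..R + 1}"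
    using \<open>R > 0\<close> by (intro fundamental_theorem_of_calculus[where f=f] has_vector_derivative_at_within[OF f]) auto
  moreover have "f (R + 1) = 0" "f (- (R + 1)) = 0" using \<open>R > 0\<close> by (simp_all add: z)
  ultimately have I: "(f' has_integral 0) {- (R + 1)..R + 1}" by simp
  have "f' x = 0" if "x \<notin> {- (R + 1)..R + 1}" for x
  proof (rule has_vector_derivative_zero_outside[OF f z])
    show "R < \<bar>x\<bar>" using that by auto
  qed
  then show ?thesis by (rule has_integral_on_superset[OF I]) auto
qed

text \<open>The difference of two steps, centred at \<open>p\<close> and \<open>q\<close> and scaled
  by e, is a test function whose derivative is the difference of two mollifiers of equal mass.
  Testing with it and letting e tend to 0 compares \<open>m p\<close> with \<open>m q\<close>
  directly.\<close>

lemma du_Bois_Reymond: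
  fixes m :: "real \<Rightarrow> 'a::euclidean_space"
  assumes m: "continuous_on UNIV m"
    and ortho: "\<And>(\<rho> :: real \<Rightarrow> real). \<rho> \<in> test_functions \<Longrightarrow> ((\<lambda>t. vderiv \<rho> t *\<^sub>R m t) has_integral 0) UNIV"
  shows "m p = m q"
proof -
  obtain N \<eta> :: "real \<Rightarrow> real" where N: "smooth N" "\<And>x. (N has_vector_derivative \<eta> x) (at x)"
    and \<eta>: "\<And>x. \<eta> x \<ge> 0" "\<And>x. 1 < \<bar>x\<bar> \<Longrightarrow> \<eta> x = 0" and I: "N (- 1) < N 1"
    and out: "\<And>x. x \<le> - 1 \<Longrightarrow> N x = N (- 1)" "\<And>x. x \<ge> 1 \<Longrightarrow> N x = N 1" and c\<eta>: "continuous_on UNIV \<eta>"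
    using smooth_step_exists by metis
  let ?I = "N 1 - N (- 1)"
  \<comment> \<open>A mollifier of mass \<open>?I\<close> concentrated on [p - e, p + e]; its
    primitive is the scaled step.\<close>
  let ?K = "\<lambda>e p t. \<eta> ((t - p) / e) / e"
  have dN: "((\<lambda>t. N ((t - p) / e)) has_vector_derivative ?K e p t) (at t)" if "e > 0" for e p t
  proof -
    have "(N \<circ> (\<lambda>t. (t - p) / e) has_vector_derivative (1 / e) *\<^sub>R \<eta> ((t - p) / e)) (at t)"
      using that by (intro vector_diff_chain_at N(2)) (auto intro!: derivative_eq_intros)
    then show ?thesis by (simp add: o_def)
  qed
  have near: "\<forall>\<^sub>F e in at_right 0. \<exists>J. ((\<lambda>t. ?K e p t *\<^sub>R m t) has_integral J) UNIV \<and> norm (J - ?I *\<^sub>R m p) \<le> d * ?I"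
    if "d > 0" for p d
  proof -
    have "isCont m p" using m by (simp add: continuous_on_eq_continuous_at)
    then obtain s where s: "s > 0" "\<And>t. dist t p < s \<Longrightarrow> dist (m t) (m p) < d"
      using \<open>d > 0\<close> unfolding continuous_at_eps_delta by metis
    have "\<exists>J. ((\<lambda>t. ?K e p t *\<^sub>R m t) has_integral J) UNIV \<and> norm (J - ?I *\<^sub>R m p) \<le> d * ?I"
      if e: "0 < e" "e < s" for e
    proof -
      let ?S = "{p - e..p + e}"
      have Kc: "continuous_on ?S (?K e p)"
        using e by (intro continuous_on_divide continuous_on_compose2[OF c\<eta>] continuous_intros) auto
      have "(?K e p has_integral N ((p + e - p) / e) - N ((p - e - p) / e)) ?S"
        using e by (intro fundamental_theorem_of_calculus[where f="\<lambda>t. N ((t - p) / e)"]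
            has_vector_derivative_at_within[OF dN]) auto
      then have K: "(?K e p has_integral ?I) ?S" using e by simp
      have "(\<lambda>t. ?K e p t *\<^sub>R m t) integrable_on ?S"
        by (intro integrable_continuous_real continuous_on_scaleR Kc continuous_on_subset[OF m]) auto
      then obtain J where J: "((\<lambda>t. ?K e p t *\<^sub>R m t) has_integral J) ?S" by blast
      have "?K e p t = 0" if "t \<notin> ?S" for t
      proof -
        have "1 < \<bar>(t - p) / e\<bar>" using that e by (auto simp: abs_if field_simps)
        then show ?thesis by (simp add: \<eta>(2))
      qed
      then have JU: "((\<lambda>t. ?K e p t *\<^sub>R m t) has_integral J) UNIV"
        using J by (intro has_integral_on_superset[OF J]) auto
      have "((\<lambda>t. ?K e p t *\<^sub>R m p) has_integral ?I *\<^sub>R m p) ?S"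
        using has_integral_scaleR_left[OF K] by blast
      from has_integral_diff[OF J this]
      have D: "((\<lambda>t. ?K e p t *\<^sub>R m t - ?K e p t *\<^sub>R m p) has_integral J - ?I *\<^sub>R m p) ?S" .
      have "norm (integral ?S (\<lambda>t. ?K e p t *\<^sub>R m t - ?K e p t *\<^sub>R m p)) \<le> integral ?S (\<lambda>t. d * ?K e p t)"
      proof (rule Henstock_Kurzweil_Integration.integral_norm_bound_integral)
        show "(\<lambda>t. ?K e p t *\<^sub>R m t - ?K e p t *\<^sub>R m p) integrable_on ?S" using D by blast
        show "(\<lambda>t. d * ?K e p t) integrable_on ?S" using has_integral_mult_right[OF K] by blast
        fix t assume "t \<in> ?S"
        then have "norm (m t - m p) \<le> d"
          using s(2)[of t] e by (auto simp: dist_norm abs_if less_imp_le)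
        then have "?K e p t * norm (m t - m p) \<le> ?K e p t * d"
          using \<eta>(1) e by (intro mult_left_mono) auto
        then show "norm (?K e p t *\<^sub>R m t - ?K e p t *\<^sub>R m p) \<le> d * ?K e p t"
          using \<eta>(1) e by (simp add: scaleR_diff_right[symmetric] mult.commute)
      qed
      also have "integral ?S (\<lambda>t. d * ?K e p t) = d * ?I"
        using has_integral_mult_right[OF K] by (rule integral_unique)
      finally have "norm (J - ?I *\<^sub>R m p) \<le> d * ?I" using D by (simp add: integral_unique)
      with JU show ?thesis by blast
    qed
    then show ?thesis
      using s(1) unfolding eventually_at_right_field by (intro exI[of _ s]) auto
  qed
  have "norm (m p - m q) \<le> 2 * d" if "d > 0" for d
  proof -
    have "\<forall>\<^sub>F e in at_right (0::real). e > 0" by (simp add: eventually_at_right_less)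
    with near[OF that, of p] near[OF that, of q]
    have "\<forall>\<^sub>F e in at_right (0::real). ?I * norm (m p - m q) \<le> ?I * (2 * d)"
    proof eventually_elim
      case (elim e)
      then obtain J J' where J: "((\<lambda>t. ?K e p t *\<^sub>R m t) has_integral J) UNIV" "norm (J - ?I *\<^sub>R m p) \<le> d * ?I"
        and J': "((\<lambda>t. ?K e q t *\<^sub>R m t) has_integral J') UNIV" "norm (J' - ?I *\<^sub>R m q) \<le> d * ?I" by blast
      have "e > 0" using elim by blast
      \<comment> \<open>To the right of both transitions the two steps equal the same constant, and
        likewise to the left, so the difference has compact support although neither step
        has.\<close>
      define \<rho> where "\<rho> t = N ((t - p) / e) - N ((t - q) / e)" for t
      have d\<rho>: "(\<rho> has_vector_derivative ?K e p t - ?K e q t) (at t)" for t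
        unfolding \<rho>_def by (intro has_vector_derivative_diff dN \<open>e > 0\<close>)
      have sm: "smooth (\<lambda>t. N ((t - r) / e))" for r
      proof -
        have "smooth (\<lambda>t. N (inverse e * t + (- r / e)))"
          by (rule smooth_affine[OF N(1) bounded_linear_mult_right])
        moreover have "(\<lambda>t. N (inverse e * t + (- r / e))) = (\<lambda>t. N ((t - r) / e))"
          by (simp add: divide_inverse algebra_simps)
        ultimately show ?thesis by simp
      qed
      have "smooth \<rho>"
        using smooth_add[OF sm smooth_scaleR_const[OF sm, of "-1"]] by (simp add: \<rho>_def[abs_def])
      moreover have "compact (supp \<rho>)"
      proof (rule compact_supp)
        show "compact {min p q - e..max p q + e}" by simp
        fix t assume t: "t \<notin> {min p q - e..max p q + e}"
        show "\<rho> t = 0"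
        proof (cases "t < min p q - e")
          case True
          then have le: "(t - p) / e \<le> - 1" "(t - q) / e \<le> - 1" using \<open>e > 0\<close> by (auto simp: field_simps)
          then show ?thesis by (simp only: \<rho>_def out(1)[OF le(1)] out(1)[OF le(2)] diff_self)
        next
          case False
          then have ge: "(t - p) / e \<ge> 1" "(t - q) / e \<ge> 1" using t \<open>e > 0\<close> by (auto simp: field_simps)
          then show ?thesis by (simp only: \<rho>_def out(2)[OF ge(1)] out(2)[OF ge(2)] diff_self)
        qed
      qed
      ultimately have "\<rho> \<in> test_functions" by (simp add: test_functions_def)
      from ortho[OF this] have "((\<lambda>t. ?K e p t *\<^sub>R m t - ?K e q t *\<^sub>R m t) has_integral 0) UNIV"
        using vector_derivative_at[OF d\<rho>] by (simp add: vderiv_def scaleR_diff_left)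
      then have "J - J' = 0"
        using has_integral_diff[OF J(1) J'(1)] has_integral_unique by blast
      then have "?I *\<^sub>R (m p - m q) = (J' - ?I *\<^sub>R m q) - (J - ?I *\<^sub>R m p)"
        by (simp add: scaleR_diff_right)
      then have "norm (?I *\<^sub>R (m p - m q)) \<le> d * ?I + d * ?I"
        using norm_triangle_ineq4[of "J' - ?I *\<^sub>R m q" "J - ?I *\<^sub>R m p"] J(2) J'(2) by simp
      then show "?I * norm (m p - m q) \<le> ?I * (2 * d)" using I by (simp add: mult.commute)
    qed
    \<comment> \<open>The inequality does not contain \<open>e\<close>, and
      \<open>at_right 0\<close> is a nontrivial filter.\<close>
    then have "?I * norm (m p - m q) \<le> ?I * (2 * d)" by simp
    then show ?thesis using I by simp
  qed
  \<comment> \<open>With \<open>d\<close> a quarter of the distance, the bound is half the distance;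
    so the distance is 0.\<close>
  from this[of "norm (m p - m q) / 4"] show ?thesis by fastforce
qed

section \<open>From the weak equation to an ordinary differential equation on each test
  function\<close>

lemma product_test_function:
  fixes \<rho> :: "real \<Rightarrow> real" and \<theta> :: "real \<Rightarrow> 'a::real_normed_vector"
  assumes "\<rho> \<in> test_functions" "\<theta> \<in> test_functions"
  shows "(\<lambda>p. \<rho> (snd p) *\<^sub>R \<theta> (fst p)) \<in> test_functions"
proof -
  have "smooth (\<lambda>p :: real \<times> real. \<rho> (snd p + 0))" "smooth (\<lambda>p :: real \<times> real. \<theta> (fst p + 0))"
    using assms by (intro smooth_affine bounded_linear_fst bounded_linear_snd; simp add: test_functionsD)+
  then have "smooth (\<lambda>p. \<rho> (snd p) *\<^sub>R \<theta> (fst p))" by (intro smooth_scaleR) simp_all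
  moreover have "compact (supp (\<lambda>p. \<rho> (snd p) *\<^sub>R \<theta> (fst p)))"
    using assms by (intro compact_supp[OF compact_Times[OF test_functionsD(2)[OF assms(2)] test_functionsD(2)[OF assms(1)]]])
      (auto simp: mem_Times_iff not_in_supp)
  ultimately show ?thesis by (simp add: test_functions_def)
qed

lemma test_function_has_vderiv:
  assumes "\<phi> \<in> test_functions"
  shows "((vderiv ^^ n) \<phi> has_vector_derivative (vderiv ^^ Suc n) \<phi> x) (at x)"
  by (rule derivative_towerD[OF test_functions_derivative_tower[OF assms]])

lemma weak_solution_time_integral:
  fixes w :: "real \<Rightarrow> (real \<Rightarrow> 'a::{real_normed_field,euclidean_space}) \<Rightarrow> 'a"
  assumes w: "\<And>t. w t \<in> distributions" and weak: "weak_solution k c w"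
    and \<rho>: "\<rho> \<in> test_functions" and \<theta>: "\<theta> \<in> test_functions"
  shows "((\<lambda>t. (vderiv ^^ 2) \<rho> t *\<^sub>R w t \<theta> - \<rho> t *\<^sub>R w t (wave_operator k c \<theta>)) has_integral 0) UNIV"
proof -
  let ?\<Phi> = "\<lambda>p. \<rho> (snd p) *\<^sub>R \<theta> (fst p)"
  have d\<rho>: "((\<lambda>t. (vderiv ^^ n) \<rho> t *\<^sub>R y) has_vector_derivative (vderiv ^^ Suc n) \<rho> t *\<^sub>R y) (at t)" for n t and y :: 'a
    by (rule bounded_linear.has_vector_derivative[OF bounded_linear_scaleR_left test_function_has_vderiv[OF \<rho>]])
  have d\<theta>: "((\<lambda>x. r *\<^sub>R (vderiv ^^ n) \<theta> x) has_vector_derivative r *\<^sub>R (vderiv ^^ Suc n) \<theta> x) (at x)" for n x r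
    by (rule bounded_linear.has_vector_derivative[OF bounded_linear_scaleR_right test_function_has_vderiv[OF \<theta>]])
  have t1: "partial_t ?\<Phi> = (\<lambda>p. vderiv \<rho> (snd p) *\<^sub>R \<theta> (fst p))"
    using vector_derivative_at[OF d\<rho>[of 0]] by (simp add: partial_t_def case_prod_unfold)
  have t2: "partial_t (partial_t ?\<Phi>) = (\<lambda>p. (vderiv ^^ 2) \<rho> (snd p) *\<^sub>R \<theta> (fst p))"
    unfolding t1 using vector_derivative_at[OF d\<rho>[of 1]]
    by (simp add: partial_t_def case_prod_unfold numeral_2_eq_2)
  have x1: "partial_x ?\<Phi> = (\<lambda>p. \<rho> (snd p) *\<^sub>R vderiv \<theta> (fst p))"
    using vector_derivative_at[OF d\<theta>[of _ 0]] by (simp add: partial_x_def case_prod_unfold)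
  have x2: "partial_x (partial_x ?\<Phi>) = (\<lambda>p. \<rho> (snd p) *\<^sub>R (vderiv ^^ 2) \<theta> (fst p))"
    unfolding x1 using vector_derivative_at[OF d\<theta>[of _ 1]]
    by (simp add: partial_x_def case_prod_unfold numeral_2_eq_2)
  have eq: "w t (\<lambda>x. partial_t (partial_t ?\<Phi>) (x, t) - c\<^sup>2 *\<^sub>R partial_x (partial_x ?\<Phi>) (x, t) - (k\<^sup>2 / 4) *\<^sub>R ?\<Phi> (x, t))
      = (vderiv ^^ 2) \<rho> t *\<^sub>R w t \<theta> - \<rho> t *\<^sub>R w t (wave_operator k c \<theta>)" for t
  proof -
    have comb: "(\<lambda>x. partial_t (partial_t ?\<Phi>) (x, t) - c\<^sup>2 *\<^sub>R partial_x (partial_x ?\<Phi>) (x, t) - (k\<^sup>2 / 4) *\<^sub>R ?\<Phi> (x, t))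
        = (\<lambda>x. (vderiv ^^ 2) \<rho> t *\<^sub>R \<theta> x + (- \<rho> t) *\<^sub>R wave_operator k c \<theta> x)"
      unfolding t2 x2 by (simp add: wave_operator_def fun_eq_iff algebra_simps)
    show ?thesis
      unfolding comb dist_linearR[OF w \<theta> wave_operator_test_function(1)[OF \<theta>]] by simp
  qed
  have "has_bochner_integral lborel (\<lambda>t. (vderiv ^^ 2) \<rho> t *\<^sub>R w t \<theta> - \<rho> t *\<^sub>R w t (wave_operator k c \<theta>)) 0"
    using weak[unfolded weak_solution_def, rule_format, OF product_test_function[OF \<rho> \<theta>]] unfolding eq .
  note I = this[unfolded has_bochner_integral_iff]
  show ?thesis
    using has_integral_integral_lborel[OF conjunct1[OF I]] unfolding conjunct2[OF I] .
qed

text \<open>With \<open>\<beta>\<close> a primitive of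
  \<open>w t (wave_operator k c \<theta>)\<close>, the point is that w'(\<theta>) - \<beta> is
  constant. The weak equation contains \<rho>'' and \<rho>; one integration by parts in each term
  leaves \<rho>' against this difference and uses only the first time derivative of
  \<open>w\<close>.\<close>

lemma weak_solution_C2:
  fixes w :: "real \<Rightarrow> (real \<Rightarrow> 'a::{real_normed_field,euclidean_space}) \<Rightarrow> 'a"
  assumes w: "dist_C1_deriv w w'" and weak: "weak_solution k c w"
  shows "dist_C1_deriv w' (\<lambda>t. on_test_functions (\<lambda>\<phi>. w t (wave_operator k c \<phi>)))"
proof (rule dist_C1_derivI[OF dist_C1_derivD(2)[OF w] distributions_wave_operator[OF dist_C1_derivD(1)[OF w]]])
  fix \<theta> :: "real \<Rightarrow> 'a" assume \<theta>: "\<theta> \<in> test_functions"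
  let ?b = "\<lambda>t. w t (wave_operator k c \<theta>)"
  note L\<theta> = wave_operator_test_function(1)[OF \<theta>, of k c]
  have b: "continuous_on UNIV ?b" by (rule dist_C1_derivD(4)[OF w L\<theta>])
  then show "continuous_on UNIV (\<lambda>t. on_test_functions (\<lambda>\<phi>. w t (wave_operator k c \<phi>)) \<theta>)"
    using \<theta> by (simp add: on_test_functions_def)
  obtain \<beta> where \<beta>: "\<And>t. (\<beta> has_vector_derivative ?b t) (at t)"
    using antiderivative_exists[OF b] by metis
  have c\<beta>: "continuous_on UNIV \<beta>"
    using \<beta> by (meson continuous_at_imp_continuous_on has_vector_derivative_continuous)
  have const: "w' p \<theta> - \<beta> p = w' q \<theta> - \<beta> q" for p q
  proof (rule du_Bois_Reymond)
    show "continuous_on UNIV (\<lambda>t. w' t \<theta> - \<beta> t)"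
      by (intro continuous_on_diff dist_C1_derivD(5)[OF w \<theta>] c\<beta>)
    fix \<rho> :: "real \<Rightarrow> real" assume \<rho>: "\<rho> \<in> test_functions"
    obtain R where R: "\<And>(\<theta> :: real \<Rightarrow> real) y. supp \<theta> \<subseteq> supp \<rho> \<Longrightarrow> R < \<bar>y\<bar> \<Longrightarrow> \<theta> y = 0"
      using test_function_radius[OF test_functionsD(2)[OF \<rho>]] by metis
    have supp': "supp (vderiv \<rho>) \<subseteq> supp \<rho>"
      using vderiv_zero_outside[OF \<rho>, of "supp \<rho>" _ 1] test_functionsD(2)[OF \<rho>]
      by (simp add: supp_subset_iff compact_imp_closed)
    \<comment> \<open>The derivative of this compactly supported function has integral 0;
      subtracting the weak equation cancels the terms with \<rho>'' and with \<rho>.\<close>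
    let ?h = "\<lambda>t. vderiv \<rho> t *\<^sub>R w t \<theta> - \<rho> t *\<^sub>R \<beta> t"
    have "(?h has_vector_derivative (vderiv \<rho> t *\<^sub>R w' t \<theta> + (vderiv ^^ 2) \<rho> t *\<^sub>R w t \<theta>)
        - (\<rho> t *\<^sub>R ?b t + vderiv \<rho> t *\<^sub>R \<beta> t)) (at t)" for t
      using test_function_has_vderiv[OF \<rho>, of 1 t] test_function_has_vderiv[OF \<rho>, of 0 t]
      by (intro has_vector_derivative_diff has_vector_derivative_scaleR dist_C1_derivD(3)[OF w \<theta>] \<beta>)
         (simp_all add: has_real_derivative_iff_has_vector_derivative numeral_2_eq_2)
    then have "((\<lambda>t. (vderiv \<rho> t *\<^sub>R w' t \<theta> + (vderiv ^^ 2) \<rho> t *\<^sub>R w t \<theta>)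
        - (\<rho> t *\<^sub>R ?b t + vderiv \<rho> t *\<^sub>R \<beta> t)) has_integral 0) UNIV"
      \<comment> \<open>The maximum with 1 makes the radius positive.\<close>
      by (rule has_integral_zero_compact_support[where R="max R 1"]) (use R[OF supp'] R[OF order_refl] in auto)
    from has_integral_diff[OF this weak_solution_time_integral[OF dist_C1_derivD(1)[OF w] weak \<rho> \<theta>]]
    show "((\<lambda>t. vderiv \<rho> t *\<^sub>R (w' t \<theta> - \<beta> t)) has_integral 0) UNIV"
      by (simp add: algebra_simps)
  qed
  show "((\<lambda>t. w' t \<theta>) has_vector_derivative on_test_functions (\<lambda>\<phi>. w t (wave_operator k c \<phi>)) \<theta>) (at t)" for t
  proof -
    have "(\<lambda>t. w' t \<theta>) = (\<lambda>t. \<beta> t + (w' 0 \<theta> - \<beta> 0))"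
      using const[of _ 0] by (auto simp: algebra_simps)
    then show ?thesis
      using \<beta>[of t] \<theta> by (auto simp: on_test_functions_def intro!: derivative_eq_intros)
  qed
qed

section \<open>The Cauchy problem\<close>

lemma test_curve_reverse:
  fixes E :: "real \<Rightarrow> real \<Rightarrow> 'a::real_normed_algebra_1"
  assumes E: "test_curve E"
  shows "test_curve (\<lambda>t. E (T - t))"
  unfolding test_curve_def
proof (intro conjI allI)
  show "E (T - t) \<in> test_functions" for t by (rule test_curve_test_functions[OF E])
  show "\<exists>K. compact K \<and> (\<forall>t. \<bar>t\<bar> \<le> S \<longrightarrow> supp (E (T - t)) \<subseteq> K)" for S
  proof -
    obtain K where K: "compact K" "\<And>t. \<bar>t\<bar> \<le> \<bar>T\<bar> + S \<Longrightarrow> supp (E t) \<subseteq> K"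
      using test_curve_support[OF E] by metis
    then have "supp (E (T - t)) \<subseteq> K" if "\<bar>t\<bar> \<le> S" for t
      using that by (intro K(2)) linarith
    then show ?thesis using K(1) by blast
  qed
  show "continuous_on UNIV (\<lambda>(t, x). (vderiv ^^ j) (E (T - t)) x)" for j
  proof -
    have "continuous_on UNIV (\<lambda>(t, x). (vderiv ^^ j) (E t) x)" using E by (simp add: test_curve_def)
    from continuous_on_compose2[OF this, of UNIV "\<lambda>p. (T - fst p, snd p)"]
    show ?thesis by (simp add: case_prod_unfold continuous_on_Pair continuous_on_diff continuous_on_fst continuous_on_snd)
  qed
qed

lemma test_curve_uminus:
  fixes E :: "real \<Rightarrow> real \<Rightarrow> 'a::real_normed_algebra_1"
  assumes E: "test_curve E"
  shows "test_curve (\<lambda>t x. - E t x)"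
proof -
  note test = test_curve_test_functions[OF E]
  \<comment> \<open>Negation is written as a linear combination in order to inherit membership and
    derivatives from \<open>test_functions_combineR\<close>.\<close>
  have m: "(\<lambda>x. - E t x) = (\<lambda>x. (- 1) *\<^sub>R E t x + 0 *\<^sub>R E t x)" for t by simp
  have vd: "(vderiv ^^ j) (\<lambda>x. - E t x) = (\<lambda>x. - (vderiv ^^ j) (E t) x)" for j t
    unfolding m test_functions_combineR(2)[OF test test] by simp
  have "continuous_on UNIV (\<lambda>p. - (vderiv ^^ j) (E (fst p)) (snd p))" for j
    using E unfolding test_curve_def case_prod_unfold by (intro continuous_on_minus) blast
  moreover have "supp (\<lambda>x. - E t x) = supp (E t)" for t by (simp add: supp_def)
  moreover have "(\<lambda>x. - E t x) \<in> test_functions" for t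
    unfolding m by (rule test_functions_combineR(1)[OF test test])
  ultimately show ?thesis using E unfolding test_curve_def vd by (simp add: case_prod_unfold)
qed

lemma test_curve_deriv_reverse:
  fixes E :: "real \<Rightarrow> real \<Rightarrow> 'a::real_normed_algebra_1"
  assumes "test_curve_deriv E E'"
  shows "test_curve_deriv (\<lambda>t. E (T - t)) (\<lambda>t x. - E' (T - t) x)"
proof -
  have "((\<lambda>s. E (T - s) x) has_vector_derivative - E' (T - t) x) (at t)" for t x
  proof -
    have "((\<lambda>s. E s x) \<circ> (\<lambda>s. T - s) has_vector_derivative (- 1) *\<^sub>R E' (T - t) x) (at t)"
      using assms by (intro vector_diff_chain_at) (auto simp: test_curve_deriv_def intro!: derivative_eq_intros)
    then show ?thesis by (simp add: o_def)
  qed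
  then show ?thesis
    using assms unfolding test_curve_deriv_def
    by (auto intro: test_curve_reverse test_curve_uminus[OF test_curve_reverse])
qed

text \<open>A duality argument: the curves \<open>?B (T - t)\<close> and \<open>?A (T - t)\<close>
  have the final values 0 and \<open>\<theta>\<close>. At t = T the conserved expression is
  therefore \<open>w T \<theta>\<close>, and at t = 0 it is the evolution formula for the data
  \<open>w 0\<close> and \<open>w' 0\<close>.\<close>

lemma solution_eq_wave_evolution:
  fixes w :: "real \<Rightarrow> (real \<Rightarrow> 'a::{real_normed_field,euclidean_space}) \<Rightarrow> 'a"
  assumes \<alpha>: "4 * c\<^sup>2 * \<alpha>\<^sup>2 = k\<^sup>2 / 4" and w: "dist_C1_deriv w w'" and weak: "weak_solution k c w"
  shows "w T = wave_evolution \<alpha> c (w 0) (w' 0) T"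
proof
  fix \<theta> :: "real \<Rightarrow> 'a"
  show "w T \<theta> = wave_evolution \<alpha> c (w 0) (w' 0) T \<theta>"
  proof (cases "\<theta> \<in> test_functions")
    case False
    then show ?thesis
      using dist_outside[OF dist_C1_derivD(1)[OF w]] by (simp add: wave_evolution_def on_test_functions_def)
  next
    case \<theta>: True
    let ?L = "wave_operator k c"
    let ?B = "psi_conv \<alpha> c \<theta>" and ?A = "psi_t_conv \<alpha> c \<theta>"
    let ?S = "\<lambda>t. w' t (?B (T - t)) + w t (?A (T - t))"
    have tB: "?B t \<in> test_functions" and tA: "?A t \<in> test_functions" for t
      by (rule propagator_test_function[OF psi_conv_propagator \<theta>] propagator_test_function[OF psi_t_conv_propagator \<theta>])+
    have neg: "u (\<lambda>x. - \<phi> x) = - u \<phi>" if "u \<in> distributions" "\<phi> \<in> test_functions"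
      for u :: "(real \<Rightarrow> 'a) \<Rightarrow> 'a" and \<phi>
      using dist_scaleR[OF that, of "-1"] by simp
    \<comment> \<open>In w''(t), which is w(t) composed with \<open>?L\<close>, the operator acts
      after the propagator; in the time derivative of \<open>?A\<close> it acts before. This
      equation reconciles the two.\<close>
    have LB: "psi_conv \<alpha> c (?L \<theta>) t = ?L (?B t)" for t
      by (rule wave_operator_propagator[OF psi_conv_propagator \<theta>, symmetric])
    have "(?S has_vector_derivative
        (on_test_functions (\<lambda>\<phi>. w t (?L \<phi>)) (?B (T - t)) + w' t (\<lambda>x. - ?A (T - t) x))
        + (w' t (?A (T - t)) + w t (\<lambda>x. - psi_conv \<alpha> c (?L \<theta>) (T - t) x))) (at t)" for t
      by (intro has_vector_derivative_add dist_curve_product_rule[OF weak_solution_C2[OF w weak]]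
          dist_curve_product_rule[OF w] test_curve_deriv_reverse psi_conv_curve[OF \<theta>] psi_t_conv_curve[OF \<alpha> \<theta>])
    \<comment> \<open>Time reversal supplies the minus signs: the two terms with \<open>w'\<close>
      cancel, and those with \<open>w\<close> cancel by \<open>LB\<close>.\<close>
    then have "(?S has_vector_derivative 0) (at t)" for t
      using tB tA wave_operator_test_function(1)[OF tB]
      by (simp add: neg dist_C1_derivD(1,2)[OF w] LB on_test_functions_def)
    then have "\<exists>r. \<forall>t\<in>UNIV. ?S t = r"
      by (intro has_derivative_zero_constant) (auto simp: has_vector_derivative_def)
    then have "?S T = ?S 0" by (metis UNIV_I)
    then show ?thesis
      using \<theta> dist_zero[OF dist_C1_derivD(2)[OF w], of T]
      by (simp add: wave_evolution_def on_test_functions_def add.commute)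
  qed
qed

theorem theorem1p3:
  fixes k c :: real
    and f g v1 :: "(real \<Rightarrow> 'a::{real_normed_field,euclidean_space}) \<Rightarrow> 'a"
    and v :: "real \<Rightarrow> (real \<Rightarrow> 'a) \<Rightarrow> 'a"
  assumes "k > 0" and "c > 0"
    and "f \<in> distributions" and "g \<in> distributions"
  defines "v1 \<equiv> (\<lambda>\<phi>. g \<phi> + (k / 2) *\<^sub>R f \<phi>)"
    and "v \<equiv> (\<lambda>t. on_test_functions (\<lambda>\<phi>. f (psi_t k c t \<star> \<phi>) + v1 (psi k c t \<star> \<phi>)))"
  shows "solves_cauchy_problem k c f v1 v \<and>
         (\<forall>w. solves_cauchy_problem k c f v1 w \<longrightarrow> w = v)"
proof -
  define \<alpha> where "\<alpha> = k / (4 * c)"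
  \<comment> \<open>The form in which the choice of \<alpha> enters the calculus: it makes the
    equation for F produce the coefficient k^2 / 4.\<close>
  have \<alpha>: "4 * c\<^sup>2 * \<alpha>\<^sup>2 = k\<^sup>2 / 4"
    using \<open>c > 0\<close> by (simp add: \<alpha>_def power_divide power_mult_distrib)
  have v1: "v1 \<in> distributions"
    unfolding v1_def by (intro distributions_add distributions_scaleR assms(3,4))
  \<comment> \<open>On test functions the convolutions are the rescaled propagators, and elsewhere
    both sides are 0, so the two curves are equal as HOL functions.\<close>
  have v: "v = wave_evolution \<alpha> c f v1"
    unfolding v_def wave_evolution_def \<alpha>_def on_test_functions_def
    by (auto simp: fun_eq_iff psi_convolution psi_t_convolution assms(1,2))
  note C1 = wave_evolution_C1[OF \<alpha> assms(3) v1] and C2 = wave_evolution_C2[OF \<alpha> assms(3) v1]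
  have "solves_cauchy_problem k c f v1 v"
    unfolding solves_cauchy_problem_def v
    using C1 weak_solutionI[OF C1 C2] wave_evolution_0[OF assms(3) v1]
    by blast
  moreover have "w = v" if w: "solves_cauchy_problem k c f v1 w" for w
  proof -
    obtain w' where w: "dist_C1_deriv w w'" "weak_solution k c w" "w 0 = f" "w' 0 = v1"
      using w unfolding solves_cauchy_problem_def by blast
    show ?thesis
      using solution_eq_wave_evolution[OF \<alpha> w(1,2)] unfolding v w(3,4) by blast
  qed
  ultimately show ?thesis by blast
qed

end
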